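(* Let $I$ be a set. The full subcategory of the category $\mathrm{Mnd}(\mathbf{Set}^I)=\mathrm{Mon}(\mathrm{Endo}(\mathbf{Set}^I),\mathrm{Id},\circ)$ of monads on $\mathbf{Set}^I$ whose underlying endofunctors are extents of $I$-indexed containers is equivalent to the category $\mathbf{ICMS}$ of $I$-indexed containers equipped with an ICMS and ICMS morphisms.
   Context: $\mathbf{Set}^I$ is the category of $I$-indexed families of sets with families of functions as morphisms; $\mathrm{Hom}_I(X,Y)$ denotes its hom-sets. An indexed container $S\triangleleft P$ has $S:I\to\mathbf{Set}$ and $P_i(s):I\to\mathbf{Set}$ for $i\in I$, $s\in S_i$; its extent is the endofunctor $[\![S\triangleleft P]\!](X)_i=\sum_{s\in S_i}\mathrm{Hom}_I(P_i(s),X)$, acting on maps by postcomposition. Container morphisms $(\sigma,\pi):S\triangleleft P\to S'\triangleleft P'$ have $\sigma_i:S_i\to S'_i$ and $\pi_{i,s}\in\mathrm{Hom}_I(P'_i(\sigma_is),P_i(s))$. An ICMS on $S\triangleleft P$: $\mathsf{e}_i\in S_i$; $s\bullet_is'\in S_i$ for $s'\in\mathrm{Hom}_I(P_i(s),S)$; $P\mathsf{e}_{\equiv,i,j}:P_i(\mathsf{e}_i)(j)\to(i=j)$; for $p\in P_i(s\bullet s')(j)$: $\uparrow p\in I$, $\nwarrow p\in P_i(s)(\uparrow p)$, $\nearrow p\in P_{\uparrow p}(s'_{\uparrow p}(\nwarrow p))(j)$. With $\mathsf{e}^P_j(\_)=\mathsf{e}_j$, $\bar s_j(q)=s$ (transported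 along $P\mathsf{e}_{\equiv}(q)$), $(s'\bullet^Ps'')_k(q)=s'_k(q)\bullet_ks''_{k,q}$ (for $s''_{k,q}\in\mathrm{Hom}_I(P_k(s'_k q),S)$) and $\widehat{s''}_\ell(r)=(s''_{\uparrow r,\nwarrow r})_\ell(\nearrow r)$, required (heterogeneously, up to transport): $s\bullet\mathsf{e}^P=s$; $\nwarrow_{i,s,\mathsf{e}^P,j}p=p$; $\mathsf{e}_i\bullet\bar s=s$; $\nearrow_{i,\mathsf{e}_i,\bar s,j}p=p$; $(s\bullet s')\bullet\widehat{s''}=s\bullet(s'\bullet^Ps'')$; and for $p\in P_i((s\bullet s')\bullet\widehat{s''})(j)$, writing $\uparrow p,\nwarrow p,\nearrow p$ for $\uparrow_{i,s,s'\bullet^Ps'',j}p$ etc.: $\uparrow_{i,s\bullet s',\widehat{s''},j}p=\uparrow_{\uparrow p,s'(\nwarrow p),s''(\nwarrow p),j}(\nearrow p)$; $\uparrow_{i,s,s'}(\nwarrow_{i,s\bullet s',\widehat{s''},j}p)=\uparrow p$; $\nwarrow_{i,s,s'}(\nwarrow_{i,s\bullet s',\widehat{s''},j}p)=\nwarrow p$; $\nearrow_{i,s,s'}(\nwarrow_{i,s\bullet s',\widehat{s''},j}p)=\nwarrow_{\uparrow p,s'(\nwarrow p),s''(\nwarrow p),j}(\nearrow p)$; $\nearrow_{i,s\bullet s',\widehat{s''},j}p=\nearrow_{\uparrow p,s'(\nwarrow p),s''(\nwarrow p),j}(\nearrow p)$. An ICMS morphism is a container morphism $(\sigma,\pi)$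 with: $\sigma_i(\mathsf{e}_i)=\mathsf{e}'_i$; $P\mathsf{e}_{\equiv}(\pi_{i,\mathsf{e}_i}(q))=P\mathsf{e}'_{\equiv}(q)$; $\sigma_i(s)\bullet'(\pi_{i,s};v;\sigma)=\sigma_i(s\bullet v)$ (where $(\pi_{i,s};v;\sigma)_k(q)=\sigma_k(v_k(\pi_{i,s}q))$); and for $p\in P'_i(\sigma_i(s\bullet v))(j)$, with primed operations at $(i,\sigma_is,\pi_{i,s};v;\sigma,j)$: $\uparrow'p=\uparrow(\pi p)$, $\pi(\nwarrow'p)=\nwarrow(\pi p)$, $\pi(\nearrow'p)=\nearrow(\pi p)$. *)

theory Defs
  imports Main "HOL-Library.FuncSet"
begin

section \<open>Categories, functors, equivalence\<close>

text \<open>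
  Hom-sets are indexed by their endpoints and need not be disjoint, so identities, composition
  and the arrow part of a functor take the relevant objects as arguments.
  \<open>Comp C X Y Z g f\<close> is \<open>g\<close> after \<open>f\<close>, for \<open>f : X \<rightarrow> Y\<close> and \<open>g : Y \<rightarrow> Z\<close>.
  Functors and natural transformations are extensional (\<open>undefined\<close> outside their domain), so
  that HOL equality is equality of functors and of natural transformations.
\<close>

record ('o, 'a) category =
  Obj :: "'o set"
  Hom :: "'o \<Rightarrow> 'o \<Rightarrow> 'a set"
  Ident :: "'o \<Rightarrow> 'a"
  Comp :: "'o \<Rightarrow> 'o \<Rightarrow> 'o \<Rightarrow> 'a \<Rightarrow> 'a \<Rightarrow> 'a"

definition is_category :: "('o, 'a, 'z) category_scheme \<Rightarrow> bool" where
  "is_category C \<longleftrightarrow>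
     (\<forall>X\<in>Obj C. Ident C X \<in> Hom C X X) \<and>
     (\<forall>X\<in>Obj C. \<forall>Y\<in>Obj C. \<forall>Z\<in>Obj C. \<forall>f\<in>Hom C X Y. \<forall>g\<in>Hom C Y Z.
        Comp C X Y Z g f \<in> Hom C X Z) \<and>
     (\<forall>X\<in>Obj C. \<forall>Y\<in>Obj C. \<forall>f\<in>Hom C X Y.
        Comp C X X Y f (Ident C X) = f \<and> Comp C X Y Y (Ident C Y) f = f) \<and>
     (\<forall>W\<in>Obj C. \<forall>X\<in>Obj C. \<forall>Y\<in>Obj C. \<forall>Z\<in>Obj C.
        \<forall>f\<in>Hom C W X. \<forall>g\<in>Hom C X Y. \<forall>h\<in>Hom C Y Z.
        Comp C W X Z (Comp C X Y Z h g) f = Comp C W Y Z h (Comp C W X Y g f))"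

definition full_subcategory :: "('o, 'a) category \<Rightarrow> 'o set \<Rightarrow> ('o, 'a) category" where
  "full_subcategory C A = C\<lparr>Obj := Obj C \<inter> A\<rparr>"

record ('o, 'a, 'p, 'b) cfunctor =
  fobj :: "'o \<Rightarrow> 'p"
  farr :: "'o \<Rightarrow> 'o \<Rightarrow> 'a \<Rightarrow> 'b"

definition functors ::
  "('o, 'a, 'y) category_scheme \<Rightarrow> ('p, 'b, 'z) category_scheme \<Rightarrow> ('o, 'a, 'p, 'b) cfunctor set"
where
  "functors C D = {F.
     fobj F \<in> Obj C \<rightarrow>\<^sub>E Obj D \<and>
     farr F \<in> (\<Pi>\<^sub>E X\<in>Obj C. \<Pi>\<^sub>E Y\<in>Obj C. Hom C X Y \<rightarrow>\<^sub>E Hom D (fobj F X) (fobj F Y)) \<and>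
     (\<forall>X\<in>Obj C. farr F X X (Ident C X) = Ident D (fobj F X)) \<and>
     (\<forall>X\<in>Obj C. \<forall>Y\<in>Obj C. \<forall>Z\<in>Obj C. \<forall>f\<in>Hom C X Y. \<forall>g\<in>Hom C Y Z.
        farr F X Z (Comp C X Y Z g f) =
        Comp D (fobj F X) (fobj F Y) (fobj F Z) (farr F Y Z g) (farr F X Y f))}"

definition id_functor :: "('o, 'a, 'z) category_scheme \<Rightarrow> ('o, 'a, 'o, 'a) cfunctor" where
  "id_functor C = \<lparr>
     fobj = (\<lambda>X\<in>Obj C. X),
     farr = (\<lambda>X\<in>Obj C. \<lambda>Y\<in>Obj C. \<lambda>f\<in>Hom C X Y. f)\<rparr>"

text \<open>\<open>comp_functor C G F\<close> is \<open>G\<close> after \<open>F\<close>, where \<open>C\<close> is the domain of \<open>F\<close>.\<close>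

definition comp_functor ::
  "('o, 'a, 'z) category_scheme \<Rightarrow> ('p, 'b, 'q, 'c) cfunctor \<Rightarrow> ('o, 'a, 'p, 'b) cfunctor
     \<Rightarrow> ('o, 'a, 'q, 'c) cfunctor"
where
  "comp_functor C G F = \<lparr>
     fobj = (\<lambda>X\<in>Obj C. fobj G (fobj F X)),
     farr = (\<lambda>X\<in>Obj C. \<lambda>Y\<in>Obj C. \<lambda>f\<in>Hom C X Y.
               farr G (fobj F X) (fobj F Y) (farr F X Y f))\<rparr>"

definition nat_trans ::
  "('o, 'a, 'y) category_scheme \<Rightarrow> ('p, 'b, 'z) category_scheme
     \<Rightarrow> ('o, 'a, 'p, 'b) cfunctor \<Rightarrow> ('o, 'a, 'p, 'b) cfunctor \<Rightarrow> ('o \<Rightarrow> 'b) set"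
where
  "nat_trans C D F G = {\<alpha> \<in> (\<Pi>\<^sub>E X\<in>Obj C. Hom D (fobj F X) (fobj G X)).
     \<forall>X\<in>Obj C. \<forall>Y\<in>Obj C. \<forall>f\<in>Hom C X Y.
       Comp D (fobj F X) (fobj F Y) (fobj G Y) (\<alpha> Y) (farr F X Y f) =
       Comp D (fobj F X) (fobj G X) (fobj G Y) (farr G X Y f) (\<alpha> X)}"

definition is_iso :: "('o, 'a, 'z) category_scheme \<Rightarrow> 'o \<Rightarrow> 'o \<Rightarrow> 'a \<Rightarrow> bool" where
  "is_iso C X Y f \<longleftrightarrow> f \<in> Hom C X Y \<and>
     (\<exists>g\<in>Hom C Y X. Comp C X Y X g f = Ident C X \<and> Comp C Y X Y f g = Ident C Y)"

definition naturally_isomorphic ::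
  "('o, 'a, 'y) category_scheme \<Rightarrow> ('p, 'b, 'z) category_scheme
     \<Rightarrow> ('o, 'a, 'p, 'b) cfunctor \<Rightarrow> ('o, 'a, 'p, 'b) cfunctor \<Rightarrow> bool"
where
  "naturally_isomorphic C D F G \<longleftrightarrow>
     (\<exists>\<alpha>\<in>nat_trans C D F G. \<forall>X\<in>Obj C. is_iso D (fobj F X) (fobj G X) (\<alpha> X))"

definition equivalent_categories ::
  "('o, 'a, 'y) category_scheme \<Rightarrow> ('p, 'b, 'z) category_scheme \<Rightarrow> bool"
where
  "equivalent_categories C D \<longleftrightarrow> is_category C \<and> is_category D \<and>
     (\<exists>F\<in>functors C D. \<exists>G\<in>functors D C.
        naturally_isomorphic C C (comp_functor C G F) (id_functor C) \<and>
        naturally_isomorphic D D (comp_functor D F G) (id_functor D))"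


section \<open>Monoids in a strict monoidal category; endofunctors\<close>

text \<open>
  \<open>tensor_arr V X X' Y Y' f g : X \<otimes> Y \<rightarrow> X' \<otimes> Y'\<close> for \<open>f : X \<rightarrow> X'\<close> and \<open>g : Y \<rightarrow> Y'\<close>.
  Only strict monoidal structures are considered (composition of endofunctors is strictly
  associative and unital), so no associator or unitors occur in the monoid laws.
\<close>

record ('o, 'a) strict_monoidal = "('o, 'a) category" +
  tensor_obj :: "'o \<Rightarrow> 'o \<Rightarrow> 'o"
  tensor_arr :: "'o \<Rightarrow> 'o \<Rightarrow> 'o \<Rightarrow> 'o \<Rightarrow> 'a \<Rightarrow> 'a \<Rightarrow> 'a"
  tensor_unit :: "'o"

record ('o, 'a) mon_obj =
  underlying :: "'o"
  mon_unit :: "'a"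
  mon_mult :: "'a"

definition monoid_objects :: "('o, 'a) strict_monoidal \<Rightarrow> ('o, 'a) mon_obj set" where
  "monoid_objects V = {M.
     let T = underlying M; \<eta> = mon_unit M; \<mu> = mon_mult M; U = tensor_unit V;
         TT = tensor_obj V T T in
     T \<in> Obj V \<and> \<eta> \<in> Hom V U T \<and> \<mu> \<in> Hom V TT T \<and>
     Comp V (tensor_obj V U T) TT T \<mu> (tensor_arr V U T T T \<eta> (Ident V T)) = Ident V T \<and>
     Comp V (tensor_obj V T U) TT T \<mu> (tensor_arr V T T U T (Ident V T) \<eta>) = Ident V T \<and>
     Comp V (tensor_obj V TT T) TT T \<mu> (tensor_arr V TT T T T \<mu> (Ident V T)) =
     Comp V (tensor_obj V T TT) TT T \<mu> (tensor_arr V T T TT T (Ident V T) \<mu>)}"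

definition monoid_homs ::
  "('o, 'a) strict_monoidal \<Rightarrow> ('o, 'a) mon_obj \<Rightarrow> ('o, 'a) mon_obj \<Rightarrow> 'a set"
where
  "monoid_homs V M N = {f.
     let T = underlying M; T' = underlying N in
     f \<in> Hom V T T' \<and>
     Comp V (tensor_unit V) T T' f (mon_unit M) = mon_unit N \<and>
     Comp V (tensor_obj V T T) T T' f (mon_mult M) =
     Comp V (tensor_obj V T T) (tensor_obj V T' T') T' (mon_mult N) (tensor_arr V T T' T T' f f)}"

definition Mon :: "('o, 'a) strict_monoidal \<Rightarrow> (('o, 'a) mon_obj, 'a) category" where
  "Mon V = \<lparr>
     Obj = monoid_objects V,
     Hom = monoid_homs V,
     Ident = (\<lambda>M. Ident V (underlying M)),
     Comp = (\<lambda>L M N. Comp V (underlying L) (underlying M) (underlying N))\<rparr>"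

text \<open>The tensor of natural transformations is horizontal composition.\<close>

definition Endo ::
  "('o, 'a) category \<Rightarrow> (('o, 'a, 'o, 'a) cfunctor, 'o \<Rightarrow> 'a) strict_monoidal"
where
  "Endo C = \<lparr>
     Obj = functors C C,
     Hom = nat_trans C C,
     Ident = (\<lambda>F. \<lambda>X\<in>Obj C. Ident C (fobj F X)),
     Comp = (\<lambda>F G H \<beta> \<alpha>. \<lambda>X\<in>Obj C. Comp C (fobj F X) (fobj G X) (fobj H X) (\<beta> X) (\<alpha> X)),
     tensor_obj = comp_functor C,
     tensor_arr = (\<lambda>F F' G G' \<alpha> \<beta>. \<lambda>X\<in>Obj C.
        Comp C (fobj F (fobj G X)) (fobj F (fobj G' X)) (fobj F' (fobj G' X))
          (\<alpha> (fobj G' X)) (farr F (fobj G X) (fobj G' X) (\<beta> X))),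
     tensor_unit = id_functor C\<rparr>"


section \<open>A universe of sets\<close>

text \<open>
  HOL has no type of all sets, and an endofunctor on families of subsets of one fixed type could
  not contain the function spaces needed for extents. \<open>Set\<close> is therefore the category of sets of an
  arbitrary Grothendieck universe: every value of the type is a set, whose elements are again
  values of the type. Neither foundation nor infinity is required.
\<close>

class grothendieck_universe =
  fixes elts :: "'a \<Rightarrow> 'a set"
  assumes elts_extensional: "elts x = elts y \<Longrightarrow> x = y"
    and ex_subset: "A \<subseteq> elts x \<Longrightarrow> \<exists>y. elts y = A"
    and ex_pair: "\<exists>z. elts z = {x, y}"
    and ex_powerset: "\<exists>y. elts y = {z. elts z \<subseteq> elts x}"
    and ex_union: "\<exists>y. elts y = (\<Union>a\<in>elts x. elts (f a))"

text \<open>\<open>vset A\<close> is meaningful only if \<open>A\<close> is the set of elements of some member of the universe.\<close>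

definition vset :: "'u::grothendieck_universe set \<Rightarrow> 'u" where
  "vset A = (THE x. elts x = A)"

definition vpair :: "'u::grothendieck_universe \<Rightarrow> 'u \<Rightarrow> 'u" where
  "vpair a b = vset {vset {a}, vset {a, b}}"

definition vfst :: "'u::grothendieck_universe \<Rightarrow> 'u" where
  "vfst z = (THE a. \<exists>b. z = vpair a b)"

definition vsnd :: "'u::grothendieck_universe \<Rightarrow> 'u" where
  "vsnd z = (THE b. \<exists>a. z = vpair a b)"

definition vsigma :: "'u::grothendieck_universe \<Rightarrow> ('u \<Rightarrow> 'u) \<Rightarrow> 'u" where
  "vsigma A B = vset {vpair a b | a b. a \<in> elts A \<and> b \<in> elts (B a)}"

text \<open>The graph of \<open>f\<close> on \<open>A\<close>, and application of a graph.\<close>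

definition vlam :: "'u::grothendieck_universe \<Rightarrow> ('u \<Rightarrow> 'u) \<Rightarrow> 'u" where
  "vlam A f = vset {vpair x (f x) | x. x \<in> elts A}"

definition vapp :: "'u::grothendieck_universe \<Rightarrow> 'u \<Rightarrow> 'u" where
  "vapp f x = (THE y. vpair x y \<in> elts f)"


section \<open>Families of sets\<close>

definition fam_hom ::
  "'u::grothendieck_universe \<Rightarrow> ('u \<Rightarrow> 'u) \<Rightarrow> ('u \<Rightarrow> 'u) \<Rightarrow> ('u \<Rightarrow> 'u \<Rightarrow> 'u) set"
where
  "fam_hom I X Y = (\<Pi>\<^sub>E i\<in>elts I. elts (X i) \<rightarrow>\<^sub>E elts (Y i))"

definition fam_id :: "'u::grothendieck_universe \<Rightarrow> ('u \<Rightarrow> 'u) \<Rightarrow> 'u \<Rightarrow> 'u \<Rightarrow> 'u" where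
  "fam_id I X = (\<lambda>i\<in>elts I. \<lambda>x\<in>elts (X i). x)"

definition fam_comp ::
  "'u::grothendieck_universe \<Rightarrow> ('u \<Rightarrow> 'u) \<Rightarrow> ('u \<Rightarrow> 'u \<Rightarrow> 'u) \<Rightarrow> ('u \<Rightarrow> 'u \<Rightarrow> 'u)
     \<Rightarrow> 'u \<Rightarrow> 'u \<Rightarrow> 'u"
where
  "fam_comp I X g f = (\<lambda>i\<in>elts I. \<lambda>x\<in>elts (X i). g i (f i x))"

definition SetFam :: "'u::grothendieck_universe \<Rightarrow> ('u \<Rightarrow> 'u, 'u \<Rightarrow> 'u \<Rightarrow> 'u) category" where
  "SetFam I = \<lparr>
     Obj = elts I \<rightarrow>\<^sub>E UNIV,
     Hom = fam_hom I,
     Ident = fam_id I,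
     Comp = (\<lambda>X Y Z. fam_comp I X)\<rparr>"

type_synonym 'u endo =
  "('u \<Rightarrow> 'u, 'u \<Rightarrow> 'u \<Rightarrow> 'u, 'u \<Rightarrow> 'u, 'u \<Rightarrow> 'u \<Rightarrow> 'u) cfunctor"

type_synonym 'u endo_trans = "('u \<Rightarrow> 'u) \<Rightarrow> 'u \<Rightarrow> 'u \<Rightarrow> 'u"

definition Mnd ::
  "'u::grothendieck_universe \<Rightarrow> (('u endo, 'u endo_trans) mon_obj, 'u endo_trans) category"
where
  "Mnd I = Mon (Endo (SetFam I))"

text \<open>
  The hom-set \<open>fam_hom I X Y\<close> as a member of the universe: \<open>fam_code\<close> turns a family of functions
  into the family of their graphs, and \<open>fam_decode\<close> goes back.
\<close>

definition fam_code ::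
  "'u::grothendieck_universe \<Rightarrow> ('u \<Rightarrow> 'u) \<Rightarrow> ('u \<Rightarrow> 'u \<Rightarrow> 'u) \<Rightarrow> 'u"
where
  "fam_code I X h = vlam I (\<lambda>i. vlam (X i) (h i))"

definition fam_decode ::
  "'u::grothendieck_universe \<Rightarrow> ('u \<Rightarrow> 'u) \<Rightarrow> 'u \<Rightarrow> 'u \<Rightarrow> 'u \<Rightarrow> 'u"
where
  "fam_decode I X c = (\<lambda>i\<in>elts I. \<lambda>x\<in>elts (X i). vapp (vapp c i) x)"

definition vhom :: "'u::grothendieck_universe \<Rightarrow> ('u \<Rightarrow> 'u) \<Rightarrow> ('u \<Rightarrow> 'u) \<Rightarrow> 'u" where
  "vhom I X Y = vset (fam_code I X ` fam_hom I X Y)"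


section \<open>Indexed containers\<close>

record 'u icontainer =
  shp :: "'u \<Rightarrow> 'u"
  pos :: "'u \<Rightarrow> 'u \<Rightarrow> 'u \<Rightarrow> 'u"

definition icontainers :: "'u::grothendieck_universe \<Rightarrow> 'u icontainer set" where
  "icontainers I = {K.
     shp K \<in> elts I \<rightarrow>\<^sub>E UNIV \<and>
     pos K \<in> (\<Pi>\<^sub>E i\<in>elts I. \<Pi>\<^sub>E s\<in>elts (shp K i). elts I \<rightarrow>\<^sub>E UNIV)}"

definition extent_obj ::
  "'u::grothendieck_universe \<Rightarrow> 'u icontainer \<Rightarrow> ('u \<Rightarrow> 'u) \<Rightarrow> 'u \<Rightarrow> 'u"
where
  "extent_obj I K X = (\<lambda>i\<in>elts I. vsigma (shp K i) (\<lambda>s. vhom I (pos K i s) X))"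

definition extent ::
  "'u::grothendieck_universe \<Rightarrow> 'u icontainer \<Rightarrow> 'u endo"
where
  "extent I K = \<lparr>
     fobj = (\<lambda>X\<in>Obj (SetFam I). extent_obj I K X),
     farr = (\<lambda>X\<in>Obj (SetFam I). \<lambda>Y\<in>Obj (SetFam I). \<lambda>f\<in>Hom (SetFam I) X Y.
       \<lambda>i\<in>elts I. \<lambda>u\<in>elts (extent_obj I K X i).
         (let s = vfst u; h = fam_decode I (pos K i s) (vsnd u) in
          vpair s (fam_code I (pos K i s) (fam_comp I (pos K i s) f h))))\<rparr>"

text \<open>In a container morphism \<open>(\<sigma>, \<pi>)\<close>, the positions component \<open>\<pi>\<close> takes \<open>i\<close>, \<open>s\<close>, \<open>j\<close> and a position.\<close>

type_synonym 'u icontainer_mor = "('u \<Rightarrow> 'u \<Rightarrow> 'u) \<times> ('u \<Rightarrow> 'u \<Rightarrow> 'u \<Rightarrow> 'u \<Rightarrow> 'u)"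

definition icontainer_homs ::
  "'u::grothendieck_universe \<Rightarrow> ('u, 'y) icontainer_scheme \<Rightarrow> ('u, 'z) icontainer_scheme
     \<Rightarrow> 'u icontainer_mor set"
where
  "icontainer_homs I K K' = {(\<sigma>, \<pi>).
     \<sigma> \<in> (\<Pi>\<^sub>E i\<in>elts I. elts (shp K i) \<rightarrow>\<^sub>E elts (shp K' i)) \<and>
     \<pi> \<in> (\<Pi>\<^sub>E i\<in>elts I. \<Pi>\<^sub>E s\<in>elts (shp K i). fam_hom I (pos K' i (\<sigma> i s)) (pos K i s))}"

definition icontainer_id ::
  "'u::grothendieck_universe \<Rightarrow> ('u, 'z) icontainer_scheme \<Rightarrow> 'u icontainer_mor"
where
  "icontainer_id I K =
     (fam_id I (shp K), \<lambda>i\<in>elts I. \<lambda>s\<in>elts (shp K i). fam_id I (pos K i s))"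

text \<open>\<open>icontainer_comp I K K' K'' g f\<close> is \<open>g : K' \<rightarrow> K''\<close> after \<open>f : K \<rightarrow> K'\<close>.\<close>

definition icontainer_comp ::
  "'u::grothendieck_universe \<Rightarrow> ('u, 'x) icontainer_scheme \<Rightarrow> ('u, 'y) icontainer_scheme
     \<Rightarrow> ('u, 'z) icontainer_scheme \<Rightarrow> 'u icontainer_mor \<Rightarrow> 'u icontainer_mor
     \<Rightarrow> 'u icontainer_mor"
where
  "icontainer_comp I K K' K'' = (\<lambda>(\<sigma>', \<pi>') (\<sigma>, \<pi>).
     (fam_comp I (shp K) \<sigma>' \<sigma>,
      \<lambda>i\<in>elts I. \<lambda>s\<in>elts (shp K i).
        fam_comp I (pos K'' i (\<sigma>' i (\<sigma> i s))) (\<pi> i s) (\<pi>' i (\<sigma> i s))))"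


section \<open>Indexed container monad structures\<close>

text \<open>
  The components of an ICMS on a container: \<open>ie i\<close> is \<open>e\<close>, \<open>ibul i s s'\<close> is \<open>s \<bullet> s'\<close>, and
  \<open>up i s s' j p\<close>, \<open>nw i s s' j p\<close>, \<open>ne i s s' j p\<close> are the images of the position \<open>p\<close> of
  \<open>s \<bullet> s'\<close> under the three arrows. The equality type \<open>i = j\<close> in the codomain of \<open>pe i j\<close> is
  the subsingleton \<open>{u :: unit. i = j}\<close>. Where the laws equate elements of sets that agree only by
  previous equations, HOL equality of members of the universe plays the role of heterogeneous
  equality.
\<close>

record 'u icms = "'u icontainer" +
  ie :: "'u \<Rightarrow> 'u"
  ibul :: "'u \<Rightarrow> 'u \<Rightarrow> ('u \<Rightarrow> 'u \<Rightarrow> 'u) \<Rightarrow> 'u"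
  pe :: "'u \<Rightarrow> 'u \<Rightarrow> 'u \<Rightarrow> unit"
  up :: "'u \<Rightarrow> 'u \<Rightarrow> ('u \<Rightarrow> 'u \<Rightarrow> 'u) \<Rightarrow> 'u \<Rightarrow> 'u \<Rightarrow> 'u"
  nw :: "'u \<Rightarrow> 'u \<Rightarrow> ('u \<Rightarrow> 'u \<Rightarrow> 'u) \<Rightarrow> 'u \<Rightarrow> 'u \<Rightarrow> 'u"
  ne :: "'u \<Rightarrow> 'u \<Rightarrow> ('u \<Rightarrow> 'u \<Rightarrow> 'u) \<Rightarrow> 'u \<Rightarrow> 'u \<Rightarrow> 'u"

definition icms_typed :: "'u::grothendieck_universe \<Rightarrow> 'u icms \<Rightarrow> bool" where
  "icms_typed I M \<longleftrightarrow>
     icontainer.truncate M \<in> icontainers I \<and>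
     ie M \<in> (\<Pi>\<^sub>E i\<in>elts I. elts (shp M i)) \<and>
     ibul M \<in> (\<Pi>\<^sub>E i\<in>elts I. \<Pi>\<^sub>E s\<in>elts (shp M i).
       fam_hom I (pos M i s) (shp M) \<rightarrow>\<^sub>E elts (shp M i)) \<and>
     pe M \<in> (\<Pi>\<^sub>E i\<in>elts I. \<Pi>\<^sub>E j\<in>elts I. elts (pos M i (ie M i) j) \<rightarrow>\<^sub>E {u. i = j}) \<and>
     up M \<in> (\<Pi>\<^sub>E i\<in>elts I. \<Pi>\<^sub>E s\<in>elts (shp M i). \<Pi>\<^sub>E s'\<in>fam_hom I (pos M i s) (shp M).
       \<Pi>\<^sub>E j\<in>elts I. \<Pi>\<^sub>E p\<in>elts (pos M i (ibul M i s s') j). elts I) \<and>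
     nw M \<in> (\<Pi>\<^sub>E i\<in>elts I. \<Pi>\<^sub>E s\<in>elts (shp M i). \<Pi>\<^sub>E s'\<in>fam_hom I (pos M i s) (shp M).
       \<Pi>\<^sub>E j\<in>elts I. \<Pi>\<^sub>E p\<in>elts (pos M i (ibul M i s s') j).
         elts (pos M i s (up M i s s' j p))) \<and>
     ne M \<in> (\<Pi>\<^sub>E i\<in>elts I. \<Pi>\<^sub>E s\<in>elts (shp M i). \<Pi>\<^sub>E s'\<in>fam_hom I (pos M i s) (shp M).
       \<Pi>\<^sub>E j\<in>elts I. \<Pi>\<^sub>E p\<in>elts (pos M i (ibul M i s s') j).
         elts (pos M (up M i s s' j p) (s' (up M i s s' j p) (nw M i s s' j p)) j))"

definition unit_fam ::
  "'u::grothendieck_universe \<Rightarrow> 'u icms \<Rightarrow> 'u \<Rightarrow> 'u \<Rightarrow> 'u \<Rightarrow> 'u \<Rightarrow> 'u"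
where
  "unit_fam I M i s = (\<lambda>j\<in>elts I. \<lambda>q\<in>elts (pos M i s j). ie M j)"

definition const_fam ::
  "'u::grothendieck_universe \<Rightarrow> 'u icms \<Rightarrow> 'u \<Rightarrow> 'u \<Rightarrow> 'u \<Rightarrow> 'u \<Rightarrow> 'u"
where
  "const_fam I M i s = (\<lambda>j\<in>elts I. \<lambda>q\<in>elts (pos M i (ie M i) j). s)"

definition bul_fam ::
  "'u::grothendieck_universe \<Rightarrow> 'u icms \<Rightarrow> 'u \<Rightarrow> 'u \<Rightarrow> ('u \<Rightarrow> 'u \<Rightarrow> 'u)
     \<Rightarrow> ('u \<Rightarrow> 'u \<Rightarrow> 'u \<Rightarrow> 'u \<Rightarrow> 'u) \<Rightarrow> 'u \<Rightarrow> 'u \<Rightarrow> 'u"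
where
  "bul_fam I M i s s' s'' = (\<lambda>k\<in>elts I. \<lambda>q\<in>elts (pos M i s k). ibul M k (s' k q) (s'' k q))"

definition hat_fam ::
  "'u::grothendieck_universe \<Rightarrow> 'u icms \<Rightarrow> 'u \<Rightarrow> 'u \<Rightarrow> ('u \<Rightarrow> 'u \<Rightarrow> 'u)
     \<Rightarrow> ('u \<Rightarrow> 'u \<Rightarrow> 'u \<Rightarrow> 'u \<Rightarrow> 'u) \<Rightarrow> 'u \<Rightarrow> 'u \<Rightarrow> 'u"
where
  "hat_fam I M i s s' s'' = (\<lambda>l\<in>elts I. \<lambda>r\<in>elts (pos M i (ibul M i s s') l).
     s'' (up M i s s' l r) (nw M i s s' l r) l (ne M i s s' l r))"

text \<open>
  The unit laws for \<open>nw\<close> and \<open>ne\<close> are well-typed because \<open>pe\<close>, applied to the \<open>ne\<close> (respectively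
  \<open>nw\<close>) component of \<open>p\<close>, gives \<open>up p = j\<close> (respectively \<open>i = up p\<close>).
\<close>

definition icms_laws :: "'u::grothendieck_universe \<Rightarrow> 'u icms \<Rightarrow> bool" where
  "icms_laws I M \<longleftrightarrow>
     (\<forall>i\<in>elts I. \<forall>s\<in>elts (shp M i).
        ibul M i s (unit_fam I M i s) = s \<and>
        (\<forall>j\<in>elts I. \<forall>p\<in>elts (pos M i s j). nw M i s (unit_fam I M i s) j p = p) \<and>
        ibul M i (ie M i) (const_fam I M i s) = s \<and>
        (\<forall>j\<in>elts I. \<forall>p\<in>elts (pos M i s j). ne M i (ie M i) (const_fam I M i s) j p = p)) \<and>
     (\<forall>i\<in>elts I. \<forall>s\<in>elts (shp M i). \<forall>s'\<in>fam_hom I (pos M i s) (shp M).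
      \<forall>s''\<in>(\<Pi>\<^sub>E k\<in>elts I. \<Pi>\<^sub>E q\<in>elts (pos M i s k). fam_hom I (pos M k (s' k q)) (shp M)).
        let t = ibul M i s s'; h = hat_fam I M i s s' s''; b = bul_fam I M i s s' s'' in
        ibul M i t h = ibul M i s b \<and>
        (\<forall>j\<in>elts I. \<forall>p\<in>elts (pos M i (ibul M i t h) j).
           let k = up M i s b j p; q = nw M i s b j p; r = ne M i s b j p;
               l = up M i t h j p; p' = nw M i t h j p in
           l = up M k (s' k q) (s'' k q) j r \<and>
           up M i s s' l p' = k \<and>
           nw M i s s' l p' = q \<and>
           ne M i s s' l p' = nw M k (s' k q) (s'' k q) j r \<and>
           ne M i t h j p = ne M k (s' k q) (s'' k q) j r))"

definition icms_homs ::
  "'u::grothendieck_universe \<Rightarrow> 'u icms \<Rightarrow> 'u icms \<Rightarrow> 'u icontainer_mor set"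
where
  "icms_homs I M M' = {(\<sigma>, \<pi>) \<in> icontainer_homs I M M'.
     (\<forall>i\<in>elts I.
        \<sigma> i (ie M i) = ie M' i \<and>
        (\<forall>j\<in>elts I. \<forall>q\<in>elts (pos M' i (ie M' i) j).
           pe M i j (\<pi> i (ie M i) j q) = pe M' i j q)) \<and>
     (\<forall>i\<in>elts I. \<forall>s\<in>elts (shp M i). \<forall>v\<in>fam_hom I (pos M i s) (shp M).
        let w = (\<lambda>k\<in>elts I. \<lambda>q\<in>elts (pos M' i (\<sigma> i s) k). \<sigma> k (v k (\<pi> i s k q)));
            t = ibul M i s v in
        ibul M' i (\<sigma> i s) w = \<sigma> i t \<and>
        (\<forall>j\<in>elts I. \<forall>p\<in>elts (pos M' i (\<sigma> i t) j).
           let k = up M' i (\<sigma> i s) w j p; q = nw M' i (\<sigma> i s) w j p; r = ne M' i (\<sigma> i s) w j p in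
           k = up M i s v j (\<pi> i t j p) \<and>
           \<pi> i s k q = nw M i s v j (\<pi> i t j p) \<and>
           \<pi> k (v k (\<pi> i s k q)) j r = ne M i s v j (\<pi> i t j p)))}"

definition ICMS :: "'u::grothendieck_universe \<Rightarrow> ('u icms, 'u icontainer_mor) category" where
  "ICMS I = \<lparr>
     Obj = {M. icms_typed I M \<and> icms_laws I M},
     Hom = icms_homs I,
     Ident = icontainer_id I,
     Comp = icontainer_comp I\<rparr>"

end

theory Submission
  imports Defs
begin

text \<open>
  A natural transformation into an extent is determined, by the Yoneda argument, by its values on
  universal elements. Such elements exist for every extent (the shape \<open>s\<close> with the identity on its
  positions), for the identity functor, and for the iterates of an extent (nested shapes whose
  positions are labelled by themselves). Evaluating at them turns unit, multiplication and monad
  morphisms into the data of an ICMS and of its morphisms; comparing shapes and labels on the two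
  sides of each monad law gives exactly the corresponding ICMS law. Hence \<open>M \<mapsto> monad_of M\<close> is
  fully faithful and surjective on objects, which also transports the category laws to \<open>ICMS\<close>.
\<close>

section \<open>Sets in the universe\<close>

text \<open>The rest is bookkeeping about codes. Hom-sets must be members of the universe, so a
  family of labels enters an extent only through its graph; \<open>ext_elt\<close> hides this
  coding, and \<open>ext_elt_eq_iff\<close> splits an equation in an extent into one between shapes
  and one between labels at each position. Codes are canonical, and functors and transformations are
  extensional, so \<open>monad_of\<close> reaches every monad on an extent up to equality, not
  merely up to isomorphism. The iterated extent behaves like the extent of a composite container: a
  shape is \<open>s\<close> with a family \<open>s'\<close> of shapes, and a position at
  \<open>j\<close> is a triple of an index \<open>k\<close>, a position \<open>q\<close> of
  \<open>s\<close> at \<open>k\<close> and a position of \<open>s' k q\<close> at \<open>j\<close>.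
  This is why a multiplication amounts to a shape operation and three arrows: \<open>up\<close>,
  \<open>nw\<close> and \<open>ne\<close> are the components of one such triple. Likewise the
  identity functor is represented by one shape whose only position at \<open>i\<close> has index
  \<open>i\<close>, which is the origin of \<open>pe\<close>.\<close>

definition small :: "'u::grothendieck_universe set \<Rightarrow> bool" where
  "small A \<longleftrightarrow> (\<exists>x. elts x = A)"

lemma elts_vset [simp]:
  assumes "small A"
  shows "elts (vset A) = A"
proof -
  from assms obtain x where x: "elts x = A"
    unfolding small_def by blast
  then have "(THE x. elts x = A) = x"
    by (intro the_equality) (auto intro: elts_extensional)
  with x show ?thesis
    unfolding vset_def by simp
qed

lemma small_elts [simp]: "small (elts x)"
  unfolding small_def by blast

lemma small_subset: "small A \<Longrightarrow> B \<subseteq> A \<Longrightarrow> small B"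
  unfolding small_def using ex_subset by metis

lemma small_pair [simp]: "small {a, b}"
  unfolding small_def by (rule ex_pair)

lemma small_singleton [simp]: "small {a}"
  using small_pair[of a a] by simp

lemma small_empty [simp]: "small {}"
  by (rule small_subset[OF small_singleton]) simp

lemma small_UN:
  fixes F :: "'u::grothendieck_universe \<Rightarrow> 'u set"
  shows "small A \<Longrightarrow> (\<And>a. a \<in> A \<Longrightarrow> small (F a)) \<Longrightarrow> small (\<Union>a\<in>A. F a)"
  using ex_union[where x = "vset A" and f = "\<lambda>a. vset (F a)"] unfolding small_def[of "\<Union>a\<in>A. F a"] by simp

lemma small_image:
  fixes f :: "'u::grothendieck_universe \<Rightarrow> 'u"
  shows "small A \<Longrightarrow> small (f ` A)"
  using small_UN[of A "\<lambda>a. {f a}"] by (simp add: UNION_singleton_eq_range)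

lemma small_subsets: "small {z. elts z \<subseteq> elts x}"
  unfolding small_def by (rule ex_powerset)

lemma vset_eq_iff: "small A \<Longrightarrow> small B \<Longrightarrow> vset A = vset B \<longleftrightarrow> A = B"
  by (metis elts_vset)

lemma vpair_eq_iff [simp]: "vpair a b = vpair c d \<longleftrightarrow> a = c \<and> b = d"
  unfolding vpair_def by (auto simp: vset_eq_iff doubleton_eq_iff singleton_insert_inj_eq
      singleton_insert_inj_eq' dest!: sym[of "vset _"])

lemma vfst_vpair [simp]: "vfst (vpair a b) = a"
  unfolding vfst_def by auto

lemma vsnd_vpair [simp]: "vsnd (vpair a b) = b"
  unfolding vsnd_def by auto

lemma elts_vsigma [simp]:
  "elts (vsigma A B) = {vpair a b | a b. a \<in> elts A \<and> b \<in> elts (B a)}"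
proof -
  have "{vpair a b | a b. a \<in> elts A \<and> b \<in> elts (B a)} = (\<Union>a\<in>elts A. vpair a ` elts (B a))"
    by auto
  then show ?thesis
    unfolding vsigma_def by (simp add: small_UN small_image)
qed

lemma elts_vlam: "elts (vlam A f) = (\<lambda>x. vpair x (f x)) ` elts A"
  unfolding vlam_def by (simp add: small_image Setcompr_eq_image)

lemma vapp_vlam [simp]: "x \<in> elts A \<Longrightarrow> vapp (vlam A f) x = f x"
  unfolding vapp_def elts_vlam by auto

text \<open>No bound on the size of \<open>H\<close> is needed: each graph is a subset of
  \<open>vsigma A B\<close>, so all of them lie in one powerset.\<close>

lemma small_vlam_image:
  assumes "\<And>f x. f \<in> H \<Longrightarrow> x \<in> elts A \<Longrightarrow> f x \<in> elts (B x)"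
  shows "small (vlam A ` H)"
proof (rule small_subset[OF small_subsets])
  show "vlam A ` H \<subseteq> {z. elts z \<subseteq> elts (vsigma A B)}"
    using assms by (auto simp: elts_vlam)
qed

section \<open>Families of functions\<close>

context
  fixes I :: "'u::grothendieck_universe"
begin

abbreviation fam_lam :: "('u \<Rightarrow> 'u) \<Rightarrow> ('u \<Rightarrow> 'u \<Rightarrow> 'b) \<Rightarrow> 'u \<Rightarrow> 'u \<Rightarrow> 'b" where
  "fam_lam X f \<equiv> (\<lambda>i\<in>elts I. \<lambda>x\<in>elts (X i). f i x)"

abbreviation fam_Pi :: "('u \<Rightarrow> 'u) \<Rightarrow> ('u \<Rightarrow> 'u \<Rightarrow> 'b set) \<Rightarrow> ('u \<Rightarrow> 'u \<Rightarrow> 'b) set" where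
  "fam_Pi X B \<equiv> (\<Pi>\<^sub>E i\<in>elts I. \<Pi>\<^sub>E x\<in>elts (X i). B i x)"

lemma fam_lam_eqI:
  "(\<And>i x. i \<in> elts I \<Longrightarrow> x \<in> elts (X i) \<Longrightarrow> f i x = g i x) \<Longrightarrow> fam_lam X f = fam_lam X g"
  by (auto intro!: restrict_ext)

lemma fam_Pi_lamI:
  "(\<And>i x. i \<in> elts I \<Longrightarrow> x \<in> elts (X i) \<Longrightarrow> f i x \<in> B i x) \<Longrightarrow> fam_lam X f \<in> fam_Pi X B"
  by auto

lemma fam_Pi_mem: "h \<in> fam_Pi X B \<Longrightarrow> i \<in> elts I \<Longrightarrow> x \<in> elts (X i) \<Longrightarrow> h i x \<in> B i x"
  by (blast dest: PiE_mem)

text \<open>The codomains \<open>B\<close> and \<open>B'\<close> may differ. Position maps over two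
  different shape maps can thus be compared although their types are written differently.\<close>

lemma fam_Pi_eqI:
  assumes "h \<in> fam_Pi X B" "h' \<in> fam_Pi X B'"
    and "\<And>i x. i \<in> elts I \<Longrightarrow> x \<in> elts (X i) \<Longrightarrow> h i x = h' i x"
  shows "h = h'"
proof (rule extensionalityI[of _ "elts I"])
  fix i assume i: "i \<in> elts I"
  show "h i = h' i"
    using PiE_mem[OF assms(1) i] PiE_mem[OF assms(2) i] assms(3)[OF i]
    by (auto simp: PiE_iff intro: extensionalityI)
qed (use assms in \<open>simp_all add: PiE_iff\<close>)

lemma fam_hom_eq_Pi: "fam_hom I X Y = fam_Pi X (\<lambda>i x. elts (Y i))"
  unfolding fam_hom_def ..

lemma fam_hom_mem:
  "h \<in> fam_hom I X Y \<Longrightarrow> i \<in> elts I \<Longrightarrow> x \<in> elts (X i) \<Longrightarrow> h i x \<in> elts (Y i)"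
  unfolding fam_hom_eq_Pi by (rule fam_Pi_mem)

lemma fam_hom_lamI:
  "(\<And>i x. i \<in> elts I \<Longrightarrow> x \<in> elts (X i) \<Longrightarrow> f i x \<in> elts (Y i)) \<Longrightarrow> fam_lam X f \<in> fam_hom I X Y"
  unfolding fam_hom_eq_Pi by (rule fam_Pi_lamI)

lemma fam_hom_eqI:
  assumes "h \<in> fam_hom I X Y" "h' \<in> fam_hom I X Y'"
    and "\<And>i x. i \<in> elts I \<Longrightarrow> x \<in> elts (X i) \<Longrightarrow> h i x = h' i x"
  shows "h = h'"
  using assms unfolding fam_hom_eq_Pi by (rule fam_Pi_eqI)

lemma fam_id_app [simp]: "i \<in> elts I \<Longrightarrow> x \<in> elts (X i) \<Longrightarrow> fam_id I X i x = x"
  unfolding fam_id_def by simp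

lemma fam_comp_app [simp]:
  "i \<in> elts I \<Longrightarrow> x \<in> elts (X i) \<Longrightarrow> fam_comp I X g f i x = g i (f i x)"
  unfolding fam_comp_def by simp

lemma fam_id_hom [simp]: "fam_id I X \<in> fam_hom I X X"
  unfolding fam_id_def by (rule fam_hom_lamI)

lemma fam_comp_hom:
  "f \<in> fam_hom I X Y \<Longrightarrow> g \<in> fam_hom I Y Z \<Longrightarrow> fam_comp I X g f \<in> fam_hom I X Z"
  unfolding fam_comp_def by (rule fam_hom_lamI) (blast intro: fam_hom_mem)

lemma fam_comp_assoc:
  "f \<in> fam_hom I W X \<Longrightarrow>
    fam_comp I W (fam_comp I X h g) f = fam_comp I W h (fam_comp I W g f)"
  unfolding fam_comp_def by (rule fam_lam_eqI) (simp add: fam_hom_mem)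

lemma SetFam_simps [simp]:
  "Obj (SetFam I) = elts I \<rightarrow>\<^sub>E UNIV" "Hom (SetFam I) = fam_hom I" "Ident (SetFam I) = fam_id I"
  "Comp (SetFam I) X Y Z = fam_comp I X"
  unfolding SetFam_def by simp_all

text \<open>Smallness is obtained in two layers: \<open>W i\<close> collects the graphs of all
  functions from \<open>X i\<close> to \<open>Y i\<close>, and a coded family is itself a graph over
  \<open>I\<close> with values in the sets \<open>W i\<close>.\<close>

lemma elts_vhom [simp]: "elts (vhom I X Y) = fam_code I X ` fam_hom I X Y"
proof -
  define W where "W = (\<lambda>i. vset (vlam (X i) ` {f. \<forall>x\<in>elts (X i). f x \<in> elts (Y i)}))"
  have W: "elts (W i) = vlam (X i) ` {f. \<forall>x\<in>elts (X i). f x \<in> elts (Y i)}" for i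
    unfolding W_def by (rule elts_vset, rule small_vlam_image[where B = "\<lambda>_. Y i"]) simp
  have "small (vlam I ` (\<lambda>h i. vlam (X i) (h i)) ` fam_hom I X Y)"
    by (rule small_vlam_image[where B = W]) (auto simp: W fam_hom_mem)
  then show ?thesis
    unfolding vhom_def by (simp add: image_image fam_code_def)
qed


section \<open>Endofunctors and monads on families\<close>

abbreviation Fam :: "('u \<Rightarrow> 'u) set" where
  "Fam \<equiv> elts I \<rightarrow>\<^sub>E UNIV"

abbreviation endofunctors :: "'u endo set" where
  "endofunctors \<equiv> functors (SetFam I) (SetFam I)"

abbreviation Trans :: "'u endo \<Rightarrow> 'u endo \<Rightarrow> 'u endo_trans set" where
  "Trans \<equiv> nat_trans (SetFam I) (SetFam I)"

abbreviation endo_comp :: "'u endo \<Rightarrow> 'u endo \<Rightarrow> 'u endo" where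
  "endo_comp \<equiv> comp_functor (SetFam I)"

lemma comp_functor_simps [simp]:
  "X \<in> Fam \<Longrightarrow> fobj (endo_comp G F) X = fobj G (fobj F X)"
  "X \<in> Fam \<Longrightarrow> Y \<in> Fam \<Longrightarrow> f \<in> fam_hom I X Y \<Longrightarrow>
    farr (endo_comp G F) X Y f = farr G (fobj F X) (fobj F Y) (farr F X Y f)"
  unfolding comp_functor_def by simp_all

lemma id_functor_simps [simp]:
  "X \<in> Fam \<Longrightarrow> fobj (id_functor (SetFam I)) X = X"
  "X \<in> Fam \<Longrightarrow> Y \<in> Fam \<Longrightarrow> f \<in> fam_hom I X Y \<Longrightarrow> farr (id_functor (SetFam I)) X Y f = f"
  unfolding id_functor_def by simp_all

lemma fobj_Fam [simp]: "T \<in> endofunctors \<Longrightarrow> X \<in> Fam \<Longrightarrow> fobj T X \<in> Fam"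
  unfolding functors_def by auto

lemma farr_hom:
  assumes "T \<in> endofunctors" "X \<in> Fam" "Y \<in> Fam" "f \<in> fam_hom I X Y"
  shows "farr T X Y f \<in> fam_hom I (fobj T X) (fobj T Y)"
proof -
  have "farr T \<in> (\<Pi>\<^sub>E X\<in>Fam. \<Pi>\<^sub>E Y\<in>Fam. fam_hom I X Y \<rightarrow>\<^sub>E fam_hom I (fobj T X) (fobj T Y))"
    using assms(1) unfolding functors_def by simp
  then show ?thesis
    using assms(2-4) by (blast dest: PiE_mem)
qed

lemma farr_id: "T \<in> endofunctors \<Longrightarrow> X \<in> Fam \<Longrightarrow> farr T X X (fam_id I X) = fam_id I (fobj T X)"
  unfolding functors_def by simp

lemma farr_comp:
  "T \<in> endofunctors \<Longrightarrow> X \<in> Fam \<Longrightarrow> Y \<in> Fam \<Longrightarrow> Z \<in> Fam \<Longrightarrow>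
    f \<in> fam_hom I X Y \<Longrightarrow> g \<in> fam_hom I Y Z \<Longrightarrow>
    farr T X Z (fam_comp I X g f) = fam_comp I (fobj T X) (farr T Y Z g) (farr T X Y f)"
  unfolding functors_def by simp

lemma trans_hom: "\<alpha> \<in> Trans F G \<Longrightarrow> X \<in> Fam \<Longrightarrow> \<alpha> X \<in> fam_hom I (fobj F X) (fobj G X)"
  unfolding nat_trans_def by (auto dest: PiE_mem)

lemma trans_natural:
  assumes "\<alpha> \<in> Trans F G" "X \<in> Fam" "Y \<in> Fam" "f \<in> fam_hom I X Y"
    and i: "i \<in> elts I" "u \<in> elts (fobj F X i)"
  shows "\<alpha> Y i (farr F X Y f i u) = farr G X Y f i (\<alpha> X i u)"
proof -
  have "fam_comp I (fobj F X) (\<alpha> Y) (farr F X Y f) = fam_comp I (fobj F X) (farr G X Y f) (\<alpha> X)"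
    using assms unfolding nat_trans_def by simp
  from fun_cong[OF fun_cong[OF this, of i], of u] show ?thesis
    using i by simp
qed

lemma trans_extensional: "\<alpha> \<in> Trans F G \<Longrightarrow> \<alpha> \<in> extensional Fam"
  by (simp add: nat_trans_def PiE_iff)

lemma transI:
  assumes "\<And>X. X \<in> Fam \<Longrightarrow> \<alpha> X \<in> fam_hom I (fobj F X) (fobj G X)" "\<alpha> \<in> extensional Fam"
    and "\<And>X Y f i u. X \<in> Fam \<Longrightarrow> Y \<in> Fam \<Longrightarrow> f \<in> fam_hom I X Y \<Longrightarrow> i \<in> elts I \<Longrightarrow>
      u \<in> elts (fobj F X i) \<Longrightarrow> \<alpha> Y i (farr F X Y f i u) = farr G X Y f i (\<alpha> X i u)"
  shows "\<alpha> \<in> Trans F G"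
  using assms unfolding nat_trans_def
  by (auto simp: PiE_iff fam_comp_def intro!: fam_lam_eqI)

lemma trans_eqI:
  assumes "\<alpha> \<in> Trans F G" "\<beta> \<in> Trans F G'"
    and "\<And>X i u. X \<in> Fam \<Longrightarrow> i \<in> elts I \<Longrightarrow> u \<in> elts (fobj F X i) \<Longrightarrow> \<alpha> X i u = \<beta> X i u"
  shows "\<alpha> = \<beta>"
proof (rule extensionalityI[of _ Fam])
  fix X assume X: "X \<in> Fam"
  show "\<alpha> X = \<beta> X"
    by (rule fam_hom_eqI[OF trans_hom[OF assms(1) X] trans_hom[OF assms(2) X]])
      (rule assms(3)[OF X])
qed (simp_all add: trans_extensional[OF assms(1)] trans_extensional[OF assms(2)])

section \<open>Monads and monad morphisms in terms of elements\<close>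

lemma Endo_simps [simp]:
  "Obj (Endo (SetFam I)) = endofunctors" "Hom (Endo (SetFam I)) = Trans"
  "Ident (Endo (SetFam I)) F = (\<lambda>X\<in>Fam. fam_id I (fobj F X))"
  "Comp (Endo (SetFam I)) F G H \<beta> \<alpha> = (\<lambda>X\<in>Fam. fam_comp I (fobj F X) (\<beta> X) (\<alpha> X))"
  "tensor_obj (Endo (SetFam I)) = endo_comp"
  "tensor_arr (Endo (SetFam I)) F F' G G' \<alpha> \<beta> =
    (\<lambda>X\<in>Fam. fam_comp I (fobj F (fobj G X)) (\<alpha> (fobj G' X)) (farr F (fobj G X) (fobj G' X) (\<beta> X)))"
  "tensor_unit (Endo (SetFam I)) = id_functor (SetFam I)"
  unfolding Endo_def by simp_all

text \<open>The bridge from monoid laws, which are equations between extensional transformations, to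
  equations at elements: both sides are first brought to the form of nested restricted
  abstractions.\<close>

lemma trans_lam_eq_iff:
  "(\<lambda>X\<in>Fam. fam_lam (F X) (f X)) = (\<lambda>X\<in>Fam. fam_lam (F X) (g X)) \<longleftrightarrow>
    (\<forall>X\<in>Fam. \<forall>i\<in>elts I. \<forall>u\<in>elts (F X i). f X i u = g X i u)" (is "?l = ?r \<longleftrightarrow> ?P")
proof
  assume eq: "?l = ?r"
  show ?P
  proof (intro ballI)
    fix X i u assume "X \<in> Fam" "i \<in> elts I" "u \<in> elts (F X i)"
    then show "f X i u = g X i u"
      using fun_cong[OF fun_cong[OF fun_cong[OF eq, of X], of i], of u] by simp
  qed
qed (auto intro!: restrict_ext)

text \<open>Horizontal composition with an identity is whiskering: the factor \<open>farr\<close> of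
  an identity vanishes by \<open>farr_id\<close>, and an identity component acts trivially on
  elements. What remains is the elementwise form of the monad laws.\<close>

lemma Mnd_obj_iff:
  "M \<in> Obj (Mnd I) \<longleftrightarrow> (let T = underlying M; \<eta> = mon_unit M; \<mu> = mon_mult M in
    T \<in> endofunctors \<and> \<eta> \<in> Trans (id_functor (SetFam I)) T \<and> \<mu> \<in> Trans (endo_comp T T) T \<and>
    (\<forall>X\<in>Fam. \<forall>i\<in>elts I. \<forall>u\<in>elts (fobj T X i).
      \<mu> X i (\<eta> (fobj T X) i u) = u \<and> \<mu> X i (farr T X (fobj T X) (\<eta> X) i u) = u) \<and>
    (\<forall>X\<in>Fam. \<forall>i\<in>elts I. \<forall>u\<in>elts (fobj T (fobj T (fobj T X)) i).
      \<mu> X i (\<mu> (fobj T X) i u) = \<mu> X i (farr T (fobj T (fobj T X)) (fobj T X) (\<mu> X) i u)))"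
proof -
  define T \<eta> \<mu> where "T = underlying M" and "\<eta> = mon_unit M" and "\<mu> = mon_mult M"
  let ?V = "Endo (SetFam I)" and ?U = "id_functor (SetFam I)" and ?TT = "endo_comp T T"
  {
    \<comment> \<open>The reformulation of each law is valid only for well-typed data. Both sides of
      the claim contain these typing conditions, so the laws are rewritten inside a block that
      assumes them.\<close>
    assume T: "T \<in> endofunctors" and \<eta>: "\<eta> \<in> Trans ?U T" and \<mu>: "\<mu> \<in> Trans ?TT T"
    have \<eta>_hom: "\<eta> X \<in> fam_hom I X (fobj T X)" if "X \<in> Fam" for X
      using trans_hom[OF \<eta> that] that by simp
    have \<mu>_hom: "\<mu> X \<in> fam_hom I (fobj T (fobj T X)) (fobj T X)" if "X \<in> Fam" for X
      using trans_hom[OF \<mu> that] that by simp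
    note mem = fam_hom_mem[OF \<eta>_hom] fam_hom_mem[OF \<mu>_hom]
      fam_hom_mem[OF farr_hom[OF T _ _ \<eta>_hom]] fam_hom_mem[OF farr_hom[OF T _ _ \<mu>_hom]]
    have "Comp ?V (endo_comp ?U T) ?TT T \<mu> (tensor_arr ?V ?U T T T \<eta> (Ident ?V T)) = Ident ?V T \<longleftrightarrow>
      (\<forall>X\<in>Fam. \<forall>i\<in>elts I. \<forall>u\<in>elts (fobj T X i). \<mu> X i (\<eta> (fobj T X) i u) = u)"
    proof -
      have "Comp ?V (endo_comp ?U T) ?TT T \<mu> (tensor_arr ?V ?U T T T \<eta> (Ident ?V T)) =
          (\<lambda>X\<in>Fam. fam_lam (fobj T X) (\<lambda>i u. \<mu> X i (\<eta> (fobj T X) i u)))"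
        using T by (auto simp: fam_comp_def intro!: restrict_ext)
      then show ?thesis
        by (simp add: fam_id_def trans_lam_eq_iff)
    qed
    moreover have "Comp ?V (endo_comp T ?U) ?TT T \<mu> (tensor_arr ?V T T ?U T (Ident ?V T) \<eta>) =
        Ident ?V T \<longleftrightarrow>
      (\<forall>X\<in>Fam. \<forall>i\<in>elts I. \<forall>u\<in>elts (fobj T X i).
        \<mu> X i (farr T X (fobj T X) (\<eta> X) i u) = u)"
    proof -
      have "Comp ?V (endo_comp T ?U) ?TT T \<mu> (tensor_arr ?V T T ?U T (Ident ?V T) \<eta>) =
          (\<lambda>X\<in>Fam. fam_lam (fobj T X) (\<lambda>i u. \<mu> X i (farr T X (fobj T X) (\<eta> X) i u)))"
        using T by (auto simp: fam_comp_def mem intro!: restrict_ext)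
      then show ?thesis
        by (simp add: fam_id_def trans_lam_eq_iff)
    qed
    moreover have "Comp ?V (endo_comp ?TT T) ?TT T \<mu> (tensor_arr ?V ?TT T T T \<mu> (Ident ?V T)) =
        Comp ?V (endo_comp T ?TT) ?TT T \<mu> (tensor_arr ?V T T ?TT T (Ident ?V T) \<mu>) \<longleftrightarrow>
      (\<forall>X\<in>Fam. \<forall>i\<in>elts I. \<forall>u\<in>elts (fobj T (fobj T (fobj T X)) i).
        \<mu> X i (\<mu> (fobj T X) i u) = \<mu> X i (farr T (fobj T (fobj T X)) (fobj T X) (\<mu> X) i u))"
    proof -
      have "Comp ?V (endo_comp ?TT T) ?TT T \<mu> (tensor_arr ?V ?TT T T T \<mu> (Ident ?V T)) =
          (\<lambda>X\<in>Fam. fam_lam (fobj T (fobj T (fobj T X))) (\<lambda>i u. \<mu> X i (\<mu> (fobj T X) i u)))"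
        using T by (auto simp: fam_comp_def farr_id intro!: restrict_ext)
      moreover have "Comp ?V (endo_comp T ?TT) ?TT T \<mu> (tensor_arr ?V T T ?TT T (Ident ?V T) \<mu>) =
          (\<lambda>X\<in>Fam. fam_lam (fobj T (fobj T (fobj T X)))
            (\<lambda>i u. \<mu> X i (farr T (fobj T (fobj T X)) (fobj T X) (\<mu> X) i u)))"
        using T by (auto simp: fam_comp_def mem intro!: restrict_ext)
      ultimately show ?thesis
        by (simp add: trans_lam_eq_iff)
    qed
    ultimately have "M \<in> Obj (Mnd I) \<longleftrightarrow>
      (\<forall>X\<in>Fam. \<forall>i\<in>elts I. \<forall>u\<in>elts (fobj T X i).
        \<mu> X i (\<eta> (fobj T X) i u) = u \<and> \<mu> X i (farr T X (fobj T X) (\<eta> X) i u) = u) \<and>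
      (\<forall>X\<in>Fam. \<forall>i\<in>elts I. \<forall>u\<in>elts (fobj T (fobj T (fobj T X)) i).
        \<mu> X i (\<mu> (fobj T X) i u) = \<mu> X i (farr T (fobj T (fobj T X)) (fobj T X) (\<mu> X) i u))"
      \<comment> \<open>\<open>Endo_simps(3,4,6)\<close> would unfold identities, composition and
        tensor, after which the three equivalences just proved would no longer match.\<close>
      using T \<eta> \<mu> unfolding Mnd_def Mon_def monoid_objects_def T_def \<eta>_def \<mu>_def
      by (simp add: Let_def del: Endo_simps(3,4,6)) blast
  }
  then show ?thesis
    unfolding Let_def T_def[symmetric] \<eta>_def[symmetric] \<mu>_def[symmetric]
    by (auto simp: Mnd_def Mon_def monoid_objects_def Let_def T_def \<eta>_def \<mu>_def)
qed

lemma Mnd_hom_iff: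
  assumes M: "M \<in> Obj (Mnd I)" and N: "N \<in> Obj (Mnd I)"
  shows "f \<in> Hom (Mnd I) M N \<longleftrightarrow> (let T = underlying M; T' = underlying N in
    f \<in> Trans T T' \<and>
    (\<forall>X\<in>Fam. \<forall>i\<in>elts I. \<forall>x\<in>elts (X i). f X i (mon_unit M X i x) = mon_unit N X i x) \<and>
    (\<forall>X\<in>Fam. \<forall>i\<in>elts I. \<forall>u\<in>elts (fobj T (fobj T X) i).
      f X i (mon_mult M X i u) =
      mon_mult N X i (f (fobj T' X) i (farr T (fobj T X) (fobj T' X) (f X) i u))))"
proof -
  define T \<eta> \<mu> where "T = underlying M" and "\<eta> = mon_unit M" and "\<mu> = mon_mult M"
  define T' \<eta>' \<mu>' where "T' = underlying N" and "\<eta>' = mon_unit N" and "\<mu>' = mon_mult N"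
  note defs = T_def \<eta>_def \<mu>_def T'_def \<eta>'_def \<mu>'_def
  let ?V = "Endo (SetFam I)" and ?U = "id_functor (SetFam I)"
  have \<eta>': "\<eta>' \<in> Trans ?U T'"
    using N by (simp add: Mnd_obj_iff Let_def defs)
  {
    assume f: "f \<in> Trans T T'"
    have "Comp ?V ?U T T' f \<eta> = \<eta>' \<longleftrightarrow>
      (\<forall>X\<in>Fam. \<forall>i\<in>elts I. \<forall>x\<in>elts (X i). f X i (\<eta> X i x) = \<eta>' X i x)"
    proof -
      have l: "Comp ?V ?U T T' f \<eta> = (\<lambda>X\<in>Fam. fam_lam X (\<lambda>i x. f X i (\<eta> X i x)))"
        by (auto simp: fam_comp_def intro!: restrict_ext)
      \<comment> \<open>The composite on the left unfolds to restricted abstractions, whereas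
        \<open>\<eta>'\<close> is opaque; extensionality puts it into the same form, as
        \<open>trans_lam_eq_iff\<close> requires.\<close>
      have r: "\<eta>' = (\<lambda>X\<in>Fam. fam_lam X (\<lambda>i x. \<eta>' X i x))"
      proof (rule extensionalityI[of _ Fam])
        fix X assume X: "X \<in> Fam"
        have h: "\<eta>' X \<in> fam_hom I X (fobj T' X)"
          using trans_hom[OF \<eta>' X] X by simp
        have "fam_lam X (\<eta>' X) \<in> fam_hom I X (fobj T' X)"
          by (rule fam_hom_lamI) (rule fam_hom_mem[OF h])
        then have "\<eta>' X = fam_lam X (\<eta>' X)"
          by (rule fam_hom_eqI[OF h]) simp
        then show "\<eta>' X = (\<lambda>X\<in>Fam. fam_lam X (\<lambda>i x. \<eta>' X i x)) X"
          unfolding restrict_apply'[OF X] .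
      qed (simp_all add: trans_extensional[OF \<eta>'])
      show ?thesis
        unfolding l by (rule trans_lam_eq_iff[where F = "\<lambda>X. X" and g = \<eta>', folded r])
    qed
    moreover have "Comp ?V (endo_comp T T) T T' f \<mu> =
        Comp ?V (endo_comp T T) (endo_comp T' T') T' \<mu>' (tensor_arr ?V T T' T T' f f) \<longleftrightarrow>
      (\<forall>X\<in>Fam. \<forall>i\<in>elts I. \<forall>u\<in>elts (fobj T (fobj T X) i).
        f X i (\<mu> X i u) = \<mu>' X i (f (fobj T' X) i (farr T (fobj T X) (fobj T' X) (f X) i u)))"
    proof -
      have "Comp ?V (endo_comp T T) T T' f \<mu> =
          (\<lambda>X\<in>Fam. fam_lam (fobj T (fobj T X)) (\<lambda>i u. f X i (\<mu> X i u)))"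
        by (auto simp: fam_comp_def intro!: restrict_ext)
      moreover have "Comp ?V (endo_comp T T) (endo_comp T' T') T' \<mu>' (tensor_arr ?V T T' T T' f f) =
          (\<lambda>X\<in>Fam. fam_lam (fobj T (fobj T X))
            (\<lambda>i u. \<mu>' X i (f (fobj T' X) i (farr T (fobj T X) (fobj T' X) (f X) i u))))"
        by (auto simp: fam_comp_def intro!: restrict_ext)
      ultimately show ?thesis
        by (simp add: trans_lam_eq_iff)
    qed
    ultimately have "f \<in> Hom (Mnd I) M N \<longleftrightarrow>
      (\<forall>X\<in>Fam. \<forall>i\<in>elts I. \<forall>x\<in>elts (X i). f X i (\<eta> X i x) = \<eta>' X i x) \<and>
      (\<forall>X\<in>Fam. \<forall>i\<in>elts I. \<forall>u\<in>elts (fobj T (fobj T X) i).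
        f X i (\<mu> X i u) = \<mu>' X i (f (fobj T' X) i (farr T (fobj T X) (fobj T' X) (f X) i u)))"
      using f unfolding Mnd_def Mon_def monoid_homs_def defs
      by (simp add: Let_def del: Endo_simps(3,4,6))
  }
  then show ?thesis
    unfolding Let_def defs[symmetric]
    by (auto simp: Mnd_def Mon_def monoid_homs_def Let_def defs)
qed

lemma Mnd_simps:
  "Ident (Mnd I) M = (\<lambda>X\<in>Fam. fam_id I (fobj (underlying M) X))"
  "Comp (Mnd I) L M N \<beta> \<alpha> = (\<lambda>X\<in>Fam. fam_comp I (fobj (underlying L) X) (\<beta> X) (\<alpha> X))"
  unfolding Mnd_def Mon_def by simp_all

lemma Ident_Mnd_hom:
  assumes M: "M \<in> Obj (Mnd I)"
  shows "Ident (Mnd I) M \<in> Hom (Mnd I) M M"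
proof -
  define T \<eta> \<mu> where "T = underlying M" and "\<eta> = mon_unit M" and "\<mu> = mon_mult M"
  have T: "T \<in> endofunctors" and \<eta>: "\<eta> \<in> Trans (id_functor (SetFam I)) T"
    and \<mu>: "\<mu> \<in> Trans (endo_comp T T) T"
    using M by (simp_all add: Mnd_obj_iff Let_def T_def \<eta>_def \<mu>_def)
  have "(\<lambda>X\<in>Fam. fam_id I (fobj T X)) \<in> Trans T T"
    by (rule transI) (simp_all add: farr_hom[OF T] fam_hom_mem[OF farr_hom[OF T]])
  then show ?thesis
    unfolding Mnd_hom_iff[OF M M] Mnd_simps Let_def T_def[symmetric] \<eta>_def[symmetric] \<mu>_def[symmetric]
    using T trans_hom[OF \<eta>, THEN fam_hom_mem] trans_hom[OF \<mu>, THEN fam_hom_mem]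
    by (simp add: farr_id)
qed

lemma Comp_Mnd_hom:
  assumes L: "L \<in> Obj (Mnd I)" and M: "M \<in> Obj (Mnd I)" and N: "N \<in> Obj (Mnd I)"
    and f: "f \<in> Hom (Mnd I) L M" and g: "g \<in> Hom (Mnd I) M N"
  shows "Comp (Mnd I) L M N g f \<in> Hom (Mnd I) L N"
proof -
  define T T' T'' where "T = underlying L" and "T' = underlying M" and "T'' = underlying N"
  note defs = T_def T'_def T''_def
  have T: "T \<in> endofunctors" "T' \<in> endofunctors" "T'' \<in> endofunctors"
    and \<mu>: "mon_mult L \<in> Trans (endo_comp T T) T" and \<eta>: "mon_unit L \<in> Trans (id_functor (SetFam I)) T"
    using L M N by (simp_all add: Mnd_obj_iff Let_def defs)
  have f_trans: "f \<in> Trans T T'" and g_trans: "g \<in> Trans T' T''"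
    using f g by (simp_all add: Mnd_hom_iff[OF L M] Mnd_hom_iff[OF M N] Let_def defs)
  have fh: "X \<in> Fam \<Longrightarrow> f X \<in> fam_hom I (fobj T X) (fobj T' X)"
    and gh: "X \<in> Fam \<Longrightarrow> g X \<in> fam_hom I (fobj T' X) (fobj T'' X)" for X
    using trans_hom[OF f_trans] trans_hom[OF g_trans] by auto
  note \<mu>h = trans_hom[OF \<mu>, THEN fam_hom_mem] and \<eta>h = trans_hom[OF \<eta>, THEN fam_hom_mem]
  note mem = fam_hom_mem[OF fh] fam_hom_mem[OF gh] fam_hom_mem[OF farr_hom[OF T(1) _ _ fh]]
    fam_hom_mem[OF farr_hom[OF T(2) _ _ gh]] fam_hom_mem[OF farr_hom[OF T(1)]]
    fam_hom_mem[OF farr_hom[OF T(2)]]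
  let ?h = "\<lambda>X\<in>Fam. fam_comp I (fobj T X) (g X) (f X)"
  have "?h \<in> Trans T T''"
    by (rule transI) (simp_all add: T mem fam_comp_hom[OF fh gh] trans_natural[OF f_trans]
        trans_natural[OF g_trans])
  moreover have "?h X i (mon_unit L X i x) = mon_unit N X i x"
    if "X \<in> Fam" "i \<in> elts I" "x \<in> elts (X i)" for X i x
    using f g that \<eta>h by (simp add: Mnd_hom_iff[OF L M] Mnd_hom_iff[OF M N] Let_def defs)
  moreover have "?h X i (mon_mult L X i u) =
      mon_mult N X i (?h (fobj T'' X) i (farr T (fobj T X) (fobj T'' X) (?h X) i u))"
    if X: "X \<in> Fam" and i: "i \<in> elts I" and u: "u \<in> elts (fobj T (fobj T X) i)" for X i u
  proof -
    let ?v = "farr T (fobj T X) (fobj T' X) (f X) i u"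
    have v: "?v \<in> elts (fobj T (fobj T' X) i)"
      using X i u T by (simp add: mem)
    have "?h X i (mon_mult L X i u) = g X i (f X i (mon_mult L X i u))"
      using X i u \<mu>h by simp
    also have "\<dots> = g X i (mon_mult M X i (f (fobj T' X) i ?v))"
      using f X i u by (simp add: Mnd_hom_iff[OF L M] Let_def defs)
    also have "\<dots> = mon_mult N X i (g (fobj T'' X) i
        (farr T' (fobj T' X) (fobj T'' X) (g X) i (f (fobj T' X) i ?v)))"
      using g X i v T by (simp add: Mnd_hom_iff[OF M N] Let_def defs[symmetric] mem)
    \<comment> \<open>Naturality of \<open>f\<close> at the map \<open>g X\<close> moves
      \<open>f\<close> outwards, so that the images of \<open>f X\<close> and \<open>g X\<close>
      under the functor \<open>T\<close> become adjacent and compose.\<close>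
    also have "farr T' (fobj T' X) (fobj T'' X) (g X) i (f (fobj T' X) i ?v) =
        f (fobj T'' X) i (farr T (fobj T' X) (fobj T'' X) (g X) i ?v)"
      using trans_natural[OF f_trans _ _ gh i v] X T by simp
    also have "farr T (fobj T' X) (fobj T'' X) (g X) i ?v =
        farr T (fobj T X) (fobj T'' X) (?h X) i u"
      using X i u T by (simp add: farr_comp[OF T(1) _ _ _ fh gh])
    also have "g (fobj T'' X) i (f (fobj T'' X) i (farr T (fobj T X) (fobj T'' X) (?h X) i u)) =
        ?h (fobj T'' X) i (farr T (fobj T X) (fobj T'' X) (?h X) i u)"
      using X i u T by (simp add: fam_hom_mem[OF farr_hom[OF T(1) _ _ fam_comp_hom[OF fh gh]]])
    finally show ?thesis .
  qed
  ultimately show ?thesis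
    unfolding Mnd_hom_iff[OF L N] Mnd_simps Let_def defs[symmetric] by blast
qed

lemma is_category_Mnd: "is_category (Mnd I)"
proof -
  have tr: "f \<in> Trans (underlying M) (underlying N)"
    if "M \<in> Obj (Mnd I)" "N \<in> Obj (Mnd I)" "f \<in> Hom (Mnd I) M N" for f M N
    using that by (simp add: Mnd_hom_iff Let_def)
  have id: "Comp (Mnd I) M M N f (Ident (Mnd I) M) = f"
      "Comp (Mnd I) M N N (Ident (Mnd I) N) f = f"
    if "M \<in> Obj (Mnd I)" "N \<in> Obj (Mnd I)" "f \<in> Hom (Mnd I) M N" for f M N
  proof -
    note f = tr[OF that]
    show "Comp (Mnd I) M M N f (Ident (Mnd I) M) = f"
      by (rule trans_eqI[OF tr[of M N] f])
        (simp_all add: that Comp_Mnd_hom Ident_Mnd_hom, simp add: Mnd_simps)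
    show "Comp (Mnd I) M N N (Ident (Mnd I) N) f = f"
      by (rule trans_eqI[OF tr[of M N] f])
        (simp_all add: that Comp_Mnd_hom Ident_Mnd_hom,
         simp add: Mnd_simps fam_hom_mem[OF trans_hom[OF f]])
  qed
  have assoc: "Comp (Mnd I) K L N (Comp (Mnd I) L M N h g) f =
      Comp (Mnd I) K M N h (Comp (Mnd I) K L M g f)"
    if "K \<in> Obj (Mnd I)" "L \<in> Obj (Mnd I)" "f \<in> Hom (Mnd I) K L" for K L M N f g h
    unfolding Mnd_simps
    by (rule restrict_ext) (simp add: fam_comp_assoc[OF trans_hom[OF tr[OF that]]])
  show ?thesis
    unfolding is_category_def
    by (intro conjI ballI; (rule id assoc Ident_Mnd_hom Comp_Mnd_hom; assumption))
qed


section \<open>Extents of containers\<close>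

lemma truncate_simps [simp]:
  "shp (icontainer.truncate M) = shp M" "pos (icontainer.truncate M) = pos M"
  by (simp_all add: icontainer.defs)

lemma fam_decode_code_lam: "fam_decode I X (fam_code I X h) = fam_lam X h"
  unfolding fam_decode_def fam_code_def by (rule fam_lam_eqI) simp

lemma pos_Fam_of_icontainer:
  assumes "icontainer.truncate K \<in> icontainers I" "i \<in> elts I" "s \<in> elts (shp K i)"
  shows "pos K i s \<in> Fam"
proof -
  have "pos K \<in> fam_Pi (shp K) (\<lambda>i s. Fam)"
    using assms(1) by (simp add: icontainers_def)
  then show ?thesis
    using assms(2,3) by (rule fam_Pi_mem)
qed

text \<open>
  An element of an extent with shape \<open>s\<close>. It depends only on the values of \<open>h\<close> at positions of \<open>s\<close>,
  so \<open>h\<close> need not be extensional.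
\<close>

definition ext_elt :: "('u, 'z) icontainer_scheme \<Rightarrow> 'u \<Rightarrow> 'u \<Rightarrow> ('u \<Rightarrow> 'u \<Rightarrow> 'u) \<Rightarrow> 'u" where
  "ext_elt K i s h = vpair s (fam_code I (pos K i s) h)"

text \<open>Recovers the labels. The shape must be read off \<open>u\<close> first, because its
  positions are the domain on which the code is decoded.\<close>

definition ext_fun :: "('u, 'z) icontainer_scheme \<Rightarrow> 'u \<Rightarrow> 'u \<Rightarrow> 'u \<Rightarrow> 'u \<Rightarrow> 'u" where
  "ext_fun K i u = fam_decode I (pos K i (vfst u)) (vsnd u)"

text \<open>\<open>extent\<close> accepts only plain containers, hence the truncations below. Only
  \<open>pos\<close> enters \<open>ext_elt\<close>, so elements may still be written with the ICMS
  itself.\<close>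

lemma ext_elt_truncate [simp]: "ext_elt (icontainer.truncate M) = ext_elt M"
  by (intro ext) (simp add: ext_elt_def)

lemma vfst_ext_elt [simp]: "vfst (ext_elt K i s h) = s"
  by (simp add: ext_elt_def)

lemma ext_fun_ext_elt [simp]:
  "j \<in> elts I \<Longrightarrow> q \<in> elts (pos K i s j) \<Longrightarrow> ext_fun K i (ext_elt K i s h) j q = h j q"
  by (simp add: ext_elt_def ext_fun_def fam_decode_code_lam)

lemma fam_code_eq_iff:
  "fam_code I X h = fam_code I X h' \<longleftrightarrow> (\<forall>i\<in>elts I. \<forall>x\<in>elts (X i). h i x = h' i x)" (is "?l \<longleftrightarrow> ?r")
proof
  assume ?l
  then have eq: "fam_lam X h = fam_lam X h'"
    by (metis fam_decode_code_lam)
  show ?r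
  proof (intro ballI)
    fix i x assume "i \<in> elts I" "x \<in> elts (X i)"
    then show "h i x = h' i x"
      using fun_cong[OF fun_cong[OF eq, of i], of x] by simp
  qed
next
  assume ?r
  then have "vlam (X i) (h i) = vlam (X i) (h' i)" if "i \<in> elts I" for i
    using that by (intro elts_extensional) (auto simp: elts_vlam)
  then have "elts (fam_code I X h) = elts (fam_code I X h')"
    unfolding fam_code_def elts_vlam[of I] by (intro image_cong) simp_all
  then show ?l
    by (rule elts_extensional)
qed

text \<open>The means by which laws are translated: an equation between elements becomes an equation
  of shapes and one of labels per position. Quantifying over the positions of \<open>s\<close> alone
  suffices, since the shapes agree.\<close>

lemma ext_elt_eq_iff:
  "ext_elt K i s h = ext_elt K i s' h' \<longleftrightarrow>
    s = s' \<and> (\<forall>j\<in>elts I. \<forall>q\<in>elts (pos K i s j). h j q = h' j q)"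
  unfolding ext_elt_def by (auto simp: fam_code_eq_iff)

lemma ext_elt_eqI:
  "s = s' \<Longrightarrow> (\<And>j q. j \<in> elts I \<Longrightarrow> q \<in> elts (pos K i s j) \<Longrightarrow> h j q = h' j q) \<Longrightarrow>
    ext_elt K i s h = ext_elt K i s' h'"
  by (simp add: ext_elt_eq_iff)

lemma elts_extent_obj:
  "i \<in> elts I \<Longrightarrow> elts (extent_obj I K X i) =
    {ext_elt K i s h | s h. s \<in> elts (shp K i) \<and> h \<in> fam_hom I (pos K i s) X}"
  by (auto simp: extent_obj_def ext_elt_def)

lemma ext_elt_in_extent_iff:
  assumes i: "i \<in> elts I"
  shows "ext_elt K i s h \<in> elts (extent_obj I K X i) \<longleftrightarrow>
    s \<in> elts (shp K i) \<and> (\<forall>j\<in>elts I. \<forall>q\<in>elts (pos K i s j). h j q \<in> elts (X j))" (is "?l \<longleftrightarrow> ?r")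
proof
  assume ?l
  then show ?r
    by (auto simp: elts_extent_obj[OF i] ext_elt_eq_iff dest: fam_hom_mem)
next
  assume r: ?r
  then have "fam_lam (pos K i s) h \<in> fam_hom I (pos K i s) X"
    by (intro fam_hom_lamI) simp
  moreover have "ext_elt K i s h = ext_elt K i s (fam_lam (pos K i s) h)"
    by (rule ext_elt_eqI) simp_all
  ultimately show ?l
    using r unfolding elts_extent_obj[OF i] by blast
qed

lemma ext_eltI:
  "i \<in> elts I \<Longrightarrow> s \<in> elts (shp K i) \<Longrightarrow>
    (\<And>j q. j \<in> elts I \<Longrightarrow> q \<in> elts (pos K i s j) \<Longrightarrow> h j q \<in> elts (X j)) \<Longrightarrow>
    ext_elt K i s h \<in> elts (extent_obj I K X i)"
  by (simp add: ext_elt_in_extent_iff)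

lemma ext_eltE:
  assumes "u \<in> elts (extent_obj I K X i)" "i \<in> elts I"
  obtains s h where "u = ext_elt K i s h" "s \<in> elts (shp K i)" "h \<in> fam_hom I (pos K i s) X"
  using assms by (auto simp: elts_extent_obj)

lemma extent_obj_Fam [simp]: "extent_obj I K X \<in> Fam"
  unfolding extent_obj_def by simp

lemma fobj_extent [simp]: "X \<in> Fam \<Longrightarrow> fobj (extent I K) X = extent_obj I K X"
  unfolding extent_def by simp

lemma farr_extent:
  assumes "X \<in> Fam" "Y \<in> Fam" "f \<in> fam_hom I X Y" "i \<in> elts I" "s \<in> elts (shp K i)"
    and "\<And>j q. j \<in> elts I \<Longrightarrow> q \<in> elts (pos K i s j) \<Longrightarrow> h j q \<in> elts (X j)"
  shows "farr (extent I K) X Y f i (ext_elt K i s h) = ext_elt K i s (\<lambda>j q. f j (h j q))"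
proof -
  have "farr (extent I K) X Y f i (ext_elt K i s h) =
      ext_elt K i s (fam_comp I (pos K i s) f (ext_fun K i (ext_elt K i s h)))"
    using assms ext_eltI[OF assms(4-6)] unfolding extent_def
    by (simp add: Let_def ext_fun_def ext_elt_def)
  also have "\<dots> = ext_elt K i s (\<lambda>j q. f j (h j q))"
    by (rule ext_elt_eqI) simp_all
  finally show ?thesis .
qed

lemma farr_extent_hom:
  assumes f: "X \<in> Fam" "Y \<in> Fam" "f \<in> fam_hom I X Y"
  shows "farr (extent I K) X Y f \<in> fam_hom I (extent_obj I K X) (extent_obj I K Y)"
proof -
  have "farr (extent I K) X Y f =
      fam_lam (extent_obj I K X) (\<lambda>i u. farr (extent I K) X Y f i u)"
    using f unfolding extent_def by (auto intro!: ext)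
  moreover have "farr (extent I K) X Y f i u \<in> elts (extent_obj I K Y i)"
    if i: "i \<in> elts I" and u: "u \<in> elts (extent_obj I K X i)" for i u
  proof -
    from u i obtain s h where "u = ext_elt K i s h" "s \<in> elts (shp K i)"
      and h: "h \<in> fam_hom I (pos K i s) X"
      by (rule ext_eltE)
    then show ?thesis
      using i by (simp add: farr_extent f ext_eltI fam_hom_mem[OF f(3)] fam_hom_mem[OF h])
  qed
  ultimately show ?thesis
    using fam_hom_lamI[of "extent_obj I K X" "farr (extent I K) X Y f" "extent_obj I K Y"]
    by simp
qed

lemma extent_endofunctor: "extent I K \<in> endofunctors"
proof -
  have "farr (extent I K) \<in>
      (\<Pi>\<^sub>E X\<in>Fam. \<Pi>\<^sub>E Y\<in>Fam. fam_hom I X Y \<rightarrow>\<^sub>E fam_hom I (extent_obj I K X) (extent_obj I K Y))"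
    by (intro PiE_I farr_extent_hom) (auto simp: extent_def)
  then have "farr (extent I K) \<in> (\<Pi>\<^sub>E X\<in>Fam. \<Pi>\<^sub>E Y\<in>Fam. fam_hom I X Y \<rightarrow>\<^sub>E
      fam_hom I (fobj (extent I K) X) (fobj (extent I K) Y))"
    by (simp cong: PiE_cong)
  moreover have "fobj (extent I K) \<in> Fam \<rightarrow>\<^sub>E Fam"
    by (rule PiE_I) (simp, simp add: extent_def)
  moreover have "farr (extent I K) X X (fam_id I X) = fam_id I (extent_obj I K X)"
    if X: "X \<in> Fam" for X
  proof (rule fam_hom_eqI[OF farr_extent_hom[OF X X fam_id_hom] fam_id_hom])
    fix i u assume i: "i \<in> elts I" and u: "u \<in> elts (extent_obj I K X i)"
    from u i obtain s h where eq: "u = ext_elt K i s h" "s \<in> elts (shp K i)"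
      and h: "h \<in> fam_hom I (pos K i s) X"
      by (rule ext_eltE)
    show "farr (extent I K) X X (fam_id I X) i u = fam_id I (extent_obj I K X) i u"
      using i u by (simp add: eq farr_extent X fam_hom_mem[OF h] ext_elt_eq_iff)
  qed
  moreover have "farr (extent I K) X Z (fam_comp I X g f) =
      fam_comp I (extent_obj I K X) (farr (extent I K) Y Z g) (farr (extent I K) X Y f)"
    if X: "X \<in> Fam" "Y \<in> Fam" "Z \<in> Fam" and f: "f \<in> fam_hom I X Y" and g: "g \<in> fam_hom I Y Z"
    for X Y Z f g
  proof (rule fam_hom_eqI[OF farr_extent_hom[OF X(1,3) fam_comp_hom[OF f g]]
        fam_comp_hom[OF farr_extent_hom[OF X(1,2) f] farr_extent_hom[OF X(2,3) g]]])
    fix i u assume i: "i \<in> elts I" and u: "u \<in> elts (extent_obj I K X i)"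
    from u i obtain s h where eq: "u = ext_elt K i s h" "s \<in> elts (shp K i)"
      and h: "h \<in> fam_hom I (pos K i s) X"
      by (rule ext_eltE)
    show "farr (extent I K) X Z (fam_comp I X g f) i u =
        fam_comp I (extent_obj I K X) (farr (extent I K) Y Z g) (farr (extent I K) X Y f) i u"
      using i u by (simp add: eq farr_extent X f g fam_comp_hom[OF f g] fam_hom_mem[OF f]
          fam_hom_mem[OF h] ext_elt_eq_iff)
  qed
  ultimately show ?thesis
    unfolding functors_def by simp
qed

text \<open>Normal form for the iterated extent: it exhibits the composite shape, \<open>s\<close>
  with the family \<open>s'\<close>, and the labels \<open>x\<close> of composite positions.\<close>

lemma ext_elt2E:
  assumes u: "u \<in> elts (extent_obj I K (extent_obj I K X) i)" and i: "i \<in> elts I"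
  obtains s s' x where
    "u = ext_elt K i s (\<lambda>k q. ext_elt K k (s' k q) (x k q))" "s \<in> elts (shp K i)"
    "s' \<in> fam_hom I (pos K i s) (shp K)"
    "x \<in> fam_Pi (pos K i s) (\<lambda>k q. fam_hom I (pos K k (s' k q)) X)"
proof -
  from u i obtain s h where u_eq: "u = ext_elt K i s h" and s: "s \<in> elts (shp K i)"
    and h: "h \<in> fam_hom I (pos K i s) (extent_obj I K X)"
    by (rule ext_eltE)
  have "\<exists>t y. h k q = ext_elt K k t y \<and> t \<in> elts (shp K k) \<and> y \<in> fam_hom I (pos K k t) X"
    if "k \<in> elts I" "q \<in> elts (pos K i s k)" for k q
    by (rule ext_eltE[OF fam_hom_mem[OF h that] that(1)]) blast
  \<comment> \<open>Shape and labels are chosen separately at each position. Elsewhere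
    \<open>t\<close> and \<open>y\<close> are arbitrary, so they are restricted below to become
    members of the extensional function spaces.\<close>
  then obtain t y where ty: "\<And>k q. k \<in> elts I \<Longrightarrow> q \<in> elts (pos K i s k) \<Longrightarrow>
      h k q = ext_elt K k (t k q) (y k q) \<and> t k q \<in> elts (shp K k) \<and>
      y k q \<in> fam_hom I (pos K k (t k q)) X"
    by metis
  show thesis
  proof
    show "u = ext_elt K i s (\<lambda>k q. ext_elt K k (fam_lam (pos K i s) t k q)
        (fam_lam (pos K i s) y k q))"
      unfolding u_eq by (rule ext_elt_eqI) (simp_all add: ty)
    show "fam_lam (pos K i s) t \<in> fam_hom I (pos K i s) (shp K)"
      by (rule fam_hom_lamI) (simp add: ty)
    show "fam_lam (pos K i s) y \<in>
        fam_Pi (pos K i s) (\<lambda>k q. fam_hom I (pos K k (fam_lam (pos K i s) t k q)) X)"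
      by (rule fam_Pi_lamI) (simp add: ty)
  qed (rule s)
qed

lemma ext_elt_eta:
  assumes "u \<in> elts (extent_obj I K X i)" "i \<in> elts I"
  shows "ext_elt K i (vfst u) (ext_fun K i u) = u" "vfst u \<in> elts (shp K i)"
    "\<And>j q. j \<in> elts I \<Longrightarrow> q \<in> elts (pos K i (vfst u) j) \<Longrightarrow> ext_fun K i u j q \<in> elts (X j)"
proof -
  from assms obtain s h where eq: "u = ext_elt K i s h" "s \<in> elts (shp K i)"
    and h: "h \<in> fam_hom I (pos K i s) X"
    by (rule ext_eltE)
  show "ext_elt K i (vfst u) (ext_fun K i u) = u" "vfst u \<in> elts (shp K i)"
    by (simp_all add: eq ext_elt_eq_iff)
  show "ext_fun K i u j q \<in> elts (X j)" if "j \<in> elts I" "q \<in> elts (pos K i (vfst u) j)" for j q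
    using that fam_hom_mem[OF h] by (simp add: eq)
qed

text \<open>The two-layer normal form is applied with labels in an extent, and these labels are then
  split by \<open>vfst\<close> and \<open>ext_fun\<close>. The labels \<open>x\<close> are typed
  only at positions and need not be extensional, because \<open>ext_elt\<close> ignores all other
  values.\<close>

lemma ext_elt3E:
  assumes u: "u \<in> elts (extent_obj I K (extent_obj I K (extent_obj I K X)) i)" and i: "i \<in> elts I"
  obtains s s' s'' x where
    "u = ext_elt K i s (\<lambda>k q. ext_elt K k (s' k q) (\<lambda>l r. ext_elt K l (s'' k q l r) (x k q l r)))"
    "s \<in> elts (shp K i)" "s' \<in> fam_hom I (pos K i s) (shp K)"
    "s'' \<in> fam_Pi (pos K i s) (\<lambda>k q. fam_hom I (pos K k (s' k q)) (shp K))"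
    "\<forall>k\<in>elts I. \<forall>q\<in>elts (pos K i s k). \<forall>l\<in>elts I. \<forall>r\<in>elts (pos K k (s' k q) l).
      \<forall>j\<in>elts I. \<forall>t\<in>elts (pos K l (s'' k q l r) j). x k q l r j t \<in> elts (X j)"
proof -
  from u i obtain s s' y where u_eq: "u = ext_elt K i s (\<lambda>k q. ext_elt K k (s' k q) (y k q))"
    and s: "s \<in> elts (shp K i)" and s': "s' \<in> fam_hom I (pos K i s) (shp K)"
    and y: "y \<in> fam_Pi (pos K i s) (\<lambda>k q. fam_hom I (pos K k (s' k q)) (extent_obj I K X))"
    by (rule ext_elt2E)
  define s'' where "s'' = fam_lam (pos K i s) (\<lambda>k q. fam_lam (pos K k (s' k q)) (\<lambda>l r. vfst (y k q l r)))"
  have y_elt: "y k q l r \<in> elts (extent_obj I K X l)"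
    if "k \<in> elts I" "q \<in> elts (pos K i s k)" "l \<in> elts I" "r \<in> elts (pos K k (s' k q) l)" for k q l r
    by (rule fam_hom_mem[OF fam_Pi_mem[OF y that(1,2)] that(3,4)])
  show thesis
  proof
    show "u = ext_elt K i s (\<lambda>k q. ext_elt K k (s' k q)
        (\<lambda>l r. ext_elt K l (s'' k q l r) (ext_fun K l (y k q l r))))"
      unfolding u_eq s''_def by (auto intro!: ext_elt_eqI simp: ext_elt_eta(1)[OF y_elt])
    show "s'' \<in> fam_Pi (pos K i s) (\<lambda>k q. fam_hom I (pos K k (s' k q)) (shp K))"
      unfolding s''_def by (intro fam_Pi_lamI fam_hom_lamI) (rule ext_elt_eta(2)[OF y_elt])
    show "\<forall>k\<in>elts I. \<forall>q\<in>elts (pos K i s k). \<forall>l\<in>elts I. \<forall>r\<in>elts (pos K k (s' k q) l).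
      \<forall>j\<in>elts I. \<forall>t\<in>elts (pos K l (s'' k q l r) j). ext_fun K l (y k q l r) j t \<in> elts (X j)"
      unfolding s''_def by (simp add: ext_elt_eta(3)[OF y_elt])
  qed (rule s s')+
qed


section \<open>The monad of a container monad structure\<close>

abbreviation ext_obj :: "('u, 'z) icontainer_scheme \<Rightarrow> ('u \<Rightarrow> 'u) \<Rightarrow> 'u \<Rightarrow> 'u" where
  "ext_obj M \<equiv> extent_obj I (icontainer.truncate M)"

text \<open>The constant label \<open>x\<close> is well-typed because the shape
  \<open>ie M i\<close> has positions at index \<open>i\<close> only; see
  \<open>pos_ie\<close>.\<close>

definition unit_trans :: "'u icms \<Rightarrow> 'u endo_trans" where
  "unit_trans M = (\<lambda>X\<in>Fam. fam_lam X (\<lambda>i x. ext_elt M i (ie M i) (\<lambda>j q. x)))"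

text \<open>Flattening of nested elements. The family \<open>s'\<close> of inner shapes is
  restricted so that it lies in the domain on which \<open>ibul\<close> and the arrows are
  specified.\<close>

definition mult_trans :: "'u icms \<Rightarrow> 'u endo_trans" where
  "mult_trans M = (\<lambda>X\<in>Fam. fam_lam (ext_obj M (ext_obj M X)) (\<lambda>i u.
     let s = vfst u; h = ext_fun M i u; s' = fam_lam (pos M i s) (\<lambda>k q. vfst (h k q)) in
     ext_elt M i (ibul M i s s') (\<lambda>j p.
       ext_fun M (up M i s s' j p) (h (up M i s s' j p) (nw M i s s' j p)) j (ne M i s s' j p))))"

definition monad_of :: "'u icms \<Rightarrow> ('u endo, 'u endo_trans) mon_obj" where
  "monad_of M = \<lparr>underlying = extent I (icontainer.truncate M),
     mon_unit = unit_trans M, mon_mult = mult_trans M\<rparr>"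

lemma monad_of_simps [simp]:
  "underlying (monad_of M) = extent I (icontainer.truncate M)"
  "mon_unit (monad_of M) = unit_trans M" "mon_mult (monad_of M) = mult_trans M"
  unfolding monad_of_def by simp_all

lemmas ext_obj_eltI = ext_eltI[where K = "icontainer.truncate M" for M, simplified]
lemmas ext_obj_eltE = ext_eltE[where K = "icontainer.truncate M" for M, simplified]
lemmas ext_obj_elt2E = ext_elt2E[where K = "icontainer.truncate M" for M, simplified]
lemmas ext_obj_elt3E = ext_elt3E[where K = "icontainer.truncate M" for M, simplified]
lemmas farr_ext_obj = farr_extent[where K = "icontainer.truncate M" for M, simplified]

context
  fixes M :: "'u icms"
  assumes typed: "icms_typed I M"
begin

lemma ie_mem: "i \<in> elts I \<Longrightarrow> ie M i \<in> elts (shp M i)"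
  using typed unfolding icms_typed_def by (elim conjE) (rule PiE_mem[where f = "ie M"])

text \<open>The target \<open>{u. i = j}\<close> of \<open>pe\<close> is empty for distinct indices,
  so a position at another index could not be mapped anywhere. This fact takes the place of
  transport along \<open>pe\<close>.\<close>

lemma pos_ie:
  assumes "i \<in> elts I" "j \<in> elts I" "q \<in> elts (pos M i (ie M i) j)"
  shows "j = i"
proof -
  have "pe M \<in> (\<Pi>\<^sub>E i\<in>elts I. \<Pi>\<^sub>E j\<in>elts I. elts (pos M i (ie M i) j) \<rightarrow>\<^sub>E {u. i = j})"
    using typed unfolding icms_typed_def by (elim conjE)
  from PiE_mem[OF PiE_mem[OF PiE_mem[OF this assms(1)] assms(2)] assms(3)] show ?thesis
    by (cases "i = j") simp_all
qed

lemma ibul_mem: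
  assumes "i \<in> elts I" "s \<in> elts (shp M i)" "s' \<in> fam_hom I (pos M i s) (shp M)"
  shows "ibul M i s s' \<in> elts (shp M i)"
proof -
  have "ibul M \<in> (\<Pi>\<^sub>E i\<in>elts I. \<Pi>\<^sub>E s\<in>elts (shp M i).
      fam_hom I (pos M i s) (shp M) \<rightarrow>\<^sub>E elts (shp M i))"
    using typed unfolding icms_typed_def by (elim conjE)
  from PiE_mem[OF PiE_mem[OF PiE_mem[OF this assms(1)] assms(2)] assms(3)] show ?thesis .
qed

context
  fixes i s s' j p
  assumes p: "i \<in> elts I" "s \<in> elts (shp M i)" "s' \<in> fam_hom I (pos M i s) (shp M)"
    "j \<in> elts I" "p \<in> elts (pos M i (ibul M i s s') j)"
begin

lemma up_nw_ne_mem: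
  "up M i s s' j p \<in> elts I"
  "nw M i s s' j p \<in> elts (pos M i s (up M i s s' j p))"
  "ne M i s s' j p \<in> elts (pos M (up M i s s' j p) (s' (up M i s s' j p) (nw M i s s' j p)) j)"
proof -
  have "up M \<in> (\<Pi>\<^sub>E i\<in>elts I. \<Pi>\<^sub>E s\<in>elts (shp M i). \<Pi>\<^sub>E s'\<in>fam_hom I (pos M i s) (shp M).
      \<Pi>\<^sub>E j\<in>elts I. \<Pi>\<^sub>E p\<in>elts (pos M i (ibul M i s s') j). elts I)"
    and "nw M \<in> (\<Pi>\<^sub>E i\<in>elts I. \<Pi>\<^sub>E s\<in>elts (shp M i). \<Pi>\<^sub>E s'\<in>fam_hom I (pos M i s) (shp M).
      \<Pi>\<^sub>E j\<in>elts I. \<Pi>\<^sub>E p\<in>elts (pos M i (ibul M i s s') j). elts (pos M i s (up M i s s' j p)))"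
    and "ne M \<in> (\<Pi>\<^sub>E i\<in>elts I. \<Pi>\<^sub>E s\<in>elts (shp M i). \<Pi>\<^sub>E s'\<in>fam_hom I (pos M i s) (shp M).
      \<Pi>\<^sub>E j\<in>elts I. \<Pi>\<^sub>E p\<in>elts (pos M i (ibul M i s s') j).
        elts (pos M (up M i s s' j p) (s' (up M i s s' j p) (nw M i s s' j p)) j))"
    using typed by (simp_all only: icms_typed_def)
  from this[THEN PiE_mem, OF p(1), THEN PiE_mem, OF p(2), THEN PiE_mem, OF p(3),
      THEN PiE_mem, OF p(4), THEN PiE_mem, OF p(5)]
  show "up M i s s' j p \<in> elts I"
    "nw M i s s' j p \<in> elts (pos M i s (up M i s s' j p))"
    "ne M i s s' j p \<in> elts (pos M (up M i s s' j p) (s' (up M i s s' j p) (nw M i s s' j p)) j)" .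
qed

end

lemmas up_mem = up_nw_ne_mem(1) and nw_mem = up_nw_ne_mem(2) and ne_mem = up_nw_ne_mem(3)

lemma unit_trans_app:
  "X \<in> Fam \<Longrightarrow> i \<in> elts I \<Longrightarrow> x \<in> elts (X i) \<Longrightarrow>
    unit_trans M X i x = ext_elt M i (ie M i) (\<lambda>j q. x)"
  unfolding unit_trans_def by simp

lemma unit_trans_hom:
  assumes X: "X \<in> Fam"
  shows "unit_trans M X \<in> fam_hom I X (ext_obj M X)"
proof -
  have "fam_lam X (\<lambda>i x. ext_elt M i (ie M i) (\<lambda>j q. x)) \<in> fam_hom I X (ext_obj M X)"
    by (intro fam_hom_lamI ext_obj_eltI ie_mem) (auto dest: pos_ie)
  with X show ?thesis
    unfolding unit_trans_def by simp
qed

lemma unit_trans_natural: "unit_trans M \<in> Trans (id_functor (SetFam I)) (extent I (icontainer.truncate M))"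
proof (rule transI)
  fix X Y f i u
  assume X: "X \<in> Fam" "Y \<in> Fam" and f: "f \<in> fam_hom I X Y" and i: "i \<in> elts I"
    and "u \<in> elts (fobj (id_functor (SetFam I)) X i)"
  then have u: "u \<in> elts (X i)"
    by simp
  \<comment> \<open>The two label families \<open>f i u\<close> and \<open>f j u\<close> agree since
    every position of the unit shape has \<open>j = i\<close>.\<close>
  have "unit_trans M Y i (f i u) = ext_elt M i (ie M i) (\<lambda>j q. f j u)"
    using X i u fam_hom_mem[OF f i u] by (auto simp: unit_trans_app intro!: ext_elt_eqI dest: pos_ie)
  also have "\<dots> = farr (extent I (icontainer.truncate M)) X Y f i (ext_elt M i (ie M i) (\<lambda>j q. u))"
    using u by (intro farr_ext_obj[symmetric] X f i ie_mem) (auto dest: pos_ie[OF i])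
  finally show "unit_trans M Y i (farr (id_functor (SetFam I)) X Y f i u) =
      farr (extent I (icontainer.truncate M)) X Y f i (unit_trans M X i u)"
    using X f i u by (simp add: unit_trans_app)
qed (simp_all add: unit_trans_hom, simp add: unit_trans_def)

text \<open>The computation rule used for all laws. Since \<open>h\<close> has to be in nested form
  only at positions of \<open>s\<close>, the rule applies to results of earlier steps, with
  \<open>s'\<close> prescribed as \<open>const_fam\<close>, \<open>hat_fam\<close> or another
  explicit family.\<close>

lemma mult_trans_app:
  assumes X: "X \<in> Fam" and s: "i \<in> elts I" "s \<in> elts (shp M i)" "s' \<in> fam_hom I (pos M i s) (shp M)"
    and x: "\<And>k q j r. k \<in> elts I \<Longrightarrow> q \<in> elts (pos M i s k) \<Longrightarrow> j \<in> elts I \<Longrightarrow>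
      r \<in> elts (pos M k (s' k q) j) \<Longrightarrow> x k q j r \<in> elts (X j)"
    and h: "\<And>k q. k \<in> elts I \<Longrightarrow> q \<in> elts (pos M i s k) \<Longrightarrow> h k q = ext_elt M k (s' k q) (x k q)"
  shows "mult_trans M X i (ext_elt M i s h) = ext_elt M i (ibul M i s s')
    (\<lambda>j p. x (up M i s s' j p) (nw M i s s' j p) j (ne M i s s' j p))"
proof -
  let ?u = "ext_elt M i s h"
  have u: "?u \<in> elts (ext_obj M (ext_obj M X) i)"
    using s x fam_hom_mem[OF s(3)] by (intro ext_obj_eltI) (auto simp: h intro!: ext_obj_eltI)
  \<comment> \<open>The family of inner shapes that \<open>mult_trans\<close> reconstructs equals
    the prescribed one as an HOL function, hence \<open>ibul\<close> and the arrows receive the same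
    argument.\<close>
  have s': "fam_lam (pos M i s) (\<lambda>k q. vfst (ext_fun M i ?u k q)) = s'"
    by (rule fam_hom_eqI[OF fam_hom_lamI[where Y = "shp M"] s(3)]) (simp_all add: h fam_hom_mem[OF s(3)])
  have "mult_trans M X i ?u = ext_elt M i (ibul M i s s')
      (\<lambda>j p. ext_fun M (up M i s s' j p) (ext_fun M i ?u (up M i s s' j p) (nw M i s s' j p)) j
        (ne M i s s' j p))"
    using X s(1) u s' unfolding mult_trans_def Let_def vfst_ext_elt by simp
  also have "\<dots> = ext_elt M i (ibul M i s s')
      (\<lambda>j p. x (up M i s s' j p) (nw M i s s' j p) j (ne M i s s' j p))"
    by (rule ext_elt_eqI) (simp_all add: h up_mem[OF s] nw_mem[OF s] ne_mem[OF s])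
  finally show ?thesis .
qed

lemma mult_trans_elt:
  assumes "X \<in> Fam" "i \<in> elts I" "s \<in> elts (shp M i)" "s' \<in> fam_hom I (pos M i s) (shp M)"
    and x: "x \<in> fam_Pi (pos M i s) (\<lambda>k q. fam_hom I (pos M k (s' k q)) X)"
  shows "mult_trans M X i (ext_elt M i s (\<lambda>k q. ext_elt M k (s' k q) (x k q))) =
    ext_elt M i (ibul M i s s') (\<lambda>j p. x (up M i s s' j p) (nw M i s s' j p) j (ne M i s s' j p))"
  by (rule mult_trans_app[where s' = s' and x = x, OF assms(1-4)])
    (assumption | rule refl fam_hom_mem[OF fam_Pi_mem[OF x]])+

lemma mult_trans_hom:
  assumes X: "X \<in> Fam"
  shows "mult_trans M X \<in> fam_hom I (ext_obj M (ext_obj M X)) (ext_obj M X)"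
proof -
  have "mult_trans M X = fam_lam (ext_obj M (ext_obj M X)) (mult_trans M X)"
    using X unfolding mult_trans_def by (auto intro!: ext)
  moreover have "mult_trans M X i u \<in> elts (ext_obj M X i)"
    if i: "i \<in> elts I" and u: "u \<in> elts (ext_obj M (ext_obj M X) i)" for i u
  proof -
    from u i obtain s s' x where u: "u = ext_elt M i s (\<lambda>k q. ext_elt M k (s' k q) (x k q))"
      and s: "s \<in> elts (shp M i)" and s': "s' \<in> fam_hom I (pos M i s) (shp M)"
      and x: "x \<in> fam_Pi (pos M i s) (\<lambda>k q. fam_hom I (pos M k (s' k q)) X)"
      by (rule ext_obj_elt2E)
    note xh = fam_hom_mem[OF fam_Pi_mem[OF x]]
    show ?thesis
      unfolding u mult_trans_elt[OF X i s s' x]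
      by (intro ext_obj_eltI i ibul_mem[OF i s s'] xh up_mem[OF i s s'] nw_mem[OF i s s'] ne_mem[OF i s s'])
  qed
  ultimately show ?thesis
    using fam_hom_lamI[of "ext_obj M (ext_obj M X)" "mult_trans M X" "ext_obj M X"] by simp
qed

lemma mult_trans_natural:
  defines "T \<equiv> extent I (icontainer.truncate M)"
  shows "mult_trans M \<in> Trans (endo_comp T T) T"
proof (rule transI)
  fix X Y f i u
  assume X: "X \<in> Fam" "Y \<in> Fam" and f: "f \<in> fam_hom I X Y" and i: "i \<in> elts I"
    and "u \<in> elts (fobj (endo_comp T T) X i)"
  then have "u \<in> elts (ext_obj M (ext_obj M X) i)"
    by (simp add: T_def)
  then obtain s s' x where u: "u = ext_elt M i s (\<lambda>k q. ext_elt M k (s' k q) (x k q))"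
    and s: "s \<in> elts (shp M i)" and s': "s' \<in> fam_hom I (pos M i s) (shp M)"
    and x: "x \<in> fam_Pi (pos M i s) (\<lambda>k q. fam_hom I (pos M k (s' k q)) X)"
    using i by (rule ext_obj_elt2E)
  note xh = fam_hom_mem[OF fam_Pi_mem[OF x]]
  note sh = fam_hom_mem[OF s']
  have Tf: "farr T X Y f \<in> fam_hom I (ext_obj M X) (ext_obj M Y)"
    unfolding T_def by (rule farr_extent_hom[OF X f])
  have "farr (endo_comp T T) X Y f i u = farr T (ext_obj M X) (ext_obj M Y) (farr T X Y f) i u"
    using X f by (simp add: T_def)
  also have "\<dots> = ext_elt M i s (\<lambda>k q. farr T X Y f k (ext_elt M k (s' k q) (x k q)))"
    unfolding u T_def
    by (rule farr_ext_obj) (simp_all add: Tf[unfolded T_def] i s ext_obj_eltI sh xh)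
  finally have "mult_trans M Y i (farr (endo_comp T T) X Y f i u) =
      mult_trans M Y i (ext_elt M i s (\<lambda>k q. farr T X Y f k (ext_elt M k (s' k q) (x k q))))"
    by (rule arg_cong)
  also have "\<dots> = ext_elt M i (ibul M i s s')
      (\<lambda>j p. f j (x (up M i s s' j p) (nw M i s s' j p) j (ne M i s s' j p)))"
    unfolding T_def
    by (rule mult_trans_app[where x = "\<lambda>k q j r. f j (x k q j r)"])
      (simp_all add: X f i s s' sh xh fam_hom_mem[OF f] farr_ext_obj)
  also have "\<dots> = farr T X Y f i (mult_trans M X i u)"
    unfolding u T_def mult_trans_elt[OF X(1) i s s' x]
    by (rule farr_ext_obj[symmetric])
      (simp_all add: X f i s s' ibul_mem xh up_mem[OF i s s'] nw_mem[OF i s s'] ne_mem[OF i s s'])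
  finally show "mult_trans M Y i (farr (endo_comp T T) X Y f i u) = farr T X Y f i (mult_trans M X i u)" .
qed (simp_all add: mult_trans_hom T_def, simp add: mult_trans_def)

section \<open>The sides of the unit laws, computed on elements\<close>

lemma unit_fam_hom: "i \<in> elts I \<Longrightarrow> unit_fam I M i s \<in> fam_hom I (pos M i s) (shp M)"
  unfolding unit_fam_def by (intro fam_hom_lamI ie_mem)

lemma const_fam_hom:
  "i \<in> elts I \<Longrightarrow> s \<in> elts (shp M i) \<Longrightarrow>
    const_fam I M i s \<in> fam_hom I (pos M i (ie M i)) (shp M)"
  unfolding const_fam_def by (rule fam_hom_lamI) (auto dest: pos_ie)

text \<open>The \<open>ne\<close> component of \<open>p\<close> is a position at \<open>j\<close> of
  the unit shape at index \<open>up p\<close>, and unit shapes have positions only at their own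
  index. This makes the law for \<open>nw\<close> well-typed.\<close>

lemma up_unit_fam:
  assumes s: "i \<in> elts I" "s \<in> elts (shp M i)"
    and p: "j \<in> elts I" "p \<in> elts (pos M i (ibul M i s (unit_fam I M i s)) j)"
  shows "up M i s (unit_fam I M i s) j p = j"
  using ne_mem[OF s unit_fam_hom[OF s(1)] p] up_mem[OF s unit_fam_hom[OF s(1)] p]
    nw_mem[OF s unit_fam_hom[OF s(1)] p] p(1)
  by (auto simp: unit_fam_def dest: pos_ie)

text \<open>Computed from the typing alone, so that one formula serves both directions: comparing it
  with \<open>ext_elt M i s h\<close> yields the monad law from the ICMS laws and conversely. All
  positions of the unit shape are at \<open>i\<close>, so the inner shapes form
  \<open>const_fam\<close>.\<close>

lemma mult_unit_left:
  assumes X: "X \<in> Fam" and s: "i \<in> elts I" "s \<in> elts (shp M i)"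
    and h: "\<And>j q. j \<in> elts I \<Longrightarrow> q \<in> elts (pos M i s j) \<Longrightarrow> h j q \<in> elts (X j)"
  shows "mult_trans M X i (unit_trans M (ext_obj M X) i (ext_elt M i s h)) =
    ext_elt M i (ibul M i (ie M i) (const_fam I M i s))
      (\<lambda>j p. h j (ne M i (ie M i) (const_fam I M i s) j p))"
proof -
  have "unit_trans M (ext_obj M X) i (ext_elt M i s h) = ext_elt M i (ie M i) (\<lambda>k q. ext_elt M i s h)"
    by (rule unit_trans_app) (simp_all add: s ext_obj_eltI h)
  moreover have "mult_trans M X i (ext_elt M i (ie M i) (\<lambda>k q. ext_elt M i s h)) =
      ext_elt M i (ibul M i (ie M i) (const_fam I M i s))
        (\<lambda>j p. h j (ne M i (ie M i) (const_fam I M i s) j p))"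
  proof (rule mult_trans_app[OF X s(1) ie_mem[OF s(1)] const_fam_hom[OF s], where x = "\<lambda>k q. h"])
    fix k q assume k: "k \<in> elts I" "q \<in> elts (pos M i (ie M i) k)"
    have k_eq: "k = i"
      by (rule pos_ie[OF s(1) k])
    have c: "const_fam I M i s k q = s"
      using k by (simp add: const_fam_def)
    show "ext_elt M i s h = ext_elt M k (const_fam I M i s k q) h"
      using k_eq c by simp
    show "h j r \<in> elts (X j)" if "j \<in> elts I" "r \<in> elts (pos M k (const_fam I M i s k q) j)" for j r
      using that h k_eq c by simp
  qed
  ultimately show ?thesis
    by simp
qed

lemma mult_unit_right:
  assumes X: "X \<in> Fam" and s: "i \<in> elts I" "s \<in> elts (shp M i)"
    and h: "\<And>j q. j \<in> elts I \<Longrightarrow> q \<in> elts (pos M i s j) \<Longrightarrow> h j q \<in> elts (X j)"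
  shows "mult_trans M X i (farr (extent I (icontainer.truncate M)) X (ext_obj M X) (unit_trans M X) i
      (ext_elt M i s h)) =
    ext_elt M i (ibul M i s (unit_fam I M i s)) (\<lambda>j p. h j (nw M i s (unit_fam I M i s) j p))"
proof -
  \<comment> \<open>The label of a composite position is \<open>h k q\<close>, independently of the
    inner position \<open>r\<close>. It lies in \<open>X j\<close> because an inner position of the
    unit shape at \<open>k\<close> forces \<open>j = k\<close>.\<close>
  have x: "h k q \<in> elts (X j)"
    if "k \<in> elts I" "q \<in> elts (pos M i s k)" "j \<in> elts I" "r \<in> elts (pos M k (unit_fam I M i s k q) j)"
    for k q j r
    using that h[OF that(1,2)] pos_ie[OF that(1,3)] by (auto simp: unit_fam_def)
  have "farr (extent I (icontainer.truncate M)) X (ext_obj M X) (unit_trans M X) i (ext_elt M i s h) =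
      ext_elt M i s (\<lambda>k q. unit_trans M X k (h k q))"
    by (rule farr_ext_obj) (simp_all add: X s unit_trans_hom h)
  moreover have "mult_trans M X i (ext_elt M i s (\<lambda>k q. unit_trans M X k (h k q))) =
      ext_elt M i (ibul M i s (unit_fam I M i s))
        (\<lambda>j p. h (up M i s (unit_fam I M i s) j p) (nw M i s (unit_fam I M i s) j p))"
    by (rule mult_trans_app[OF X s unit_fam_hom[OF s(1)], of "\<lambda>k q j r. h k q"])
      (simp_all add: X unit_trans_app h x unit_fam_def)
  moreover have "\<dots> = ext_elt M i (ibul M i s (unit_fam I M i s))
      (\<lambda>j p. h j (nw M i s (unit_fam I M i s) j p))"
    by (rule ext_elt_eqI) (simp_all add: up_unit_fam s)
  ultimately show ?thesis
    by simp
qed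

section \<open>The two sides of associativity on triply nested elements\<close>

context
  fixes i s s' s''
  assumes i: "i \<in> elts I" and s: "s \<in> elts (shp M i)" and s': "s' \<in> fam_hom I (pos M i s) (shp M)"
    and s'': "s'' \<in> fam_Pi (pos M i s) (\<lambda>k q. fam_hom I (pos M k (s' k q)) (shp M))"
begin

lemma hat_fam_hom: "hat_fam I M i s s' s'' \<in> fam_hom I (pos M i (ibul M i s s')) (shp M)"
  unfolding hat_fam_def
  by (intro fam_hom_lamI fam_hom_mem[OF fam_Pi_mem[OF s'']]
      up_mem[OF i s s'] nw_mem[OF i s s'] ne_mem[OF i s s'])

lemma bul_fam_hom: "bul_fam I M i s s' s'' \<in> fam_hom I (pos M i s) (shp M)"
  unfolding bul_fam_def
  by (intro fam_hom_lamI ibul_mem fam_hom_mem[OF s'] fam_Pi_mem[OF s''])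

context
  fixes X x
  assumes X: "X \<in> Fam"
    and x_all: "\<forall>k\<in>elts I. \<forall>q\<in>elts (pos M i s k). \<forall>l\<in>elts I. \<forall>r\<in>elts (pos M k (s' k q) l).
      \<forall>j\<in>elts I. \<forall>t\<in>elts (pos M l (s'' k q l r) j). x k q l r j t \<in> elts (X j)"
begin

text \<open>The outer two layers are merged first. At a position of \<open>s\<close> composed with
  \<open>s'\<close>, the remaining inner shape is found by following the arrows, which is the family
  \<open>hat_fam\<close>.\<close>

lemma mult_mult_left:
  "mult_trans M X i (mult_trans M (ext_obj M X) i
     (ext_elt M i s (\<lambda>k q. ext_elt M k (s' k q) (\<lambda>l r. ext_elt M l (s'' k q l r) (x k q l r))))) =
   (let t = ibul M i s s'; h = hat_fam I M i s s' s'' in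
    ext_elt M i (ibul M i t h) (\<lambda>j p. let l = up M i t h j p; p' = nw M i t h j p in
      x (up M i s s' l p') (nw M i s s' l p') l (ne M i s s' l p') j (ne M i t h j p)))"
proof -
  let ?t = "ibul M i s s'" and ?h = "hat_fam I M i s s' s''"
  note x = x_all[rule_format]
  note s''_mem = fam_hom_mem[OF fam_Pi_mem[OF s'']]
  note arrows = up_mem[OF i s s'] nw_mem[OF i s s'] ne_mem[OF i s s']
  have h: "?h l p = s'' (up M i s s' l p) (nw M i s s' l p) l (ne M i s s' l p)"
    if "l \<in> elts I" "p \<in> elts (pos M i ?t l)" for l p
    using that by (simp add: hat_fam_def)
  have "mult_trans M (ext_obj M X) i
     (ext_elt M i s (\<lambda>k q. ext_elt M k (s' k q) (\<lambda>l r. ext_elt M l (s'' k q l r) (x k q l r)))) =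
     ext_elt M i ?t (\<lambda>l p. ext_elt M l
       (s'' (up M i s s' l p) (nw M i s s' l p) l (ne M i s s' l p))
       (x (up M i s s' l p) (nw M i s s' l p) l (ne M i s s' l p)))"
    by (rule mult_trans_app[OF _ i s s', where x = "\<lambda>k q l r. ext_elt M l (s'' k q l r) (x k q l r)"])
      (simp_all add: ext_obj_eltI s''_mem x)
  moreover have "mult_trans M X i (ext_elt M i ?t (\<lambda>l p. ext_elt M l
       (s'' (up M i s s' l p) (nw M i s s' l p) l (ne M i s s' l p))
       (x (up M i s s' l p) (nw M i s s' l p) l (ne M i s s' l p)))) =
     ext_elt M i (ibul M i ?t ?h) (\<lambda>j p.
       (\<lambda>l p'. x (up M i s s' l p') (nw M i s s' l p') l (ne M i s s' l p'))
         (up M i ?t ?h j p) (nw M i ?t ?h j p) j (ne M i ?t ?h j p))"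
    by (rule mult_trans_app[OF X i ibul_mem[OF i s s'] hat_fam_hom,
          where x = "\<lambda>l p'. x (up M i s s' l p') (nw M i s s' l p') l (ne M i s s' l p')"])
      (simp_all add: h x arrows)
  ultimately show ?thesis
    by (simp add: Let_def)
qed

text \<open>The inner two layers are merged first, separately under each position of
  \<open>s\<close>, which turns the inner shapes into \<open>bul_fam\<close>; each label is then
  reached through two successive decompositions of \<open>p\<close>.\<close>

lemma mult_mult_right:
  "mult_trans M X i (farr (extent I (icontainer.truncate M)) (ext_obj M (ext_obj M X)) (ext_obj M X)
     (mult_trans M X) i
     (ext_elt M i s (\<lambda>k q. ext_elt M k (s' k q) (\<lambda>l r. ext_elt M l (s'' k q l r) (x k q l r))))) =
   (let b = bul_fam I M i s s' s'' in
    ext_elt M i (ibul M i s b) (\<lambda>j p.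
      let k = up M i s b j p; q = nw M i s b j p; r = ne M i s b j p in
      x k q (up M k (s' k q) (s'' k q) j r) (nw M k (s' k q) (s'' k q) j r) j
        (ne M k (s' k q) (s'' k q) j r)))"
proof -
  let ?b = "bul_fam I M i s s' s''"
  note x = x_all[rule_format]
  note s_mem = fam_hom_mem[OF s'] and s''_hom = fam_Pi_mem[OF s'']
  note s''_mem = fam_hom_mem[OF s''_hom]
  have b: "?b k q = ibul M k (s' k q) (s'' k q)" if "k \<in> elts I" "q \<in> elts (pos M i s k)" for k q
    using that by (simp add: bul_fam_def)
  have m: "mult_trans M X k (ext_elt M k (s' k q) (\<lambda>l r. ext_elt M l (s'' k q l r) (x k q l r))) =
      ext_elt M k (?b k q) (\<lambda>j r. x k q (up M k (s' k q) (s'' k q) j r)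
        (nw M k (s' k q) (s'' k q) j r) j (ne M k (s' k q) (s'' k q) j r))"
    if k: "k \<in> elts I" "q \<in> elts (pos M i s k)" for k q
    unfolding b[OF k]
    by (rule mult_trans_app[OF X k(1) s_mem[OF k] s''_hom[OF k]]) (simp_all add: x k)
  have "farr (extent I (icontainer.truncate M)) (ext_obj M (ext_obj M X)) (ext_obj M X) (mult_trans M X) i
     (ext_elt M i s (\<lambda>k q. ext_elt M k (s' k q) (\<lambda>l r. ext_elt M l (s'' k q l r) (x k q l r)))) =
     ext_elt M i s (\<lambda>k q. mult_trans M X k
       (ext_elt M k (s' k q) (\<lambda>l r. ext_elt M l (s'' k q l r) (x k q l r))))"
    by (rule farr_ext_obj) (simp_all add: mult_trans_hom X i s ext_obj_eltI s_mem s''_mem x)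
  moreover have "mult_trans M X i (ext_elt M i s (\<lambda>k q. mult_trans M X k
       (ext_elt M k (s' k q) (\<lambda>l r. ext_elt M l (s'' k q l r) (x k q l r))))) =
     ext_elt M i (ibul M i s ?b) (\<lambda>j p.
       (\<lambda>k q j r. x k q (up M k (s' k q) (s'' k q) j r)
         (nw M k (s' k q) (s'' k q) j r) j (ne M k (s' k q) (s'' k q) j r))
       (up M i s ?b j p) (nw M i s ?b j p) j (ne M i s ?b j p))"
  proof (rule mult_trans_app[OF X i s bul_fam_hom])
    fix k q j r
    assume k: "k \<in> elts I" "q \<in> elts (pos M i s k)" "j \<in> elts I" "r \<in> elts (pos M k (?b k q) j)"
    note k_mem = k(1) s_mem[OF k(1,2)] s''_hom[OF k(1,2)] k(3) k(4)[unfolded b[OF k(1,2)]]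
    show "x k q (up M k (s' k q) (s'' k q) j r) (nw M k (s' k q) (s'' k q) j r) j
        (ne M k (s' k q) (s'' k q) j r) \<in> elts (X j)"
      by (intro x k up_mem[OF k_mem] nw_mem[OF k_mem] ne_mem[OF k_mem])
  qed (rule m)
  ultimately show ?thesis
    by (simp add: Let_def)
qed

end

end

section \<open>ICMS laws versus monad laws\<close>

lemma pos_Fam: "i \<in> elts I \<Longrightarrow> s \<in> elts (shp M i) \<Longrightarrow> pos M i s \<in> Fam"
  by (rule pos_Fam_of_icontainer) (use typed in \<open>simp_all add: icms_typed_def\<close>)

text \<open>The ICMS laws equate composite shapes and decomposed positions; applying arbitrary
  labels to the positions gives the monad laws on normal forms.\<close>

lemma monad_of_obj:
  assumes laws: "icms_laws I M"
  shows "monad_of M \<in> Obj (Mnd I)"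
proof -
  let ?T = "extent I (icontainer.truncate M)"
  have "mult_trans M X i (unit_trans M (ext_obj M X) i u) = u \<and>
      mult_trans M X i (farr ?T X (ext_obj M X) (unit_trans M X) i u) = u"
    if X: "X \<in> Fam" and i: "i \<in> elts I" and u: "u \<in> elts (ext_obj M X i)" for X i u
  proof -
    from u i obtain s h where u: "u = ext_elt M i s h" and s: "s \<in> elts (shp M i)"
      and h: "h \<in> fam_hom I (pos M i s) X"
      by (rule ext_obj_eltE)
    note hm = fam_hom_mem[OF h]
    have "ibul M i s (unit_fam I M i s) = s \<and>
        (\<forall>j\<in>elts I. \<forall>p\<in>elts (pos M i s j). nw M i s (unit_fam I M i s) j p = p) \<and>
        ibul M i (ie M i) (const_fam I M i s) = s \<and>
        (\<forall>j\<in>elts I. \<forall>p\<in>elts (pos M i s j). ne M i (ie M i) (const_fam I M i s) j p = p)"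
      using laws i s unfolding icms_laws_def by blast
    then show ?thesis
      unfolding u by (simp add: mult_unit_left[OF X i s hm] mult_unit_right[OF X i s hm] ext_elt_eq_iff)
  qed
  moreover have "mult_trans M X i (mult_trans M (ext_obj M X) i u) =
      mult_trans M X i (farr ?T (ext_obj M (ext_obj M X)) (ext_obj M X) (mult_trans M X) i u)"
    if X: "X \<in> Fam" and i: "i \<in> elts I" and u: "u \<in> elts (ext_obj M (ext_obj M (ext_obj M X)) i)"
    for X i u
  proof -
    from u i obtain s s' s'' x where u: "u = ext_elt M i s (\<lambda>k q. ext_elt M k (s' k q)
        (\<lambda>l r. ext_elt M l (s'' k q l r) (x k q l r)))"
      and s: "s \<in> elts (shp M i)" "s' \<in> fam_hom I (pos M i s) (shp M)"
        "s'' \<in> fam_Pi (pos M i s) (\<lambda>k q. fam_hom I (pos M k (s' k q)) (shp M))"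
      and x: "\<forall>k\<in>elts I. \<forall>q\<in>elts (pos M i s k). \<forall>l\<in>elts I. \<forall>r\<in>elts (pos M k (s' k q) l).
        \<forall>j\<in>elts I. \<forall>t\<in>elts (pos M l (s'' k q l r) j). x k q l r j t \<in> elts (X j)"
      by (rule ext_obj_elt3E)
    note law = laws[unfolded icms_laws_def Let_def, THEN conjunct2, rule_format, OF i s]
    show ?thesis
      unfolding u mult_mult_left[OF i s X x] mult_mult_right[OF i s X x] Let_def
      by (rule ext_elt_eqI, rule law[THEN conjunct1], drule (1) law[THEN conjunct2, rule_format],
          elim conjE, simp)
  qed
  ultimately show ?thesis
    by (simp add: Mnd_obj_iff Let_def extent_endofunctor unit_trans_natural mult_trans_natural)
qed

text \<open>Stated for any well-typed structure, so it also supplies the laws for the structure read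
  off a given monad.\<close>

lemma icms_laws_of_monad:
  assumes monad: "monad_of M \<in> Obj (Mnd I)"
  shows "icms_laws I M"
proof -
  let ?T = "extent I (icontainer.truncate M)"
  have unit_l: "mult_trans M X i (unit_trans M (ext_obj M X) i u) = u"
    and unit_r: "mult_trans M X i (farr ?T X (ext_obj M X) (unit_trans M X) i u) = u"
    if "X \<in> Fam" "i \<in> elts I" "u \<in> elts (ext_obj M X i)" for X i u
    using monad that by (simp_all add: Mnd_obj_iff Let_def)
  have assoc: "mult_trans M X i (mult_trans M (ext_obj M X) i u) =
      mult_trans M X i (farr ?T (ext_obj M (ext_obj M X)) (ext_obj M X) (mult_trans M X) i u)"
    if "X \<in> Fam" "i \<in> elts I" "u \<in> elts (ext_obj M (ext_obj M (ext_obj M X)) i)" for X i u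
    using monad that by (simp add: Mnd_obj_iff Let_def)
  show ?thesis
    unfolding icms_laws_def Let_def
  proof (rule conjI; (intro ballI)?)
    fix i s assume i: "i \<in> elts I" and s: "s \<in> elts (shp M i)"
    \<comment> \<open>With every position labelled by itself, equality of labels is equality of
      positions, so the unit laws yield the equations for \<open>nw\<close> and
      \<open>ne\<close>.\<close>
    let ?u = "ext_elt M i s (\<lambda>j q. q)"
    note X = pos_Fam[OF i s]
    have u: "?u \<in> elts (ext_obj M (pos M i s) i)"
      by (intro ext_obj_eltI i s)
    show "ibul M i s (unit_fam I M i s) = s \<and>
        (\<forall>j\<in>elts I. \<forall>p\<in>elts (pos M i s j). nw M i s (unit_fam I M i s) j p = p) \<and>
        ibul M i (ie M i) (const_fam I M i s) = s \<and>
        (\<forall>j\<in>elts I. \<forall>p\<in>elts (pos M i s j). ne M i (ie M i) (const_fam I M i s) j p = p)"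
      using unit_l[OF X i u] unit_r[OF X i u]
      by (simp add: mult_unit_left[OF X i s] mult_unit_right[OF X i s] ext_elt_eq_iff)
  next
    fix i s s' s''
    assume i: "i \<in> elts I" and s: "s \<in> elts (shp M i)" "s' \<in> fam_hom I (pos M i s) (shp M)"
      "s'' \<in> fam_Pi (pos M i s) (\<lambda>k q. fam_hom I (pos M k (s' k q)) (shp M))"
    \<comment> \<open>the universal element: every composite position is labelled by the tuple of its parts\<close>
    define X where "X = (\<lambda>j\<in>elts I. vsigma I (\<lambda>k. vsigma (pos M i s k) (\<lambda>q.
      vsigma I (\<lambda>l. vsigma (pos M k (s' k q) l) (\<lambda>r. pos M l (s'' k q l r) j)))))"
    define x where "x = (\<lambda>k q l r (j::'u) t::'u. vpair k (vpair q (vpair l (vpair r t))))"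
    let ?u = "ext_elt M i s (\<lambda>k q. ext_elt M k (s' k q) (\<lambda>l r. ext_elt M l (s'' k q l r) (x k q l r)))"
    have X: "X \<in> Fam"
      by (simp add: X_def)
    have x: "\<forall>k\<in>elts I. \<forall>q\<in>elts (pos M i s k). \<forall>l\<in>elts I. \<forall>r\<in>elts (pos M k (s' k q) l).
      \<forall>j\<in>elts I. \<forall>t\<in>elts (pos M l (s'' k q l r) j). x k q l r j t \<in> elts (X j)"
      by (simp add: X_def x_def)
    have u: "?u \<in> elts (ext_obj M (ext_obj M (ext_obj M X)) i)"
      by (intro ext_obj_eltI i s fam_hom_mem[OF s(2)] fam_hom_mem[OF fam_Pi_mem[OF s(3)]]
          x[rule_format])
    let ?t = "ibul M i s s'" and ?h = "hat_fam I M i s s' s''" and ?b = "bul_fam I M i s s' s''"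
    have "ext_elt M i (ibul M i ?t ?h) (\<lambda>j p. let l = up M i ?t ?h j p; p' = nw M i ?t ?h j p in
        x (up M i s s' l p') (nw M i s s' l p') l (ne M i s s' l p') j (ne M i ?t ?h j p)) =
      ext_elt M i (ibul M i s ?b) (\<lambda>j p.
        let k = up M i s ?b j p; q = nw M i s ?b j p; r = ne M i s ?b j p in
        x k q (up M k (s' k q) (s'' k q) j r) (nw M k (s' k q) (s'' k q) j r) j
          (ne M k (s' k q) (s'' k q) j r))"
      using assoc[OF X i u] unfolding mult_mult_left[OF i s X x] mult_mult_right[OF i s X x]
      by (simp only: Let_def)
    then show "ibul M i ?t ?h = ibul M i s ?b \<and>
        (\<forall>j\<in>elts I. \<forall>p\<in>elts (pos M i (ibul M i ?t ?h) j).
           up M i ?t ?h j p = up M (up M i s ?b j p) (s' (up M i s ?b j p) (nw M i s ?b j p))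
             (s'' (up M i s ?b j p) (nw M i s ?b j p)) j (ne M i s ?b j p) \<and>
           up M i s s' (up M i ?t ?h j p) (nw M i ?t ?h j p) = up M i s ?b j p \<and>
           nw M i s s' (up M i ?t ?h j p) (nw M i ?t ?h j p) = nw M i s ?b j p \<and>
           ne M i s s' (up M i ?t ?h j p) (nw M i ?t ?h j p) =
             nw M (up M i s ?b j p) (s' (up M i s ?b j p) (nw M i s ?b j p))
               (s'' (up M i s ?b j p) (nw M i s ?b j p)) j (ne M i s ?b j p) \<and>
           ne M i ?t ?h j p =
             ne M (up M i s ?b j p) (s' (up M i s ?b j p) (nw M i s ?b j p))
               (s'' (up M i s ?b j p) (nw M i s ?b j p)) j (ne M i s ?b j p))"
      \<comment> \<open>Labels are nested pairs, so injectivity of \<open>vpair\<close> splits their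
        equality into five components: these are the five required equations, up to order.\<close>
      unfolding ext_elt_eq_iff Let_def x_def vpair_eq_iff by blast
  qed
qed

end


section \<open>Transformations of extents\<close>

text \<open>The action of a container morphism on extents. Shapes go forward, positions backward, so
  labels are pulled back along the second component.\<close>

definition cont_trans ::
  "('u, 'y) icontainer_scheme \<Rightarrow> ('u, 'z) icontainer_scheme \<Rightarrow> 'u icontainer_mor \<Rightarrow> 'u endo_trans"
where
  "cont_trans K K' f = (\<lambda>X\<in>Fam. fam_lam (ext_obj K X) (\<lambda>i u.
     ext_elt K' i (fst f i (vfst u)) (\<lambda>j q. ext_fun K i u j (snd f i (vfst u) j q))))"

context
  fixes K :: "('u, 'y) icontainer_scheme" and K' :: "('u, 'z) icontainer_scheme" and \<sigma> \<pi>
  assumes hom: "(\<sigma>, \<pi>) \<in> icontainer_homs I K K'"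
begin

lemma shape_map_mem: "i \<in> elts I \<Longrightarrow> s \<in> elts (shp K i) \<Longrightarrow> \<sigma> i s \<in> elts (shp K' i)"
  using hom unfolding icontainer_homs_def by (auto dest: fam_Pi_mem)

lemma position_map_hom:
  "i \<in> elts I \<Longrightarrow> s \<in> elts (shp K i) \<Longrightarrow> \<pi> i s \<in> fam_hom I (pos K' i (\<sigma> i s)) (pos K i s)"
  using hom unfolding icontainer_homs_def by (auto dest: fam_Pi_mem)

lemma cont_trans_app:
  assumes X: "X \<in> Fam" and i: "i \<in> elts I" and s: "s \<in> elts (shp K i)"
    and h: "\<And>j q. j \<in> elts I \<Longrightarrow> q \<in> elts (pos K i s j) \<Longrightarrow> h j q \<in> elts (X j)"
  shows "cont_trans K K' (\<sigma>, \<pi>) X i (ext_elt K i s h) = ext_elt K' i (\<sigma> i s) (\<lambda>j q. h j (\<pi> i s j q))"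
proof -
  have "ext_elt K i s h \<in> elts (ext_obj K X i)"
    by (intro ext_obj_eltI i s h)
  then show ?thesis
    using X i
    by (simp add: cont_trans_def ext_elt_eq_iff fam_hom_mem[OF position_map_hom[OF i s]])
qed

lemma cont_trans_natural:
  "cont_trans K K' (\<sigma>, \<pi>) \<in> Trans (extent I (icontainer.truncate K)) (extent I (icontainer.truncate K'))"
proof (rule transI)
  fix X assume X: "X \<in> Fam"
  have "cont_trans K K' (\<sigma>, \<pi>) X = fam_lam (ext_obj K X) (cont_trans K K' (\<sigma>, \<pi>) X)"
    using X unfolding cont_trans_def by (auto intro!: HOL.ext)
  moreover have "cont_trans K K' (\<sigma>, \<pi>) X i u \<in> elts (ext_obj K' X i)"
    if i: "i \<in> elts I" and u: "u \<in> elts (ext_obj K X i)" for i u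
  proof -
    from u i obtain s h where u: "u = ext_elt K i s h" and s: "s \<in> elts (shp K i)"
      and h: "h \<in> fam_hom I (pos K i s) X"
      by (rule ext_obj_eltE)
    show ?thesis
      unfolding u using X i s
      by (simp add: cont_trans_app fam_hom_mem[OF h] ext_obj_eltI shape_map_mem
          fam_hom_mem[OF position_map_hom[OF i s]])
  qed
  ultimately show "cont_trans K K' (\<sigma>, \<pi>) X \<in> fam_hom I (fobj (extent I (icontainer.truncate K)) X)
      (fobj (extent I (icontainer.truncate K')) X)"
    using fam_hom_lamI[of "ext_obj K X" "cont_trans K K' (\<sigma>, \<pi>) X" "ext_obj K' X"] X by simp
next
  fix X Y f i u
  assume X: "X \<in> Fam" "Y \<in> Fam" and f: "f \<in> fam_hom I X Y" and i: "i \<in> elts I"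
    and "u \<in> elts (fobj (extent I (icontainer.truncate K)) X i)"
  then have "u \<in> elts (ext_obj K X i)"
    by simp
  then obtain s h where u: "u = ext_elt K i s h" and s: "s \<in> elts (shp K i)"
    and h: "h \<in> fam_hom I (pos K i s) X"
    using i by (rule ext_obj_eltE)
  show "cont_trans K K' (\<sigma>, \<pi>) Y i (farr (extent I (icontainer.truncate K)) X Y f i u) =
      farr (extent I (icontainer.truncate K')) X Y f i (cont_trans K K' (\<sigma>, \<pi>) X i u)"
    unfolding u using X f i s
    by (simp add: farr_ext_obj cont_trans_app shape_map_mem fam_hom_mem[OF f] fam_hom_mem[OF h]
        fam_hom_mem[OF position_map_hom[OF i s]])
qed (simp add: cont_trans_def)

end

lemma cont_trans_id: "cont_trans K K (icontainer_id I K) = (\<lambda>X\<in>Fam. fam_id I (ext_obj K X))"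
  unfolding cont_trans_def fam_id_def
proof (intro restrict_ext fam_lam_eqI)
  fix X i u assume i: "i \<in> elts I" and u: "u \<in> elts (ext_obj K X i)"
  from u i obtain s h where u: "u = ext_elt K i s h" and s: "s \<in> elts (shp K i)"
    and h: "h \<in> fam_hom I (pos K i s) X"
    by (rule ext_obj_eltE)
  show "ext_elt K i (fst (icontainer_id I K) i (vfst u))
      (\<lambda>j q. ext_fun K i u j (snd (icontainer_id I K) i (vfst u) j q)) = u"
    unfolding u using i s by (simp add: icontainer_id_def ext_elt_eq_iff)
qed

lemma icontainer_comp_simps:
  "i \<in> elts I \<Longrightarrow> s \<in> elts (shp K i) \<Longrightarrow> fst (icontainer_comp I K K' K'' (\<sigma>', \<pi>') (\<sigma>, \<pi>)) i s = \<sigma>' i (\<sigma> i s)"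
  "i \<in> elts I \<Longrightarrow> s \<in> elts (shp K i) \<Longrightarrow> j \<in> elts I \<Longrightarrow> q \<in> elts (pos K'' i (\<sigma>' i (\<sigma> i s)) j) \<Longrightarrow>
    snd (icontainer_comp I K K' K'' (\<sigma>', \<pi>') (\<sigma>, \<pi>)) i s j q = \<pi> i s j (\<pi>' i (\<sigma> i s) j q)"
  unfolding icontainer_comp_def by simp_all

text \<open>Together with \<open>cont_trans_id\<close> this is functoriality; with faithfulness it
  lets the category laws of \<open>ICMS\<close> be inherited from \<open>Mnd\<close>.\<close>

lemma cont_trans_comp:
  assumes f: "f \<in> icontainer_homs I K K'" and g: "g \<in> icontainer_homs I K' K''"
  shows "cont_trans K K'' (icontainer_comp I K K' K'' g f) =
    (\<lambda>X\<in>Fam. fam_comp I (ext_obj K X) (cont_trans K' K'' g X) (cont_trans K K' f X))"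
proof -
  obtain \<sigma> \<pi> \<sigma>' \<pi>' where eq: "f = (\<sigma>, \<pi>)" "g = (\<sigma>', \<pi>')"
    by (metis surj_pair)
  note f = f[unfolded eq] and g = g[unfolded eq]
  show ?thesis
    unfolding eq fam_comp_def cont_trans_def[of K K'']
  proof (intro restrict_ext fam_lam_eqI)
    fix X i u assume X: "X \<in> Fam" and i: "i \<in> elts I" and u: "u \<in> elts (ext_obj K X i)"
    from u i obtain s h where u: "u = ext_elt K i s h" and s: "s \<in> elts (shp K i)"
      and h: "h \<in> fam_hom I (pos K i s) X"
      by (rule ext_obj_eltE)
    note s' = shape_map_mem[OF f i s]
    note mem = fam_hom_mem[OF position_map_hom[OF f i s]] fam_hom_mem[OF position_map_hom[OF g i s']]
      fam_hom_mem[OF h]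
    have "cont_trans K' K'' (\<sigma>', \<pi>') X i (cont_trans K K' (\<sigma>, \<pi>) X i u) =
        ext_elt K'' i (\<sigma>' i (\<sigma> i s)) (\<lambda>j q. h j (\<pi> i s j (\<pi>' i (\<sigma> i s) j q)))"
      unfolding u by (simp add: cont_trans_app[OF f X i s] cont_trans_app[OF g X i s'] mem)
    then show "ext_elt K'' i (fst (icontainer_comp I K K' K'' (\<sigma>', \<pi>') (\<sigma>, \<pi>)) i (vfst u))
        (\<lambda>j q. ext_fun K i u j (snd (icontainer_comp I K K' K'' (\<sigma>', \<pi>') (\<sigma>, \<pi>)) i (vfst u) j q)) =
        cont_trans K' K'' (\<sigma>', \<pi>') X i (cont_trans K K' (\<sigma>, \<pi>) X i u)"
      unfolding u using i s by (simp add: icontainer_comp_simps ext_elt_eq_iff mem)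
  qed
qed

lemma icontainer_id_hom: "icontainer_id I K \<in> icontainer_homs I K K"
  unfolding icontainer_homs_def icontainer_id_def
  using fam_id_hom[of "shp K"] by (auto simp: fam_hom_eq_Pi[symmetric] intro!: fam_Pi_lamI)

lemma icontainer_comp_hom:
  assumes f: "f \<in> icontainer_homs I K K'" and g: "g \<in> icontainer_homs I K' K''"
  shows "icontainer_comp I K K' K'' g f \<in> icontainer_homs I K K''"
proof -
  obtain \<sigma> \<pi> \<sigma>' \<pi>' where eq: "f = (\<sigma>, \<pi>)" "g = (\<sigma>', \<pi>')"
    by (metis surj_pair)
  note f = f[unfolded eq] and g = g[unfolded eq]
  have "fam_comp I (shp K) \<sigma>' \<sigma> \<in> fam_hom I (shp K) (shp K'')"
    unfolding fam_comp_def by (intro fam_hom_lamI shape_map_mem[OF g] shape_map_mem[OF f])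
  moreover have "fam_lam (shp K) (\<lambda>i s.
        fam_comp I (pos K'' i (\<sigma>' i (\<sigma> i s))) (\<pi> i s) (\<pi>' i (\<sigma> i s))) \<in>
      fam_Pi (shp K) (\<lambda>i s. fam_hom I (pos K'' i (fam_comp I (shp K) \<sigma>' \<sigma> i s)) (pos K i s))"
    by (rule fam_Pi_lamI, simp)
      (intro fam_comp_hom[OF position_map_hom[OF g] position_map_hom[OF f]] shape_map_mem[OF f])
  ultimately show ?thesis
    unfolding eq icontainer_homs_def icontainer_comp_def by (simp add: fam_hom_eq_Pi)
qed

text \<open>
  The Yoneda argument: a transformation into an extent is determined by its values on elements from
  which all others arise by functoriality.
\<close>

lemma trans_extent_yoneda:
  assumes \<alpha>: "\<alpha> \<in> Trans F (extent I (icontainer.truncate K))" and f: "U \<in> Fam" "X \<in> Fam" "f \<in> fam_hom I U X"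
    and u: "i \<in> elts I" "u \<in> elts (fobj F U i)"
  shows "\<alpha> X i (farr F U X f i u) =
    ext_elt K i (vfst (\<alpha> U i u)) (\<lambda>j q. f j (ext_fun K i (\<alpha> U i u) j q))"
proof -
  have "\<alpha> U i u \<in> elts (ext_obj K U i)"
    using fam_hom_mem[OF trans_hom[OF \<alpha> f(1)] u] f(1) by simp
  then obtain s h where eq: "\<alpha> U i u = ext_elt K i s h" and s: "s \<in> elts (shp K i)"
    and h: "h \<in> fam_hom I (pos K i s) U"
    using u(1) by (rule ext_obj_eltE)
  have "\<alpha> X i (farr F U X f i u) = farr (extent I (icontainer.truncate K)) U X f i (ext_elt K i s h)"
    using trans_natural[OF \<alpha> f u] by (simp add: eq)
  then show ?thesis
    using f u s unfolding eq by (simp add: farr_ext_obj fam_hom_mem[OF h] ext_elt_eq_iff)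
qed

lemma ext_obj_elt_eta:
  assumes "u \<in> elts (ext_obj K X i)" "i \<in> elts I"
  shows "ext_elt K i (vfst u) (ext_fun K i u) = u" "vfst u \<in> elts (shp K i)"
    "\<And>j q. j \<in> elts I \<Longrightarrow> q \<in> elts (pos K i (vfst u) j) \<Longrightarrow> ext_fun K i u j q \<in> elts (X j)"
  using ext_elt_eta[OF assms] by (simp_all add: ext_fun_def)

text \<open>Evaluation at the shape \<open>s\<close> labelled by its own positions returns an
  element with shape \<open>\<sigma> i s\<close> and labels \<open>\<pi> i s\<close>, so the
  morphism can be read back.\<close>

lemma cont_trans_inj:
  assumes K: "icontainer.truncate K \<in> icontainers I"
    and f: "f \<in> icontainer_homs I K K'" and g: "g \<in> icontainer_homs I K K'"
    and eq: "cont_trans K K' f = cont_trans K K' g"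
  shows "f = g"
proof -
  obtain \<sigma> \<pi> \<sigma>' \<pi>' where fg: "f = (\<sigma>, \<pi>)" "g = (\<sigma>', \<pi>')"
    by (metis surj_pair)
  note f = f[unfolded fg] and g = g[unfolded fg]
  have *: "\<sigma> i s = \<sigma>' i s \<and> (\<forall>j\<in>elts I. \<forall>q\<in>elts (pos K' i (\<sigma> i s) j). \<pi> i s j q = \<pi>' i s j q)"
    if i: "i \<in> elts I" and s: "s \<in> elts (shp K i)" for i s
  proof -
    note X = pos_Fam_of_icontainer[OF K i s]
    have "cont_trans K K' f (pos K i s) i (ext_elt K i s (\<lambda>j q. q)) =
        cont_trans K K' g (pos K i s) i (ext_elt K i s (\<lambda>j q. q))"
      by (simp only: eq)
    then show ?thesis
      unfolding fg by (simp add: cont_trans_app[OF f X i s] cont_trans_app[OF g X i s] ext_elt_eq_iff)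
  qed
  have "\<sigma> = \<sigma>'"
    using f g * by (intro fam_Pi_eqI[of \<sigma> "shp K" _ \<sigma>']) (auto simp: icontainer_homs_def)
  moreover have "\<pi> = \<pi>'"
  proof (rule fam_Pi_eqI)
    show "\<pi> \<in> fam_Pi (shp K) (\<lambda>i s. fam_hom I (pos K' i (\<sigma> i s)) (pos K i s))"
      "\<pi>' \<in> fam_Pi (shp K) (\<lambda>i s. fam_hom I (pos K' i (\<sigma>' i s)) (pos K i s))"
      using f g by (simp_all add: icontainer_homs_def)
    fix i s assume i: "i \<in> elts I" and s: "s \<in> elts (shp K i)"
    show "\<pi> i s = \<pi>' i s"
      using *[OF i s] position_map_hom[OF g i s]
      by (intro fam_hom_eqI[OF position_map_hom[OF f i s], of _ "pos K i s"]) auto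
  qed
  ultimately show ?thesis
    by (simp add: fg)
qed

text \<open>The value \<open>v i s\<close> at the self-labelled shape \<open>s\<close> determines
  the morphism: its shape defines \<open>\<sigma>\<close>, its labels, being positions of
  \<open>s\<close>, define \<open>\<pi>\<close>.\<close>

lemma cont_trans_surj:
  assumes K: "icontainer.truncate K \<in> icontainers I"
    and \<alpha>: "\<alpha> \<in> Trans (extent I (icontainer.truncate K)) (extent I (icontainer.truncate K'))"
  obtains f where "f \<in> icontainer_homs I K K'" "cont_trans K K' f = \<alpha>"
proof
  define v where "v i s = \<alpha> (pos K i s) i (ext_elt K i s (\<lambda>j q. q))" for i s
  define \<sigma> where "\<sigma> = fam_lam (shp K) (\<lambda>i s. vfst (v i s))"
  define \<pi> where "\<pi> = fam_lam (shp K) (\<lambda>i s. fam_lam (pos K' i (\<sigma> i s)) (ext_fun K' i (v i s)))"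
  have u: "ext_elt K i s (\<lambda>j q. q) \<in> elts (ext_obj K (pos K i s) i)"
    if "i \<in> elts I" "s \<in> elts (shp K i)" for i s
    using that by (intro ext_obj_eltI)
  have v: "v i s \<in> elts (ext_obj K' (pos K i s) i)" if i: "i \<in> elts I" "s \<in> elts (shp K i)" for i s
    unfolding v_def
    using fam_hom_mem[OF trans_hom[OF \<alpha> pos_Fam_of_icontainer[OF K i]], OF i(1)] u[OF i]
      pos_Fam_of_icontainer[OF K i]
    by simp
  have "\<sigma> \<in> fam_Pi (shp K) (\<lambda>i s. elts (shp K' i))"
    unfolding \<sigma>_def by (intro fam_Pi_lamI ext_obj_elt_eta(2)[OF v])
  moreover have "\<pi> \<in> fam_Pi (shp K) (\<lambda>i s. fam_hom I (pos K' i (\<sigma> i s)) (pos K i s))"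
    unfolding \<pi>_def
    by (intro fam_Pi_lamI fam_hom_lamI) (simp add: \<sigma>_def ext_obj_elt_eta(3)[OF v])
  ultimately show hom: "(\<sigma>, \<pi>) \<in> icontainer_homs I K K'"
    by (simp add: icontainer_homs_def)
  show "cont_trans K K' (\<sigma>, \<pi>) = \<alpha>"
  proof (rule trans_eqI[OF cont_trans_natural[OF hom] \<alpha>])
    fix X i w
    assume X: "X \<in> Fam" and i: "i \<in> elts I" and "w \<in> elts (fobj (extent I (icontainer.truncate K)) X i)"
    then have "w \<in> elts (ext_obj K X i)"
      by simp
    then obtain s h where w: "w = ext_elt K i s h" and s: "s \<in> elts (shp K i)"
      and h: "h \<in> fam_hom I (pos K i s) X"
      using i by (rule ext_obj_eltE)
    note U = pos_Fam_of_icontainer[OF K i s]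
    \<comment> \<open>Every element is the image of the self-labelled one under its own labelling
      \<open>h\<close>, so naturality determines \<open>\<alpha>\<close> at
      \<open>w\<close>.\<close>
    have "w = farr (extent I (icontainer.truncate K)) (pos K i s) X h i (ext_elt K i s (\<lambda>j q. q))"
      unfolding w using U X h i s by (simp add: farr_ext_obj)
    then have "\<alpha> X i w = ext_elt K' i (vfst (v i s)) (\<lambda>j q. h j (ext_fun K' i (v i s) j q))"
      using trans_extent_yoneda[OF \<alpha> U X h i, of "ext_elt K i s (\<lambda>j q. q)"] u[OF i s] U
      by (simp add: v_def)
    also have "\<dots> = ext_elt K' i (\<sigma> i s) (\<lambda>j q. h j (\<pi> i s j q))"
      using i s by (intro ext_elt_eqI) (simp_all add: \<sigma>_def \<pi>_def)
    also have "\<dots> = cont_trans K K' (\<sigma>, \<pi>) X i w"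
      unfolding w by (rule cont_trans_app[OF hom X i s, symmetric]) (rule fam_hom_mem[OF h])
    finally show "cont_trans K K' (\<sigma>, \<pi>) X i w = \<alpha> X i w" ..
  qed
qed

section \<open>Morphisms of container monad structures\<close>

context
  fixes M M' :: "'u icms" and \<sigma> \<pi>
  assumes typed: "icms_typed I M" and typed': "icms_typed I M'"
    and hom: "(\<sigma>, \<pi>) \<in> icontainer_homs I M M'"
begin

lemma cont_trans_unit:
  assumes X: "X \<in> Fam" and i: "i \<in> elts I" and x: "x \<in> elts (X i)"
  shows "cont_trans M M' (\<sigma>, \<pi>) X i (unit_trans M X i x) = ext_elt M' i (\<sigma> i (ie M i)) (\<lambda>j q. x)"
  unfolding unit_trans_app[OF typed X i x]
  by (rule cont_trans_app[OF hom X i ie_mem[OF typed i]]) (use x pos_ie[OF typed i] in auto)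

context
  fixes i s v
  assumes i: "i \<in> elts I" and s: "s \<in> elts (shp M i)" and v: "v \<in> fam_hom I (pos M i s) (shp M)"
begin

text \<open>The family written \<open>w\<close> in \<open>icms_homs\<close>, restricted in the same
  way so that the two are identical.\<close>

definition shape_fam :: "'u \<Rightarrow> 'u \<Rightarrow> 'u" where
  "shape_fam = fam_lam (pos M' i (\<sigma> i s)) (\<lambda>k q. \<sigma> k (v k (\<pi> i s k q)))"

lemma shape_fam_hom: "shape_fam \<in> fam_hom I (pos M' i (\<sigma> i s)) (shp M')"
  unfolding shape_fam_def
  by (intro fam_hom_lamI shape_map_mem[OF hom] fam_hom_mem[OF v]
      fam_hom_mem[OF position_map_hom[OF hom i s]])

context
  fixes X x
  assumes X: "X \<in> Fam"
    and x_all: "\<forall>k\<in>elts I. \<forall>q\<in>elts (pos M i s k). \<forall>j\<in>elts I. \<forall>r\<in>elts (pos M k (v k q) j).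
      x k q j r \<in> elts (X j)"
begin

text \<open>First side of the multiplication law: flatten in the source, then reindex. A target
  position is pulled back by \<open>\<pi>\<close> before it is decomposed.\<close>

lemma cont_trans_mult:
  "cont_trans M M' (\<sigma>, \<pi>) X i (mult_trans M X i
     (ext_elt M i s (\<lambda>k q. ext_elt M k (v k q) (x k q)))) =
   ext_elt M' i (\<sigma> i (ibul M i s v)) (\<lambda>j p. let p' = \<pi> i (ibul M i s v) j p in
     x (up M i s v j p') (nw M i s v j p') j (ne M i s v j p'))"
proof -
  note x = x_all[rule_format] and b = ibul_mem[OF typed i s v]
  note arrows = up_mem[OF typed i s v] nw_mem[OF typed i s v] ne_mem[OF typed i s v]
  have "mult_trans M X i (ext_elt M i s (\<lambda>k q. ext_elt M k (v k q) (x k q))) =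
      ext_elt M i (ibul M i s v) (\<lambda>j p. x (up M i s v j p) (nw M i s v j p) j (ne M i s v j p))"
    by (rule mult_trans_app[OF typed X i s v]) (simp_all add: x)
  moreover have "cont_trans M M' (\<sigma>, \<pi>) X i
      (ext_elt M i (ibul M i s v) (\<lambda>j p. x (up M i s v j p) (nw M i s v j p) j (ne M i s v j p))) =
      ext_elt M' i (\<sigma> i (ibul M i s v)) (\<lambda>j p.
        (\<lambda>j p. x (up M i s v j p) (nw M i s v j p) j (ne M i s v j p)) j (\<pi> i (ibul M i s v) j p))"
    by (rule cont_trans_app[OF hom X i b]) (simp add: x arrows)
  ultimately show ?thesis
    by (simp add: Let_def)
qed

text \<open>Second side: the morphism is applied under the outer layer, then to the outer layer, and
  the result is flattened in the target. A target position is decomposed first and its parts are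
  pulled back afterwards, which explains the nested \<open>\<pi>\<close>.\<close>

lemma mult_cont_trans:
  "mult_trans M' X i (cont_trans M M' (\<sigma>, \<pi>) (ext_obj M' X) i
     (farr (extent I (icontainer.truncate M)) (ext_obj M X) (ext_obj M' X) (cont_trans M M' (\<sigma>, \<pi>) X) i
       (ext_elt M i s (\<lambda>k q. ext_elt M k (v k q) (x k q))))) =
   ext_elt M' i (ibul M' i (\<sigma> i s) shape_fam) (\<lambda>j p.
     let k = up M' i (\<sigma> i s) shape_fam j p; q = nw M' i (\<sigma> i s) shape_fam j p;
         r = ne M' i (\<sigma> i s) shape_fam j p
     in x k (\<pi> i s k q) j (\<pi> k (v k (\<pi> i s k q)) j r))"
proof -
  let ?c = "cont_trans M M' (\<sigma>, \<pi>)"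
  note x = x_all[rule_format] and v_mem = fam_hom_mem[OF v] and s' = shape_map_mem[OF hom i s]
  note \<pi>_mem = fam_hom_mem[OF position_map_hom[OF hom]]
  note \<sigma>_mem = shape_map_mem[OF hom]
  have c_hom: "?c X \<in> fam_hom I (ext_obj M X) (ext_obj M' X)"
    using trans_hom[OF cont_trans_natural[OF hom] X] X by simp
  have c: "?c X k (ext_elt M k (v k q) (x k q)) =
      ext_elt M' k (\<sigma> k (v k q)) (\<lambda>j r. x k q j (\<pi> k (v k q) j r))"
    if k: "k \<in> elts I" "q \<in> elts (pos M i s k)" for k q
    by (rule cont_trans_app[OF hom X k(1) v_mem[OF k]]) (simp add: x k)
  have "farr (extent I (icontainer.truncate M)) (ext_obj M X) (ext_obj M' X) (?c X) i
      (ext_elt M i s (\<lambda>k q. ext_elt M k (v k q) (x k q))) =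
      ext_elt M i s (\<lambda>k q. ?c X k (ext_elt M k (v k q) (x k q)))"
    by (rule farr_ext_obj) (simp_all add: c_hom i s ext_obj_eltI v_mem x)
  also have "\<dots> = ext_elt M i s (\<lambda>k q. ext_elt M' k (\<sigma> k (v k q)) (\<lambda>j r. x k q j (\<pi> k (v k q) j r)))"
    by (rule ext_elt_eqI) (simp_all add: c)
  finally have 1: "farr (extent I (icontainer.truncate M)) (ext_obj M X) (ext_obj M' X) (?c X) i
      (ext_elt M i s (\<lambda>k q. ext_elt M k (v k q) (x k q))) =
      ext_elt M i s (\<lambda>k q. ext_elt M' k (\<sigma> k (v k q)) (\<lambda>j r. x k q j (\<pi> k (v k q) j r)))" .
  have 2: "?c (ext_obj M' X) i
      (ext_elt M i s (\<lambda>k q. ext_elt M' k (\<sigma> k (v k q)) (\<lambda>j r. x k q j (\<pi> k (v k q) j r)))) =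
      ext_elt M' i (\<sigma> i s) (\<lambda>k q. ext_elt M' k (\<sigma> k (v k (\<pi> i s k q)))
        (\<lambda>j r. x k (\<pi> i s k q) j (\<pi> k (v k (\<pi> i s k q)) j r)))"
    by (rule cont_trans_app[OF hom _ i s]) (simp_all add: ext_obj_eltI \<sigma>_mem \<pi>_mem v_mem x)
  have 3: "mult_trans M' X i (ext_elt M' i (\<sigma> i s) (\<lambda>k q. ext_elt M' k (\<sigma> k (v k (\<pi> i s k q)))
        (\<lambda>j r. x k (\<pi> i s k q) j (\<pi> k (v k (\<pi> i s k q)) j r)))) =
      ext_elt M' i (ibul M' i (\<sigma> i s) shape_fam) (\<lambda>j p.
        (\<lambda>k q j r. x k (\<pi> i s k q) j (\<pi> k (v k (\<pi> i s k q)) j r))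
          (up M' i (\<sigma> i s) shape_fam j p) (nw M' i (\<sigma> i s) shape_fam j p) j
          (ne M' i (\<sigma> i s) shape_fam j p))"
    by (rule mult_trans_app[OF typed' X i s' shape_fam_hom])
      (simp_all add: shape_fam_def x \<pi>_mem v_mem i s)
  show ?thesis
    by (simp add: 1 2 3 Let_def)
qed

end

end

text \<open>For naturality nothing remains to be compared; the unit law concerns only shapes, and
  the multiplication law holds for all labels as soon as it holds for composite positions labelled
  by themselves.\<close>

lemma cont_trans_hom_iff:
  assumes M: "monad_of M \<in> Obj (Mnd I)" and M': "monad_of M' \<in> Obj (Mnd I)"
  shows "cont_trans M M' (\<sigma>, \<pi>) \<in> Hom (Mnd I) (monad_of M) (monad_of M') \<longleftrightarrow>
    (\<sigma>, \<pi>) \<in> icms_homs I M M'"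
proof -
  let ?c = "cont_trans M M' (\<sigma>, \<pi>)" and ?T = "extent I (icontainer.truncate M)"
  have unit: "(\<forall>X\<in>Fam. \<forall>i\<in>elts I. \<forall>x\<in>elts (X i). ?c X i (unit_trans M X i x) = unit_trans M' X i x) \<longleftrightarrow>
      (\<forall>i\<in>elts I. \<sigma> i (ie M i) = ie M' i)"
  proof (intro iffI ballI)
    fix i assume i: "i \<in> elts I"
      and *: "\<forall>X\<in>Fam. \<forall>i\<in>elts I. \<forall>x\<in>elts (X i). ?c X i (unit_trans M X i x) = unit_trans M' X i x"
    \<comment> \<open>Any family with an element at index \<open>i\<close> would serve: labels are
      constant on both sides, so only the shapes are compared.\<close>
    have X: "(\<lambda>j\<in>elts I. vset {i}) \<in> Fam" and x: "i \<in> elts ((\<lambda>j\<in>elts I. vset {i}) i)"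
      using i by simp_all
    show "\<sigma> i (ie M i) = ie M' i"
      using *[rule_format, OF X i x]
      unfolding cont_trans_unit[OF X i x] unit_trans_app[OF typed' X i x] ext_elt_eq_iff by blast
  next
    fix X i x assume "\<forall>i\<in>elts I. \<sigma> i (ie M i) = ie M' i" and X: "X \<in> Fam" "i \<in> elts I" "x \<in> elts (X i)"
    then show "?c X i (unit_trans M X i x) = unit_trans M' X i x"
      by (simp add: cont_trans_unit[OF X] unit_trans_app[OF typed' X])
  qed
  define laws where "laws i s v \<longleftrightarrow>
      ibul M' i (\<sigma> i s) (shape_fam i s v) = \<sigma> i (ibul M i s v) \<and>
      (\<forall>j\<in>elts I. \<forall>p\<in>elts (pos M' i (\<sigma> i (ibul M i s v)) j).
         let k = up M' i (\<sigma> i s) (shape_fam i s v) j p; q = nw M' i (\<sigma> i s) (shape_fam i s v) j p;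
             r = ne M' i (\<sigma> i s) (shape_fam i s v) j p in
         k = up M i s v j (\<pi> i (ibul M i s v) j p) \<and>
         \<pi> i s k q = nw M i s v j (\<pi> i (ibul M i s v) j p) \<and>
         \<pi> k (v k (\<pi> i s k q)) j r = ne M i s v j (\<pi> i (ibul M i s v) j p))" for i s v
  have mult: "(\<forall>X\<in>Fam. \<forall>i\<in>elts I. \<forall>u\<in>elts (ext_obj M (ext_obj M X) i). ?c X i (mult_trans M X i u) =
      mult_trans M' X i (?c (ext_obj M' X) i (farr ?T (ext_obj M X) (ext_obj M' X) (?c X) i u))) \<longleftrightarrow>
    (\<forall>i\<in>elts I. \<forall>s\<in>elts (shp M i). \<forall>v\<in>fam_hom I (pos M i s) (shp M). laws i s v)"
  proof (intro iffI ballI)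
    fix i s v
    assume *: "\<forall>X\<in>Fam. \<forall>i\<in>elts I. \<forall>u\<in>elts (ext_obj M (ext_obj M X) i). ?c X i (mult_trans M X i u) =
      mult_trans M' X i (?c (ext_obj M' X) i (farr ?T (ext_obj M X) (ext_obj M' X) (?c X) i u))"
      and i: "i \<in> elts I" and s: "s \<in> elts (shp M i)" and v: "v \<in> fam_hom I (pos M i s) (shp M)"
    \<comment> \<open>Composite positions of \<open>s\<close> and \<open>v\<close> label themselves
      by \<open>x\<close>, so equal labels give the equations for all three arrows.\<close>
    define X where "X = (\<lambda>j\<in>elts I. vsigma I (\<lambda>k. vsigma (pos M i s k) (\<lambda>q. pos M k (v k q) j)))"
    define x where "x = (\<lambda>k q (j::'u) r::'u. vpair k (vpair q r))"
    have X: "X \<in> Fam"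
      by (simp add: X_def)
    have x: "\<forall>k\<in>elts I. \<forall>q\<in>elts (pos M i s k). \<forall>j\<in>elts I. \<forall>r\<in>elts (pos M k (v k q) j).
        x k q j r \<in> elts (X j)"
      by (simp add: X_def x_def)
    have "ext_elt M i s (\<lambda>k q. ext_elt M k (v k q) (x k q)) \<in> elts (ext_obj M (ext_obj M X) i)"
      by (intro ext_obj_eltI i s fam_hom_mem[OF v] x[rule_format])
    from *[rule_format, OF X i this] show "laws i s v"
      unfolding cont_trans_mult[OF i s v X x] mult_cont_trans[OF i s v X x]
      unfolding ext_elt_eq_iff laws_def Let_def x_def vpair_eq_iff
      \<comment> \<open>The monad morphism law states the equations in the opposite orientation;
        ordered rewriting with \<open>eq_commute\<close> brings both to a common form.\<close>
      by (simp (no_asm_use) only: eq_commute)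
  next
    fix X i u
    assume *: "\<forall>i\<in>elts I. \<forall>s\<in>elts (shp M i). \<forall>v\<in>fam_hom I (pos M i s) (shp M). laws i s v"
      and X: "X \<in> Fam" and i: "i \<in> elts I" and u: "u \<in> elts (ext_obj M (ext_obj M X) i)"
    from u i obtain s v x where u: "u = ext_elt M i s (\<lambda>k q. ext_elt M k (v k q) (x k q))"
      and s: "s \<in> elts (shp M i)" and v: "v \<in> fam_hom I (pos M i s) (shp M)"
      and x: "x \<in> fam_Pi (pos M i s) (\<lambda>k q. fam_hom I (pos M k (v k q)) X)"
      by (rule ext_obj_elt2E)
    have x: "\<forall>k\<in>elts I. \<forall>q\<in>elts (pos M i s k). \<forall>j\<in>elts I. \<forall>r\<in>elts (pos M k (v k q) j).
        x k q j r \<in> elts (X j)"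
      by (intro ballI fam_hom_mem[OF fam_Pi_mem[OF x]])
    note law = *[rule_format, OF i s v, unfolded laws_def Let_def]
    show "?c X i (mult_trans M X i u) =
        mult_trans M' X i (?c (ext_obj M' X) i (farr ?T (ext_obj M X) (ext_obj M' X) (?c X) i u))"
      unfolding u cont_trans_mult[OF i s v X x] mult_cont_trans[OF i s v X x] Let_def
      by (rule ext_elt_eqI, rule law[THEN conjunct1, symmetric],
          drule (1) law[THEN conjunct2, rule_format], elim conjE, simp)
  qed
  have "?c \<in> Trans ?T (extent I (icontainer.truncate M'))"
    by (rule cont_trans_natural[OF hom])
  then have "?c \<in> Hom (Mnd I) (monad_of M) (monad_of M') \<longleftrightarrow>
      (\<forall>i\<in>elts I. \<sigma> i (ie M i) = ie M' i) \<and>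
      (\<forall>i\<in>elts I. \<forall>s\<in>elts (shp M i). \<forall>v\<in>fam_hom I (pos M i s) (shp M). laws i s v)"
    using unit mult unfolding Mnd_hom_iff[OF M M'] by (simp add: Let_def)
  \<comment> \<open>The clause on \<open>pe\<close> equates two values of type \<open>unit\<close>
    and holds by simplification.\<close>
  also have "\<dots> \<longleftrightarrow> (\<sigma>, \<pi>) \<in> icms_homs I M M'"
    using hom unfolding icms_homs_def laws_def by (simp add: Let_def shape_fam_def)
  finally show ?thesis .
qed

end

section \<open>Monads on extents\<close>

text \<open>The structure consists of the shapes and labels of unit and multiplication at universal
  elements. By the Yoneda argument these values determine both transformations, so the original
  monad is recovered exactly.\<close>

lemma icms_of_monad:
  assumes N: "N \<in> Obj (Mnd I)" and K: "K \<in> icontainers I" and under: "underlying N = extent I K"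
  obtains M where "icms_typed I M" "icms_laws I M" "monad_of M = N"
proof -
  define \<eta> \<mu> where "\<eta> = mon_unit N" and "\<mu> = mon_mult N"
  let ?T = "extent I K"
  have \<eta>: "\<eta> \<in> Trans (id_functor (SetFam I)) ?T" and \<mu>: "\<mu> \<in> Trans (endo_comp ?T ?T) ?T"
    using N by (simp_all add: Mnd_obj_iff Let_def \<eta>_def \<mu>_def under)
  have trunc: "icontainer.truncate K = K"
    by (simp add: icontainer.defs)
  note yoneda = trans_extent_yoneda[where K = K, unfolded trunc]

  \<comment> \<open>\<open>U i\<close> is the representable family: a map \<open>U i \<rightarrow> X\<close> is an element of \<open>X i\<close>\<close>
  define U where "U i = (\<lambda>j\<in>elts I. vset (if j = i then {i} else {}))" for i
  have U: "U i \<in> Fam" for i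
    by (simp add: U_def)
  have U_elts: "elts (U i j) = (if j = i then {i} else {})" if "j \<in> elts I" for i j
    using that by (simp add: U_def)
  \<comment> \<open>The unit at the universal element \<open>i\<close> of \<open>U i\<close>. Its
    shape becomes the unit shape, and its labels witness that positions occur only at index
    \<open>i\<close>.\<close>
  define e where "e i = \<eta> (U i) i i" for i
  have e: "e i \<in> elts (extent_obj I K (U i) i)" if i: "i \<in> elts I" for i
    using fam_hom_mem[OF trans_hom[OF \<eta> U] i, of i i] U_elts[OF i, of i] U by (simp add: e_def)

  \<comment> \<open>\<open>P i s s'\<close> is the family of positions of the composite container at the shape \<open>(s, s')\<close>\<close>
  define P where "P i s s' = (\<lambda>j\<in>elts I. vsigma I (\<lambda>k. vsigma (pos K i s k) (\<lambda>q. pos K k (s' k q) j)))"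
    for i s s'
  have P: "P i s s' \<in> Fam" for i s s'
    by (simp add: P_def)
  \<comment> \<open>The universal element of the double extent, each composite position being
    labelled by itself. Its image \<open>m\<close> has the composite of \<open>s\<close> and
    \<open>s'\<close> as shape and triples as labels.\<close>
  define c where "c i s s' = ext_elt K i s (\<lambda>k q. ext_elt K k (s' k q) (\<lambda>j r. vpair k (vpair q r)))"
    for i s s'
  define m where "m i s s' = \<mu> (P i s s') i (c i s s')" for i s s'
  have c: "c i s s' \<in> elts (extent_obj I K (extent_obj I K (P i s s')) i)"
    if s: "i \<in> elts I" "s \<in> elts (shp K i)" "s' \<in> fam_hom I (pos K i s) (shp K)" for i s s'
    unfolding c_def by (intro ext_eltI s fam_hom_mem[OF s(3)]) (simp_all add: P_def)
  have m: "m i s s' \<in> elts (extent_obj I K (P i s s') i)"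
    if s: "i \<in> elts I" "s \<in> elts (shp K i)" "s' \<in> fam_hom I (pos K i s) (shp K)" for i s s'
    using fam_hom_mem[OF trans_hom[OF \<mu> P] s(1), of "c i s s'" i s s'] c[OF s] P by (simp add: m_def)

  define bul where "bul = fam_lam (shp K) (\<lambda>i s. \<lambda>s'\<in>fam_hom I (pos K i s) (shp K). vfst (m i s s'))"
  \<comment> \<open>One definition for all three arrows: \<open>f\<close> is the projection that
    extracts the wanted component of the triple labelling \<open>p\<close>. The restrictions give
    the extensionality demanded by \<open>icms_typed\<close>.\<close>
  define arrow where "arrow f = fam_lam (shp K) (\<lambda>i s. \<lambda>s'\<in>fam_hom I (pos K i s) (shp K).
    fam_lam (pos K i (bul i s s')) (\<lambda>j p. f (ext_fun K i (m i s s') j p)))" for f :: "'u \<Rightarrow> 'u"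
  define M where "M = \<lparr>shp = shp K, pos = pos K, ie = (\<lambda>i\<in>elts I. vfst (e i)), ibul = bul,
    pe = (\<lambda>i\<in>elts I. fam_lam (pos K i (vfst (e i))) (\<lambda>j q. ())),
    up = arrow vfst, nw = arrow (\<lambda>z. vfst (vsnd z)), ne = arrow (\<lambda>z. vsnd (vsnd z))\<rparr>"
  have M_sel [simp]: "shp M = shp K" "pos M = pos K" "ie M = (\<lambda>i\<in>elts I. vfst (e i))" "ibul M = bul"
    "pe M = (\<lambda>i\<in>elts I. fam_lam (pos K i (vfst (e i))) (\<lambda>j q. ()))"
    "up M = arrow vfst" "nw M = arrow (\<lambda>z. vfst (vsnd z))" "ne M = arrow (\<lambda>z. vsnd (vsnd z))"
    by (simp_all add: M_def)
  have trunc_M: "icontainer.truncate M = K"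
    by (simp add: icontainer.defs)
  have ext_elt_M: "ext_elt M = ext_elt K"
    by (intro HOL.ext) (simp add: ext_elt_def)

  have bul: "bul i s s' = vfst (m i s s')"
    if "i \<in> elts I" "s \<in> elts (shp K i)" "s' \<in> fam_hom I (pos K i s) (shp K)" for i s s'
    using that by (simp add: bul_def)
  have arrow: "arrow f i s s' j p = f (ext_fun K i (m i s s') j p)"
    if "i \<in> elts I" "s \<in> elts (shp K i)" "s' \<in> fam_hom I (pos K i s) (shp K)"
      "j \<in> elts I" "p \<in> elts (pos K i (bul i s s') j)" for f i s s' j p
    using that by (simp add: arrow_def)
  have arrow_mem: "arrow vfst i s s' j p \<in> elts I"
      "arrow (\<lambda>z. vfst (vsnd z)) i s s' j p \<in> elts (pos K i s (arrow vfst i s s' j p))"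
      "arrow (\<lambda>z. vsnd (vsnd z)) i s s' j p \<in> elts (pos K (arrow vfst i s s' j p)
        (s' (arrow vfst i s s' j p) (arrow (\<lambda>z. vfst (vsnd z)) i s s' j p)) j)"
    if s: "i \<in> elts I" "s \<in> elts (shp K i)" "s' \<in> fam_hom I (pos K i s) (shp K)"
      and p: "j \<in> elts I" "p \<in> elts (pos K i (bul i s s') j)" for i s s' j p
  proof -
    have "ext_fun K i (m i s s') j p \<in> elts (P i s s' j)"
      using ext_elt_eta(3)[OF m[OF s] s(1) p(1)] p(2) by (simp add: bul[OF s])
    then show "arrow vfst i s s' j p \<in> elts I"
      "arrow (\<lambda>z. vfst (vsnd z)) i s s' j p \<in> elts (pos K i s (arrow vfst i s s' j p))"
      "arrow (\<lambda>z. vsnd (vsnd z)) i s s' j p \<in> elts (pos K (arrow vfst i s s' j p)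
        (s' (arrow vfst i s s' j p) (arrow (\<lambda>z. vfst (vsnd z)) i s s' j p)) j)"
      using p(1) by (auto simp: arrow[OF s p] P_def)
  qed
  \<comment> \<open>The label of \<open>q\<close> is an element of \<open>U i j\<close>, which is
    empty unless \<open>j = i\<close>. This is what types \<open>pe\<close>.\<close>
  have e_pos: "j = i" if i: "i \<in> elts I" and j: "j \<in> elts I" "q \<in> elts (pos K i (vfst (e i)) j)" for i j q
    using ext_elt_eta(3)[OF e[OF i] i j] U_elts[OF j(1), of i] by (simp split: if_splits)

  have arrow_Pi: "arrow f \<in> (\<Pi>\<^sub>E i\<in>elts I. \<Pi>\<^sub>E s\<in>elts (shp K i). \<Pi>\<^sub>E s'\<in>fam_hom I (pos K i s) (shp K).
      \<Pi>\<^sub>E j\<in>elts I. \<Pi>\<^sub>E p\<in>elts (pos K i (bul i s s') j). B i s s' j p)"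
    if "\<And>i s s' j p. i \<in> elts I \<Longrightarrow> s \<in> elts (shp K i) \<Longrightarrow> s' \<in> fam_hom I (pos K i s) (shp K) \<Longrightarrow>
      j \<in> elts I \<Longrightarrow> p \<in> elts (pos K i (bul i s s') j) \<Longrightarrow> arrow f i s s' j p \<in> B i s s' j p" for f B
    using that by (intro PiE_I) (auto simp: arrow_def)
  have typed: "icms_typed I M"
    unfolding icms_typed_def trunc_M M_sel
  proof (intro conjI)
    show "(\<lambda>i\<in>elts I. vfst (e i)) \<in> (\<Pi>\<^sub>E i\<in>elts I. elts (shp K i))"
      by (simp add: ext_elt_eta(2)[OF e])
    show "bul \<in> (\<Pi>\<^sub>E i\<in>elts I. \<Pi>\<^sub>E s\<in>elts (shp K i).
        fam_hom I (pos K i s) (shp K) \<rightarrow>\<^sub>E elts (shp K i))"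
      unfolding bul_def by (simp add: ext_elt_eta(2)[OF m])
    show "(\<lambda>i\<in>elts I. fam_lam (pos K i (vfst (e i))) (\<lambda>j q. ())) \<in> (\<Pi>\<^sub>E i\<in>elts I. \<Pi>\<^sub>E j\<in>elts I.
        elts (pos K i ((\<lambda>i\<in>elts I. vfst (e i)) i) j) \<rightarrow>\<^sub>E {u. i = j})"
      by (auto dest: e_pos)
  qed (rule K | (rule arrow_Pi, rule arrow_mem; assumption))+

  have "unit_trans M = \<eta>"
  proof (rule trans_eqI[OF unit_trans_natural[OF typed] \<eta>])
    fix X i x
    assume X: "X \<in> Fam" and i: "i \<in> elts I" and "x \<in> elts (fobj (id_functor (SetFam I)) X i)"
    then have x: "x \<in> elts (X i)"
      by simp
    \<comment> \<open>The map out of the representable family that sends \<open>i\<close> to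
      \<open>x\<close>.\<close>
    define f where "f = fam_lam (U i) (\<lambda>j z. x)"
    have f: "f \<in> fam_hom I (U i) X"
      unfolding f_def using x by (intro fam_hom_lamI) (simp add: U_elts split: if_splits)
    have ii: "i \<in> elts (U i i)"
      by (simp add: U_elts[OF i])
    have "\<eta> X i x = \<eta> X i (farr (id_functor (SetFam I)) (U i) X f i i)"
      using U X f i ii by (simp add: f_def)
    also have "\<dots> = ext_elt K i (vfst (e i)) (\<lambda>j q. f j (ext_fun K i (e i) j q))"
      using yoneda[OF \<eta> U X f i, of i] U ii by (simp add: e_def)
    also have "\<dots> = ext_elt K i (vfst (e i)) (\<lambda>j q. x)"
      by (rule ext_elt_eqI) (simp_all add: f_def ext_elt_eta(3)[OF e[OF i] i])
    also have "\<dots> = unit_trans M X i x"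
      using i by (simp add: unit_trans_app[OF typed X i x] ext_elt_M)
    finally show "unit_trans M X i x = \<eta> X i x" ..
  qed
  moreover have "mult_trans M = \<mu>"
  proof (rule trans_eqI[OF mult_trans_natural[OF typed, unfolded trunc_M] \<mu>])
    fix X i u
    assume X: "X \<in> Fam" and i: "i \<in> elts I"
      and "u \<in> elts (fobj (endo_comp ?T ?T) X i)"
    then have "u \<in> elts (extent_obj I K (extent_obj I K X) i)"
      by simp
    then obtain s s' x where u: "u = ext_elt K i s (\<lambda>k q. ext_elt K k (s' k q) (x k q))"
      and s: "s \<in> elts (shp K i)" "s' \<in> fam_hom I (pos K i s) (shp K)"
      and x: "x \<in> fam_Pi (pos K i s) (\<lambda>k q. fam_hom I (pos K k (s' k q)) X)"
      using i by (rule ext_elt2E)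
    note x_mem = fam_hom_mem[OF fam_Pi_mem[OF x]]
    \<comment> \<open>The map that decodes a triple and returns its label under \<open>x\<close>; it
      carries the universal element \<open>c\<close> to \<open>u\<close>.\<close>
    define f where "f = fam_lam (P i s s') (\<lambda>j z. x (vfst z) (vfst (vsnd z)) j (vsnd (vsnd z)))"
    have f: "f \<in> fam_hom I (P i s s') X"
      unfolding f_def by (intro fam_hom_lamI) (auto simp: P_def x_mem)
    note Tf = farr_extent_hom[OF P X f]
    have "farr (endo_comp ?T ?T) (P i s s') X f i (c i s s') =
        farr ?T (extent_obj I K (P i s s')) (extent_obj I K X) (farr ?T (P i s s') X f) i (c i s s')"
      using P X f by simp
    also have "\<dots> = ext_elt K i s (\<lambda>k q. farr ?T (P i s s') X f k
        (ext_elt K k (s' k q) (\<lambda>j r. vpair k (vpair q r))))"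
      unfolding c_def
      by (rule farr_extent[OF _ _ Tf i s(1)]) (simp_all add: ext_eltI fam_hom_mem[OF s(2)] P_def)
    also have "\<dots> = u"
      unfolding u
    proof (rule ext_elt_eqI)
      fix k q assume k: "k \<in> elts I" "q \<in> elts (pos K i s k)"
      have mem: "vpair k (vpair q r) \<in> elts (P i s s' j)"
        if "j \<in> elts I" "r \<in> elts (pos K k (s' k q) j)" for j r
        using that k by (simp add: P_def)
      have "farr ?T (P i s s') X f k (ext_elt K k (s' k q) (\<lambda>j r. vpair k (vpair q r))) =
          ext_elt K k (s' k q) (\<lambda>j r. f j (vpair k (vpair q r)))"
        by (rule farr_extent[OF P X f k(1) fam_hom_mem[OF s(2) k]]) (rule mem)
      also have "\<dots> = ext_elt K k (s' k q) (x k q)"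
        by (rule ext_elt_eqI) (simp_all add: f_def mem)
      finally show "farr ?T (P i s s') X f k (ext_elt K k (s' k q) (\<lambda>j r. vpair k (vpair q r))) =
          ext_elt K k (s' k q) (x k q)" .
    qed simp
    finally have "\<mu> X i u = \<mu> X i (farr (endo_comp ?T ?T) (P i s s') X f i (c i s s'))"
      by simp
    also have "\<dots> = ext_elt K i (vfst (m i s s')) (\<lambda>j p. f j (ext_fun K i (m i s s') j p))"
      using yoneda[OF \<mu> P X f i, of "c i s s'"] c[OF i s] P by (simp add: m_def)
    also have "\<dots> = ext_elt K i (bul i s s') (\<lambda>j p. x (arrow vfst i s s' j p)
        (arrow (\<lambda>z. vfst (vsnd z)) i s s' j p) j (arrow (\<lambda>z. vsnd (vsnd z)) i s s' j p))"
      by (rule ext_elt_eqI)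
        (simp_all add: bul[OF i s] arrow[OF i s] f_def ext_elt_eta(3)[OF m[OF i s] i])
    also have "\<dots> = mult_trans M X i u"
      using mult_trans_elt[OF typed X i, of s s' x] s x by (simp add: u ext_elt_M)
    finally show "mult_trans M X i u = \<mu> X i u" ..
  qed
  ultimately have "monad_of M = N"
    by (simp add: monad_of_def trunc_M under[symmetric] \<eta>_def \<mu>_def)
  \<comment> \<open>The laws need no separate computation: they follow from the monad laws of
    \<open>N\<close> once \<open>monad_of M = N\<close> is known.\<close>
  then show thesis
    using that typed icms_laws_of_monad[OF typed] N by blast
qed

end

section \<open>The equivalence\<close>

text \<open>For \<open>D\<close> only the typing of identities and composites is assumed; its laws
  are reflected along the faithful \<open>g\<close>. Surjectivity on objects is strict, so the
  quasi-inverse is a section and one of the two natural isomorphisms is the identity.\<close>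

lemma equivalent_categories_of_fully_faithful_surjective:
  fixes C :: "('o, 'a, 'y) category_scheme" and D :: "('p, 'b, 'z) category_scheme"
  assumes C: "is_category C"
    and obj: "\<And>X. X \<in> Obj D \<Longrightarrow> G X \<in> Obj C"
    and surj: "\<And>Y. Y \<in> Obj C \<Longrightarrow> \<exists>X\<in>Obj D. G X = Y"
    and bij: "\<And>X Y. X \<in> Obj D \<Longrightarrow> Y \<in> Obj D \<Longrightarrow>
      bij_betw (g X Y) (Hom D X Y) (Hom C (G X) (G Y))"
    and ident: "\<And>X. X \<in> Obj D \<Longrightarrow> Ident D X \<in> Hom D X X"
    and g_ident: "\<And>X. X \<in> Obj D \<Longrightarrow> g X X (Ident D X) = Ident C (G X)"
    and comp: "\<And>X Y Z p q. X \<in> Obj D \<Longrightarrow> Y \<in> Obj D \<Longrightarrow> Z \<in> Obj D \<Longrightarrow>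
      p \<in> Hom D X Y \<Longrightarrow> q \<in> Hom D Y Z \<Longrightarrow> Comp D X Y Z q p \<in> Hom D X Z"
    and g_comp: "\<And>X Y Z p q. X \<in> Obj D \<Longrightarrow> Y \<in> Obj D \<Longrightarrow> Z \<in> Obj D \<Longrightarrow>
      p \<in> Hom D X Y \<Longrightarrow> q \<in> Hom D Y Z \<Longrightarrow>
      g X Z (Comp D X Y Z q p) = Comp C (G X) (G Y) (G Z) (g Y Z q) (g X Y p)"
  shows "equivalent_categories C D"
proof -
  have C_ident: "Ident C X \<in> Hom C X X" if "X \<in> Obj C" for X
    using C that by (simp add: is_category_def)
  have C_comp: "Comp C X Y Z q p \<in> Hom C X Z"
    if "X \<in> Obj C" "Y \<in> Obj C" "Z \<in> Obj C" "p \<in> Hom C X Y" "q \<in> Hom C Y Z" for X Y Z p q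
    using C that by (simp add: is_category_def)
  have C_unit: "Comp C X X Y p (Ident C X) = p" "Comp C X Y Y (Ident C Y) p = p"
    if "X \<in> Obj C" "Y \<in> Obj C" "p \<in> Hom C X Y" for X Y p
    using C that by (simp_all add: is_category_def)
  have C_assoc: "Comp C W X Z (Comp C X Y Z r q) p = Comp C W Y Z r (Comp C W X Y q p)"
    if "W \<in> Obj C" "X \<in> Obj C" "Y \<in> Obj C" "Z \<in> Obj C"
      "p \<in> Hom C W X" "q \<in> Hom C X Y" "r \<in> Hom C Y Z" for W X Y Z p q r
    using C that by (simp add: is_category_def)
  have g: "g X Y p \<in> Hom C (G X) (G Y)" if "X \<in> Obj D" "Y \<in> Obj D" "p \<in> Hom D X Y" for X Y p
    using bij[OF that(1,2)] that(3) by (rule bij_betw_apply)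
  have faithful: "p = q"
    if "X \<in> Obj D" "Y \<in> Obj D" "p \<in> Hom D X Y" "q \<in> Hom D X Y" "g X Y p = g X Y q" for X Y p q
    using bij_betw_imp_inj_on[OF bij[OF that(1,2)]] that(3-5) by (simp add: inj_on_def)
  have D: "is_category D"
    unfolding is_category_def
  proof (intro conjI ballI)
    fix X Y p assume X: "X \<in> Obj D" "Y \<in> Obj D" "p \<in> Hom D X Y"
    \<comment> \<open>Both sides have the same image under \<open>g\<close>, where the law of
      \<open>C\<close> applies; the other laws of \<open>D\<close> are obtained in the same
      way.\<close>
    show "Comp D X X Y p (Ident D X) = p"
      by (rule faithful[of X Y]) (simp_all add: X comp ident g_comp g_ident C_unit obj g)
    show "Comp D X Y Y (Ident D Y) p = p"
      by (rule faithful[of X Y]) (simp_all add: X comp ident g_comp g_ident C_unit obj g)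
  next
    fix W X Y Z p q r
    assume X: "W \<in> Obj D" "X \<in> Obj D" "Y \<in> Obj D" "Z \<in> Obj D"
      "p \<in> Hom D W X" "q \<in> Hom D X Y" "r \<in> Hom D Y Z"
    have "Comp D X Y Z r q \<in> Hom D X Z" "Comp D W X Y q p \<in> Hom D W Y"
      using X by (auto intro: comp)
    then show "Comp D W X Z (Comp D X Y Z r q) p = Comp D W Y Z r (Comp D W X Y q p)"
      using X by (intro faithful[of W Z])
        (simp_all add: comp[of W X Z] comp[of W Y Z] g_comp C_assoc obj g)
  qed (simp_all add: ident comp)

  \<comment> \<open>A chosen strict preimage on objects; on arrows, \<open>l\<close> inverts the
    bijections on hom-sets.\<close>
  define F where "F Y = (SOME X. X \<in> Obj D \<and> G X = Y)" for Y
  have F: "F Y \<in> Obj D" "G (F Y) = Y" if "Y \<in> Obj C" for Y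
    using someI_ex[of "\<lambda>X. X \<in> Obj D \<and> G X = Y"] surj[OF that] unfolding F_def by auto
  define l where "l X Y = inv_into (Hom D X Y) (g X Y)" for X Y
  have l: "l X Y r \<in> Hom D X Y" "g X Y (l X Y r) = r"
    if "X \<in> Obj D" "Y \<in> Obj D" "r \<in> Hom C (G X) (G Y)" for X Y r
    using bij[OF that(1,2)] that(3) unfolding l_def
    by (auto simp: bij_betw_def inv_into_into f_inv_into_f)
  have l_eq: "l X Y r = p"
    if "X \<in> Obj D" "Y \<in> Obj D" "p \<in> Hom D X Y" "g X Y p = r" for X Y r p
    using faithful[of X Y "l X Y r" p] l[of X Y r] g[OF that(1-3)] that by simp

  let ?G = "\<lparr>fobj = \<lambda>X\<in>Obj D. G X,
    farr = \<lambda>X\<in>Obj D. \<lambda>Y\<in>Obj D. \<lambda>p\<in>Hom D X Y. g X Y p\<rparr>"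
  let ?F = "\<lparr>fobj = \<lambda>Y\<in>Obj C. F Y,
    farr = \<lambda>X\<in>Obj C. \<lambda>Y\<in>Obj C. \<lambda>r\<in>Hom C X Y. l (F X) (F Y) r\<rparr>"
  have G_functor: "?G \<in> functors D C"
    unfolding functors_def by (simp add: obj g ident g_ident comp g_comp)
  have lF: "l (F X) (F Y) r \<in> Hom D (F X) (F Y)" "g (F X) (F Y) (l (F X) (F Y) r) = r"
    if "X \<in> Obj C" "Y \<in> Obj C" "r \<in> Hom C X Y" for X Y r
    using l[of "F X" "F Y" r] F that by auto
  have lF_ident: "l (F X) (F X) (Ident C X) = Ident D (F X)" if "X \<in> Obj C" for X
    by (rule l_eq) (simp_all add: that F ident g_ident)
  have lF_comp: "l (F X) (F Z) (Comp C X Y Z q p) =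
      Comp D (F X) (F Y) (F Z) (l (F Y) (F Z) q) (l (F X) (F Y) p)"
    if X: "X \<in> Obj C" "Y \<in> Obj C" "Z \<in> Obj C" "p \<in> Hom C X Y" "q \<in> Hom C Y Z" for X Y Z p q
    by (rule l_eq) (simp_all add: X F lF comp g_comp)
  have F_functor: "?F \<in> functors C D"
    unfolding functors_def by (simp add: F lF lF_ident lF_comp C_ident C_comp)

  have "naturally_isomorphic C C (comp_functor C ?G ?F) (id_functor C)"
    unfolding naturally_isomorphic_def
  proof (intro bexI[of _ "\<lambda>X\<in>Obj C. Ident C X"] ballI)
    show "(\<lambda>X\<in>Obj C. Ident C X) \<in> nat_trans C C (comp_functor C ?G ?F) (id_functor C)"
      unfolding nat_trans_def comp_functor_def id_functor_def
      by (simp add: F lF C_ident C_unit)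
    show "is_iso C (fobj (comp_functor C ?G ?F) X) (fobj (id_functor C) X) ((\<lambda>X\<in>Obj C. Ident C X) X)"
      if "X \<in> Obj C" for X
      using that C_ident[OF that] C_unit[OF that that C_ident[OF that]]
      unfolding is_iso_def comp_functor_def id_functor_def by (auto simp: F)
  qed
  moreover have "naturally_isomorphic D D (comp_functor D ?F ?G) (id_functor D)"
  proof -
    \<comment> \<open>\<open>F (G X)\<close> may differ from \<open>X\<close>, but \<open>G\<close>
      identifies them; full faithfulness lifts the identity of \<open>G X\<close> to mutually
      inverse arrows between the two. Naturality and inverse laws are checked after applying
      \<open>g\<close>.\<close>
    let ?a = "\<lambda>X. l (F (G X)) X (Ident C (G X))" and ?b = "\<lambda>X. l X (F (G X)) (Ident C (G X))"
    have FG: "F (G X) \<in> Obj D" "G (F (G X)) = G X" if "X \<in> Obj D" for X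
      using F obj that by auto
    have a: "?a X \<in> Hom D (F (G X)) X" "g (F (G X)) X (?a X) = Ident C (G X)"
      and b: "?b X \<in> Hom D X (F (G X))" "g X (F (G X)) (?b X) = Ident C (G X)"
      if X: "X \<in> Obj D" for X
      using l[OF FG(1)[OF X] X] l[OF X FG(1)[OF X]] C_ident[OF obj[OF X]] FG[OF X] by auto
    have ll: "l (F (G X)) (F (G Y)) (g X Y p) \<in> Hom D (F (G X)) (F (G Y))"
      "g (F (G X)) (F (G Y)) (l (F (G X)) (F (G Y)) (g X Y p)) = g X Y p"
      if "X \<in> Obj D" "Y \<in> Obj D" "p \<in> Hom D X Y" for X Y p
      using lF[OF obj obj g] that by auto
    have nat: "Comp D (F (G X)) (F (G Y)) Y (?a Y) (l (F (G X)) (F (G Y)) (g X Y p)) =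
        Comp D (F (G X)) X Y p (?a X)"
      if X: "X \<in> Obj D" "Y \<in> Obj D" "p \<in> Hom D X Y" for X Y p
      using X a ll g[OF X] FG obj
      by (intro faithful[of "F (G X)" Y]) (simp_all add: comp g_comp C_unit)
    have iso: "Comp D (F (G X)) X (F (G X)) (?b X) (?a X) = Ident D (F (G X))"
      "Comp D X (F (G X)) X (?a X) (?b X) = Ident D X" if X: "X \<in> Obj D" for X
      using X a b FG obj C_ident[OF obj[OF X]]
      by (intro faithful[of "F (G X)" "F (G X)"] faithful[of X X];
          simp add: comp ident g_comp g_ident C_unit)+
    show ?thesis
      unfolding naturally_isomorphic_def
    proof (intro bexI[of _ "\<lambda>X\<in>Obj D. ?a X"] ballI)
      show "(\<lambda>X\<in>Obj D. ?a X) \<in> nat_trans D D (comp_functor D ?F ?G) (id_functor D)"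
        unfolding nat_trans_def comp_functor_def id_functor_def
        by (simp add: a nat obj g)
      show "is_iso D (fobj (comp_functor D ?F ?G) X) (fobj (id_functor D) X) ((\<lambda>X\<in>Obj D. ?a X) X)"
        if X: "X \<in> Obj D" for X
        using X a(1)[OF X] b(1)[OF X] iso[OF X]
        unfolding is_iso_def comp_functor_def id_functor_def by (auto simp: obj)
    qed
  qed
  ultimately show ?thesis
    unfolding equivalent_categories_def using C D F_functor G_functor by blast
qed

lemma is_category_full_subcategory: "is_category C \<Longrightarrow> is_category (full_subcategory C A)"
  unfolding is_category_def full_subcategory_def by simp

theorem theorem3p10:
  fixes I :: "'u::grothendieck_universe"
  shows "equivalent_categories
           (full_subcategory (Mnd I) {M. \<exists>K\<in>icontainers I. underlying M = extent I K})
           (ICMS I)"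
proof -
  let ?C = "full_subcategory (Mnd I) {M. \<exists>K\<in>icontainers I. underlying M = extent I K}"
  have C_simps: "Obj ?C = Obj (Mnd I) \<inter> {M. \<exists>K\<in>icontainers I. underlying M = extent I K}"
    "Hom ?C = Hom (Mnd I)" "Ident ?C = Ident (Mnd I)" "Comp ?C = Comp (Mnd I)"
    by (simp_all add: full_subcategory_def)
  have D_simps: "Obj (ICMS I) = {M. icms_typed I M \<and> icms_laws I M}" "Hom (ICMS I) = icms_homs I"
    "Ident (ICMS I) = icontainer_id I" "Comp (ICMS I) = icontainer_comp I"
    by (simp_all add: ICMS_def)
  have cont: "icontainer.truncate M \<in> icontainers I" if "icms_typed I M" for M
    using that unfolding icms_typed_def by (elim conjE)
  have monad: "monad_of I M \<in> Obj (Mnd I)" if "M \<in> Obj (ICMS I)" for M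
    using that by (simp add: D_simps monad_of_obj)
  have typed: "icms_typed I M" if "M \<in> Obj (ICMS I)" for M
    using that by (simp add: D_simps)
  have homs: "icms_homs I M M' \<subseteq> icontainer_homs I M M'" for M M'
    unfolding icms_homs_def by blast
  have iff: "cont_trans I M M' f \<in> Hom (Mnd I) (monad_of I M) (monad_of I M') \<longleftrightarrow> f \<in> icms_homs I M M'"
    if "M \<in> Obj (ICMS I)" "M' \<in> Obj (ICMS I)" "f \<in> icontainer_homs I M M'" for M M' f
    using cont_trans_hom_iff[OF typed[OF that(1)] typed[OF that(2)] _ monad[OF that(1)] monad[OF that(2)]]
      that(3) by (cases f) blast
  have ct_id: "cont_trans I M M (icontainer_id I M) = Ident (Mnd I) (monad_of I M)" for M
    by (auto simp: cont_trans_id Mnd_simps intro!: restrict_ext)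
  have ct_comp: "cont_trans I L N (icontainer_comp I L M N g f) =
      Comp (Mnd I) (monad_of I L) (monad_of I M) (monad_of I N) (cont_trans I M N g) (cont_trans I L M f)"
    if "f \<in> icms_homs I L M" "g \<in> icms_homs I M N" for L M N f g
    using cont_trans_comp[OF subsetD[OF homs that(1)] subsetD[OF homs that(2)]]
    by (auto simp: Mnd_simps intro!: restrict_ext)
  show ?thesis
  proof (rule equivalent_categories_of_fully_faithful_surjective[where G = "monad_of I" and g = "cont_trans I"])
    show "is_category ?C"
      by (rule is_category_full_subcategory[OF is_category_Mnd])
    show "monad_of I M \<in> Obj ?C" if "M \<in> Obj (ICMS I)" for M
      using monad[OF that] cont[OF typed[OF that]] by (auto simp: C_simps)
    show "\<exists>M\<in>Obj (ICMS I). monad_of I M = N" if "N \<in> Obj ?C" for N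
    proof -
      from that obtain K where "N \<in> Obj (Mnd I)" "K \<in> icontainers I" "underlying N = extent I K"
        by (auto simp: C_simps)
      then obtain M where "icms_typed I M" "icms_laws I M" "monad_of I M = N"
        by (rule icms_of_monad)
      then show ?thesis
        by (auto simp: D_simps)
    qed
    show "bij_betw (cont_trans I M M') (Hom (ICMS I) M M') (Hom ?C (monad_of I M) (monad_of I M'))"
      if M: "M \<in> Obj (ICMS I)" "M' \<in> Obj (ICMS I)" for M M'
      unfolding bij_betw_def C_simps D_simps
    proof (intro conjI subset_antisym subsetI)
      show "inj_on (cont_trans I M M') (icms_homs I M M')"
        using cont_trans_inj[OF cont[OF typed[OF M(1)]]] homs by (intro inj_onI) blast
      show "\<alpha> \<in> Hom (Mnd I) (monad_of I M) (monad_of I M')"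
        if "\<alpha> \<in> cont_trans I M M' ` icms_homs I M M'" for \<alpha>
        using that iff[OF M] homs by blast
      show "\<alpha> \<in> cont_trans I M M' ` icms_homs I M M'"
        if \<alpha>: "\<alpha> \<in> Hom (Mnd I) (monad_of I M) (monad_of I M')" for \<alpha>
      proof -
        have "\<alpha> \<in> nat_trans (SetFam I) (SetFam I)
            (extent I (icontainer.truncate M)) (extent I (icontainer.truncate M'))"
          using \<alpha> by (simp add: Mnd_hom_iff[OF monad[OF M(1)] monad[OF M(2)]] Let_def)
        then obtain f where "f \<in> icontainer_homs I M M'" "cont_trans I M M' f = \<alpha>"
          by (rule cont_trans_surj[OF cont[OF typed[OF M(1)]]])
        \<comment> \<open>As a natural transformation, \<open>\<alpha>\<close> comes from a
          container morphism; being a monad morphism, it forces that morphism to respect the ICMS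
          structure.\<close>
        then show ?thesis
          using iff[OF M] \<alpha> by blast
      qed
    qed
    show "Ident (ICMS I) M \<in> Hom (ICMS I) M M" if M: "M \<in> Obj (ICMS I)" for M
      using iff[OF M M icontainer_id_hom] Ident_Mnd_hom[OF monad[OF M]] by (simp add: D_simps ct_id)
    show "cont_trans I M M (Ident (ICMS I) M) = Ident ?C (monad_of I M)" for M
      by (simp add: C_simps D_simps ct_id)
    fix L M N f g
    assume M: "L \<in> Obj (ICMS I)" "M \<in> Obj (ICMS I)" "N \<in> Obj (ICMS I)"
      and fg: "f \<in> Hom (ICMS I) L M" "g \<in> Hom (ICMS I) M N"
    have f: "f \<in> icms_homs I L M" and g: "g \<in> icms_homs I M N"
      using fg by (simp_all add: D_simps)
    note fc = subsetD[OF homs f] and gc = subsetD[OF homs g]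
    show "cont_trans I L N (Comp (ICMS I) L M N g f) =
        Comp ?C (monad_of I L) (monad_of I M) (monad_of I N) (cont_trans I M N g) (cont_trans I L M f)"
      by (simp add: C_simps D_simps ct_comp[OF f g])
    \<comment> \<open>Closure of ICMS morphisms under composition is not checked on arrows: the
      image is a composite of monad morphisms, and \<open>iff\<close> reflects this back.\<close>
    have "cont_trans I L N (icontainer_comp I L M N g f) \<in> Hom (Mnd I) (monad_of I L) (monad_of I N)"
      unfolding ct_comp[OF f g] using iff[OF M(1,2) fc] iff[OF M(2,3) gc] f g M
      by (intro Comp_Mnd_hom monad) simp_all
    then show "Comp (ICMS I) L M N g f \<in> Hom (ICMS I) L N"
      using iff[OF M(1,3) icontainer_comp_hom[OF fc gc]] by (simp add: D_simps)
  qed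
qed

end
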